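(* Let $\mathbf{S}$ be a once-punctured disk with puncture $p$ and $n$ boundary marked points, $\mathbf{T}$ a triangulation of $\mathbf{S}$, $i\in\mathbf{T}$ an arc incident to $p$, and $(\tilde{\mathbf{S}}_i,\tilde{\mathbf{T}})$ the associated triangulated polygon. Let $a\in\mathbf{T}$, $a\neq i$, be an arc that is not the radius of a self-folded triangle, and let $a,\hat a\in\tilde{\mathbf{T}}$ be its two copies. Then (a) $\widetilde{\mu_a(\mathbf{T})}=\mu_a\mu_{\hat a}(\tilde{\mathbf{T}})$, where $\widetilde{\mu_a(\mathbf{T})}$ is constructed from $\mu_a(\mathbf{T})$ by cutting along the same arc $i$; (b) $\mu_a\mu_{\hat a}(g(\mathfrak{F}_{\mathbf{T}}))=g(\mathfrak{F}_{\mu_a(\mathbf{T})})$, where $\mu_a\mu_{\hat a}(g(\mathfrak{F}_{\mathbf{T}}))$ denotes the sub-pattern of the frieze $\mu_a\mu_{\hat a}(\mathfrak{F}_{\tilde{\mathbf{T}}})=\mathfrak{F}_{\mu_a\mu_{\hat a}(\tilde{\mathbf{T}})}$ occupying the same positions that $g(\mathfrak{F}_{\mathbf{T}})$ occupies in $\mathfrak{F}_{\tilde{\mathbf{T}}}$. In particular, $\mu_a(\mathfrak{F}_{\mathbf{T}})$ is obtained by ungluing the sub-pattern $g(\mathfrak{F}_{\mu_a(\mathbf{T})})$ contained in $\mu_a\mu_{\hat a}(\mathfrak{F}_{\tilde{\mathbf{T}}})$.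
   Context: Arcs, triangulations (ideal, possibly with self-folded triangles: a radius from a boundary point to $p$ enclosed by a loop), and quiddity sequences are as usual: the quiddity entry at a boundary marked point is the number of regions of the complement of the triangulation visible near that point. Mutation: for a triangulation $\mathbf{T}$ and an arc $a\in\mathbf{T}$ that is not the radius of a self-folded triangle, there is a unique arc $a'\ne a$ with $\mu_a(\mathbf{T})=\mathbf{T}\setminus\{a\}\cup\{a'\}$ a triangulation. For a triangulation $\mathbf{T}$ with associated frieze $\mathfrak{F}_{\mathbf{T}}$ (type $A$ for a polygon, type $D$ for a once-punctured disk), $\mu_a(\mathfrak{F}_{\mathbf{T}}):=\mathfrak{F}_{\mu_a(\mathbf{T})}$. A frieze of type $A_m$: rows $0,1$, then $m$ nontrivial rows of positive integers, then rows $1,0$, consecutive rows offset a half step, every diamond $\begin{smallmatrix}&a\\ b&&c\\ &d\end{smallmatrix}$ satisfying $bc-ad=1$; a triangulated $N$-gon gives one of type $A_{N-3}$ with first nontrivial row the quiddity sequence. A frieze of type $D_n$: a row of $0$'s, a row of $1$'s, then $n$ nontrivial rows; the first $n$ rows satisfy the diamond rule; the last two nontrivial rows $n-1,n$ are vertically aligned and satisfy: for $a$ in row $n-2$ above neighbouring $b,c$ in row $n-1$ with $d,e$ in row $n$ below $b,c$, $bc-a=de-a=1$; for $b,c$ in row $n-2$ with $a$ above them in row $n-3$, $d$ below them in row $n-1$ and $e$ below $d$ in row $n$, $bc-ade=1$. $\mathfrak{F}_{\mathbf{T}}$ for a triangulated once-punctured disk has first nontrivial row the quiddity sequence; the rest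 is then uniquely determined using these relations and the number of triangles at $p$. Type $D$ friezes are considered up to horizontal translation and interchange of the last two rows. Entries of the last two rows correspond to arcs incident to $p$ or loops around $p$, and an entry equals $1$ iff its arc lies in $\mathbf{T}$. Glued pattern $g(\mathfrak{F})$: keep the trivial rows and nontrivial rows $1,\dots,n-2$ of the type $D_n$ frieze $\mathfrak{F}$ and replace the last two rows by one row of products $a_{n-1,j}a_{n,j}$ of vertically aligned entries. Ungluing: given $g(\mathfrak{F})$ and an entry of its last row one of whose factors is known to be $1$ (e.g. the one corresponding to the arc $i$), set that factor $a_{n,j}=1$; then $a_{n,j-1}=1+a_{n-2,j}$ and $a_{n-1,j-1}=(1+a_{n-2,j})/a_{n-1,j}$, and iterating leftwards recovers $\mathfrak{F}$ up to interchanging its last two rows. Construction of $(\tilde{\mathbf{S}}_i,\tilde{\mathbf{T}})$: label boundary points of $\mathbf{S}$ by $1,\dots,n$ counterclockwise with $1$ the boundary endpoint of $i$. Cutting along $i$ gives a polygon $\mathbf{S}_i$ with vertices $x,2,\dots,n,y,p$ counterclockwise ($x,y$ the two copies of $1$), triangulated by $\mathbf{T}\setminus\{i\}$. $\tilde{\mathbf{S}}_i$ is the $(2n+2)$-gon with vertices $w_0=p,w_1,\dots,w_{2n+1}$ counterclockwise obtained by gluing two copies of $\mathbf{S}_i$: the first via $p\mapsto w_0,x\mapsto w_1,k\mapsto w_k,y\mapsto w_{n+1}$, the second via $p\mapsto w_0,x\mapsto w_{n+1},k\mapsto w_{n+k},y\mapsto w_{2n+1}$. Its triangulation $\tilde{\mathbf{T}}$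 consists of the image $\gamma$ in the first copy and $\hat\gamma$ in the second copy of each $\gamma\in\mathbf{T}\setminus\{i\}$, plus the diameter $i=w_0w_{n+1}$. $\mathfrak{F}_{\tilde{\mathbf{T}}}$ is its frieze of type $A_{2n-1}$; $g(\mathfrak{F}_{\mathbf{T}})$ appears as a connected region of $\mathfrak{F}_{\tilde{\mathbf{T}}}$, namely inside the first $n-1$ nontrivial rows below the quiddity entries at $w_2,\dots,w_{2n}$. *)

theory Defs
  imports Complex_Main "HOL-Library.Extended"
begin

section \<open>Arcs as pairs of endpoints, triangulations, mutation\<close>

text \<open>
  An arc of a polygon, or an arc of the universal cover of the punctured disk, is determined by
  its two endpoints. The vertices are linearly ordered along the boundary, and two arcs cross
  iff their endpoints interlace.
\<close>

definition crosses :: "'v::linorder set \<Rightarrow> 'v set \<Rightarrow> bool" where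
  "crosses e f \<longleftrightarrow> (\<exists>u x v y. u < x \<and> x < v \<and> v < y \<and>
     (e = {u, v} \<and> f = {x, y} \<or> e = {x, y} \<and> f = {u, v}))"

definition is_triangulation :: "'a set \<Rightarrow> ('a \<Rightarrow> 'a \<Rightarrow> bool) \<Rightarrow> 'a set \<Rightarrow> bool" where
  "is_triangulation arcs cr T \<longleftrightarrow>
     T \<subseteq> arcs \<and> (\<forall>a\<in>T. \<forall>b\<in>T. \<not> cr a b) \<and>
     (\<forall>c\<in>arcs. (\<forall>a\<in>T. \<not> cr a c \<and> \<not> cr c a) \<longrightarrow> c \<in> T)"

definition mutate :: "('a set \<Rightarrow> bool) \<Rightarrow> 'a \<Rightarrow> 'a set \<Rightarrow> 'a set" where
  "mutate tri a T = T - {a} \<union> {THE a'. a' \<noteq> a \<and> tri (T - {a} \<union> {a'})}"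

text \<open>
  The regions of a triangulation are the triangles, i.e. the triples of vertices that are pairwise
  joined; \<open>E\<close> consists of the arcs of the triangulation together with the boundary segments.
\<close>

definition triangles :: "'v set set \<Rightarrow> 'v set set" where
  "triangles E = {t. card t = 3 \<and> (\<forall>u\<in>t. \<forall>v\<in>t. u \<noteq> v \<longrightarrow> {u, v} \<in> E)}"


section \<open>Polygons\<close>

text \<open>The vertices of the \<open>N\<close>-gon are \<open>0, \<dots>, N - 1\<close> in counterclockwise order.\<close>

definition poly_sides :: "nat \<Rightarrow> int set set" where
  "poly_sides N = {{v, (v + 1) mod int N} | v. v \<in> {0..<int N}}"

definition poly_arcs :: "nat \<Rightarrow> int set set" where
  "poly_arcs N = {{u, v} | u v. u \<in> {0..<int N} \<and> v \<in> {0..<int N} \<and> u \<noteq> v} - poly_sides N"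

definition poly_triangulation :: "nat \<Rightarrow> int set set \<Rightarrow> bool" where
  "poly_triangulation N = is_triangulation (poly_arcs N) crosses"

definition poly_quiddity :: "nat \<Rightarrow> int set set \<Rightarrow> int \<Rightarrow> nat" where
  "poly_quiddity N T v = card {t \<in> triangles (T \<union> poly_sides N). v mod int N \<in> t}"


section \<open>The once-punctured disk\<close>

text \<open>
  The boundary marked points are \<open>0, \<dots>, n - 1\<close> in counterclockwise order, read modulo \<open>n\<close>.
  Up to isotopy, \<open>Radius v\<close> is the arc from \<open>v\<close> to the puncture, and \<open>Around a b\<close> is the curve
  from \<open>a\<close> to \<open>b\<close> that bounds, together with the counterclockwise boundary path from \<open>a\<close> to \<open>b\<close>,
  a region without puncture. In particular \<open>Around a a\<close> is the loop at \<open>a\<close> around the puncture.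
  The boundary path consists of \<open>disk_len n a b \<in> {1..n}\<close> segments; for length 1 the curve is
  isotopic to a boundary segment and hence not an arc.
\<close>

datatype disk_arc = Radius int | Around int int

definition disk_len :: "nat \<Rightarrow> int \<Rightarrow> int \<Rightarrow> int" where
  "disk_len n a b = (b - a - 1) mod int n + 1"

definition disk_arcs :: "nat \<Rightarrow> disk_arc set" where
  "disk_arcs n = {Radius v | v. v \<in> {0..<int n}} \<union>
     {Around a b | a b. a \<in> {0..<int n} \<and> b \<in> {0..<int n} \<and> disk_len n a b \<ge> 2}"

text \<open>
  In the universal cover of the punctured disk the boundary points are \<open>Fin s\<close> with \<open>s :: int\<close>, lying
  over the boundary point \<open>s mod n\<close>, and the puncture is the ideal vertex \<open>\<infinity>\<close>, which comes after
  all boundary points. (The element \<open>-\<infinity>\<close> of the type is not used.)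
\<close>

fun lifts :: "nat \<Rightarrow> disk_arc \<Rightarrow> int extended set set" where
  "lifts n (Radius v) = {{Fin s, \<infinity>} | s. s mod int n = v}"
| "lifts n (Around a b) = {{Fin s, Fin (s + disk_len n a b)} | s. s mod int n = a}"

definition disk_crosses :: "nat \<Rightarrow> disk_arc \<Rightarrow> disk_arc \<Rightarrow> bool" where
  "disk_crosses n a b \<longleftrightarrow> (\<exists>e\<in>lifts n a. \<exists>f\<in>lifts n b. crosses e f)"

definition disk_triangulation :: "nat \<Rightarrow> disk_arc set \<Rightarrow> bool" where
  "disk_triangulation n = is_triangulation (disk_arcs n) (disk_crosses n)"

definition self_folded_radius :: "disk_arc set \<Rightarrow> disk_arc \<Rightarrow> bool" where
  "self_folded_radius T a \<longleftrightarrow> (\<exists>v. a = Radius v \<and> Radius v \<in> T \<and> Around v v \<in> T)"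

definition disk_triangles :: "nat \<Rightarrow> disk_arc set \<Rightarrow> int extended set set" where
  "disk_triangles n T = triangles ((\<Union>a\<in>T. lifts n a) \<union> {{Fin s, Fin (s + 1)} | s. True})"

text \<open>
  Near a boundary point the covering is a homeomorphism, so the regions visible near the boundary
  point \<open>s mod n\<close> are the triangles at \<open>Fin s\<close> upstairs. A region that is seen several times from
  one point (such as a self-folded triangle from the endpoint of its radius) is counted with
  multiplicity.
\<close>

definition disk_quiddity :: "nat \<Rightarrow> disk_arc set \<Rightarrow> int \<Rightarrow> nat" where
  "disk_quiddity n T s = card {t \<in> disk_triangles n T. Fin s \<in> t}"

text \<open>
  A triangle at the puncture lifts to the triangles \<open>{Fin s, Fin t, \<infinity>}\<close>, \<open>s < t\<close>, forming one orbit
  under translation by \<open>n\<close>; exactly one of them has \<open>0 \<le> s < n\<close>.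
\<close>

definition puncture_triangles :: "nat \<Rightarrow> disk_arc set \<Rightarrow> nat" where
  "puncture_triangles n T =
     card {(s, t). s \<in> {0..<int n} \<and> s < t \<and> {Fin s, Fin t, \<infinity>} \<in> disk_triangles n T}"


section \<open>Friezes\<close>

text \<open>
  \<open>F r j\<close> is the entry in row \<open>r\<close> at horizontal position \<open>j\<close>; row \<open>-1\<close> is the row of zeros, row \<open>0\<close>
  the row of ones, and the nontrivial rows start with row \<open>1\<close>. The entry \<open>F r j\<close> is centred
  horizontally at \<open>j + r / 2\<close>, so below the neighbours \<open>F r j\<close> and \<open>F r (j + 1)\<close> stands
  \<open>F (r + 1) j\<close>, and above them \<open>F (r - 1) (j + 1)\<close>.
\<close>

type_synonym pattern = "int \<Rightarrow> int \<Rightarrow> int"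

definition diamond :: "pattern \<Rightarrow> int \<Rightarrow> int \<Rightarrow> bool" where
  "diamond F r j \<longleftrightarrow> F r j * F r (j + 1) - F (r - 1) (j + 1) * F (r + 1) j = 1"

definition is_frieze_A :: "nat \<Rightarrow> pattern \<Rightarrow> bool" where
  "is_frieze_A m F \<longleftrightarrow>
     (\<forall>j. F (-1) j = 0 \<and> F 0 j = 1 \<and> F (int m + 1) j = 1 \<and> F (int m + 2) j = 0) \<and>
     (\<forall>r\<in>{1..int m}. \<forall>j. F r j > 0) \<and>
     (\<forall>r\<in>{0..int m + 1}. \<forall>j. diamond F r j)"

text \<open>In type D the rows \<open>n - 1\<close> and \<open>n\<close> are vertically aligned.\<close>

definition is_frieze_D :: "nat \<Rightarrow> pattern \<Rightarrow> bool" where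
  "is_frieze_D n F \<longleftrightarrow>
     (\<forall>j. F (-1) j = 0 \<and> F 0 j = 1) \<and>
     (\<forall>r\<in>{1..int n}. \<forall>j. F r j > 0) \<and>
     (\<forall>r\<in>{0..int n - 3}. \<forall>j. diamond F r j) \<and>
     (\<forall>j. F (int n - 1) j * F (int n - 1) (j + 1) - F (int n - 2) (j + 1) = 1 \<and>
          F (int n) j * F (int n) (j + 1) - F (int n - 2) (j + 1) = 1 \<and>
          F (int n - 2) j * F (int n - 2) (j + 1)
            - F (int n - 3) (j + 1) * F (int n - 1) j * F (int n) j = 1)"

definition swap_last :: "nat \<Rightarrow> pattern \<Rightarrow> pattern" where
  "swap_last n F r = (if r = int n - 1 then F (int n) else if r = int n then F (int n - 1) else F r)"

text \<open>The glued pattern \<open>g(F)\<close>; only its rows up to \<open>n - 1\<close> are meaningful.\<close>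

definition glue :: "nat \<Rightarrow> pattern \<Rightarrow> pattern" where
  "glue n F r j = (if r = int n - 1 then F (int n - 1) j * F (int n) j else F r j)"

text \<open>
  In the frieze of a triangulated polygon \<open>F r j\<close> belongs to the pair of vertices \<open>j\<close>, \<open>j + r + 1\<close>
  (modulo \<open>N\<close>); in particular the quiddity entry of the vertex \<open>j + 1\<close> is \<open>F 1 j\<close>.
\<close>

definition frieze_A :: "nat \<Rightarrow> int set set \<Rightarrow> pattern" where
  "frieze_A N T = (SOME F. is_frieze_A (N - 3) F \<and>
     (\<forall>j. F 1 j = int (poly_quiddity N T (j + 1))))"

text \<open>
  In the frieze of a triangulated punctured disk \<open>F r j\<close> with \<open>r \<le> n - 2\<close> belongs to the curve
  from \<open>j\<close> to \<open>j + r + 1\<close> around the boundary, and the two entries \<open>F (n - 1) j\<close> and \<open>F n j\<close> belong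
  to the radius and to the loop at \<open>j\<close>. If the radius lies in the triangulation, its entry is \<open>1\<close>
  and the other one is the number of triangles at the puncture. As every triangulation contains a
  radius, this and the quiddity sequence determine the frieze up to interchanging its last two
  rows, and \<open>frieze_D n T\<close> is one of the two representatives.
  For \<open>n \<ge> 3\<close> the term \<open>glue n F 1 j\<close> is just \<open>F 1 j\<close>; for \<open>n = 2\<close> the only nontrivial rows are
  the two aligned ones, and the quiddity sequence is the product row.
\<close>

definition frieze_D :: "nat \<Rightarrow> disk_arc set \<Rightarrow> pattern" where
  "frieze_D n T = (SOME F. is_frieze_D n F \<and>
     (\<forall>j. glue n F 1 j = int (disk_quiddity n T (j + 1))) \<and>
     (\<forall>j. Radius (j mod int n) \<in> T \<longrightarrow>
        {F (int n - 1) j, F (int n) j} = {1, int (puncture_triangles n T)}))"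


section \<open>Ungluing\<close>

text \<open>
  \<open>unglue_last n G j0 m\<close> is the pair of entries in rows \<open>n - 1\<close>, \<open>n\<close> at position \<open>j0 - m\<close>, starting
  from the factor \<open>1\<close> in row \<open>n\<close> at position \<open>j0\<close> and moving left.
\<close>

primrec unglue_last :: "nat \<Rightarrow> pattern \<Rightarrow> int \<Rightarrow> nat \<Rightarrow> rat \<times> rat" where
  "unglue_last n G j0 0 = (of_int (G (int n - 1) j0), 1)"
| "unglue_last n G j0 (Suc m) =
     (let (b, e) = unglue_last n G j0 m; c = 1 + of_int (G (int n - 2) (j0 - int m))
      in (c / b, c / e))"

text \<open>The result of ungluing, meaningful for \<open>r \<le> n\<close> and \<open>j \<le> j0\<close>.\<close>

definition unglue :: "nat \<Rightarrow> pattern \<Rightarrow> int \<Rightarrow> int \<Rightarrow> int \<Rightarrow> rat" where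
  "unglue n G j0 r j =
     (if r = int n - 1 then fst (unglue_last n G j0 (nat (j0 - j)))
      else if r = int n then snd (unglue_last n G j0 (nat (j0 - j)))
      else of_int (G r j))"


section \<open>Cutting along a radius and gluing two copies\<close>

text \<open>
  Cutting the disk along \<open>Radius k\<close> gives the part of the universal cover between the lifts of
  \<open>Radius k\<close> at \<open>Fin k\<close> and \<open>Fin (k + n)\<close>: a polygon with vertices
  \<open>x = Fin k, Fin (k + 1), \<dots>, Fin (k + n - 1), y = Fin (k + n), p = \<infinity>\<close>. In the labelling
  \<open>1, \<dots>, n\<close> that starts at the endpoint of the cut arc, the label \<open>l\<close> is \<open>Fin (k + l - 1)\<close>.
\<close>

definition cut_arc :: "nat \<Rightarrow> int \<Rightarrow> disk_arc \<Rightarrow> int extended set" where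
  "cut_arc n k a = (THE e. e \<in> lifts n a \<and> e \<subseteq> Fin ` {k..k + int n} \<union> {\<infinity>})"

text \<open>
  The vertex \<open>w_m\<close> of the \<open>(2 * n + 2)\<close>-gon is \<open>m\<close>; the offset \<open>c\<close> is \<open>0\<close> for the first and \<open>n\<close> for
  the second copy of the cut polygon. The value at \<open>-\<infinity>\<close> is irrelevant.
\<close>

fun copy_vertex :: "int \<Rightarrow> int \<Rightarrow> int extended \<Rightarrow> int" where
  "copy_vertex k c (Fin s) = s - k + 1 + c"
| "copy_vertex k c \<infinity> = 0"
| "copy_vertex k c (-\<infinity>) = 0"

definition copy1 :: "nat \<Rightarrow> int \<Rightarrow> disk_arc \<Rightarrow> int set" where
  "copy1 n k a = copy_vertex k 0 ` cut_arc n k a"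

definition copy2 :: "nat \<Rightarrow> int \<Rightarrow> disk_arc \<Rightarrow> int set" where
  "copy2 n k a = copy_vertex k (int n) ` cut_arc n k a"

definition tilde :: "nat \<Rightarrow> int \<Rightarrow> disk_arc set \<Rightarrow> int set set" where
  "tilde n k T = copy1 n k ` (T - {Radius k}) \<union> copy2 n k ` (T - {Radius k}) \<union> {{0, int n + 1}}"

text \<open>
  The positions \<open>(r, j)\<close> occupied by the glued pattern in the frieze of the \<open>(2 * n + 2)\<close>-gon: the
  trivial rows and rows \<open>1, \<dots>, n - 1\<close> of the triangle below the quiddity entries of the vertices
  \<open>2, \<dots>, 2 * n\<close>, i.e. the entries for pairs of vertices among \<open>1, \<dots>, 2 * n + 1\<close> at distance at
  most \<open>n\<close>.
\<close>

definition glued_region :: "nat \<Rightarrow> (int \<times> int) set" where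
  "glued_region n = {(r, j). -1 \<le> r \<and> r \<le> int n - 1 \<and> 1 \<le> j \<and> j + r + 1 \<le> 2 * int n + 1}"

text \<open>
  The vertex \<open>j\<close> of the \<open>(2 * n + 2)\<close>-gon, \<open>1 \<le> j \<le> 2 * n + 1\<close>, lies over the boundary point
  \<open>(k + j - 1) mod n\<close>, so position \<open>j\<close> of the polygon frieze corresponds to position \<open>k + j - 1\<close> of
  the disk frieze. The region above contains in each row the positions \<open>1, \<dots>, n\<close>, i.e. one period
  of the glued pattern; \<open>region_pattern\<close> is the \<open>n\<close>-periodic pattern read off from them, with the
  positions of the disk frieze.
\<close>

definition region_pattern :: "nat \<Rightarrow> int \<Rightarrow> pattern \<Rightarrow> pattern" where
  "region_pattern n k F r j = F r (1 + (j - k) mod int n)"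

end

theory Submission
  imports Defs
begin

text \<open>
  Arcs of the disk other than \<open>Radius k\<close> that do not cross it are the same as diagonals of the cut
  \<open>(n + 2)\<close>-gon, with the same crossings; hence flips in the disk are flips in the cut polygon, and
  flipping both copies of an arc in the glued polygon keeps the two halves equal. That is part (a).

  For the friezes, a triangulated polygon is realised by vectors in \<open>\<int>\<^sup>2\<close> such that joined vertices
  have determinant 1 (Farey addition across every triangle). The Pluecker relation is the diamond
  rule, and the recurrence between three consecutive vectors counts triangles, so the determinants
  form the frieze. Extending the vectors of the cut polygon by the unipotent monodromy around the
  puncture gives vectors on the universal cover; their determinants are the entries of both the
  glued frieze of the disk and of the frieze of the glued polygon. Part (b) and the ungluing follow since the
  quiddity sequence determines a frieze.
\<close>

text \<open>Both \<open>frieze_A\<close> and \<open>frieze_D\<close> are choices, so their entries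
  are accessible only through existence and uniqueness. In type D the last two rows are fixed only
  up to an interchange; uniqueness is therefore proved for the glued pattern, where the mixed type D
  rule becomes one more ordinary diamond. Let a be the vector of the puncture, c the number of
  triangles there, and <a,v> the determinant. The recurrence at vertex 0 of the cut polygon shows
  that one turn sends v to v - c <a,v> a. Hence a full turn starting at v has determinant c <a,v>^2,
  the product of the radius value <a,v> and the loop value c <a,v>. This factorisation is why the
  product row, and not either factor, occurs in the frieze of a polygon. One copy of the cut polygon
  is too small: an endpoint of the cut sees only part of its triangles there, and a turn that starts
  elsewhere runs over the cut. Two consecutive translates contain every turn up to translation, and
  the shared copy of the endpoint is interior to them.\<close>

lemma crosses_iff:
  fixes u v x y :: "'v::linorder"
  assumes "u < v" "x < y"
  shows "crosses {u, v} {x, y} \<longleftrightarrow> u < x \<and> x < v \<and> v < y \<or> x < u \<and> u < y \<and> y < v"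
proof
  assume "crosses {u, v} {x, y}"
  then show "u < x \<and> x < v \<and> v < y \<or> x < u \<and> u < y \<and> y < v"
    using assms unfolding crosses_def doubleton_eq_iff by (elim exE conjE disjE) auto
next
  assume "u < x \<and> x < v \<and> v < y \<or> x < u \<and> u < y \<and> y < v"
  then show "crosses {u, v} {x, y}" unfolding crosses_def by blast
qed

lemma crosses_sym: "crosses e f \<longleftrightarrow> crosses f e"
  unfolding crosses_def by blast

text \<open>Follows from maximality of the smaller set. It rules out degenerate exchanges, in which
  the new arc was present already and an arc is merely dropped.\<close>

lemma is_triangulation_maximal:
  assumes "is_triangulation arcs cr S" "is_triangulation arcs cr T" "S \<subseteq> T"
  shows "S = T"
  using assms unfolding is_triangulation_def by blast

text \<open>\<open>triangles\<close> is defined without reference to an order; the sorted list of a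
  three-element set supplies the ordered vertices on which the interlacing arguments run.\<close>

lemma triangles_iff:
  fixes E :: "'v::linorder set set"
  shows "t \<in> triangles E \<longleftrightarrow>
    (\<exists>a b c. a < b \<and> b < c \<and> t = {a, b, c} \<and> {a, b} \<in> E \<and> {b, c} \<in> E \<and> {a, c} \<in> E)"
proof
  assume t: "t \<in> triangles E"
  then have c3: "card t = 3" and ed: "\<And>u v. u \<in> t \<Longrightarrow> v \<in> t \<Longrightarrow> u \<noteq> v \<Longrightarrow> {u, v} \<in> E"
    unfolding triangles_def by auto
  have fin: "finite t" using c3 card.infinite by fastforce
  have l3: "\<exists>a b c. xs = [a, b, c]" if "length xs = 3" for xs :: "'v list"
    using that by (auto simp: numeral_3_eq_3 length_Suc_conv)
  have l: "length (sorted_list_of_set t) = 3" using c3 by simp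
  obtain a b c where abc: "sorted_list_of_set t = [a, b, c]"
    using l3[OF l] by blast
  have t3: "t = {a, b, c}" using set_sorted_list_of_set[OF fin] abc by auto
  have lt: "a < b" "b < c" using strict_sorted_list_of_set[of t] abc by auto
  have "{a, b} \<in> E" "{b, c} \<in> E" "{a, c} \<in> E"
    using lt by (auto intro!: ed simp: t3)
  then show "\<exists>a b c. a < b \<and> b < c \<and> t = {a, b, c} \<and> {a, b} \<in> E \<and> {b, c} \<in> E \<and> {a, c} \<in> E"
    using t3 lt by blast
next
  assume "\<exists>a b c. a < b \<and> b < c \<and> t = {a, b, c} \<and> {a, b} \<in> E \<and> {b, c} \<in> E \<and> {a, c} \<in> E"
  then obtain a b c where abc: "a < b" "b < c" "t = {a, b, c}"
    and e: "{a, b} \<in> E" "{b, c} \<in> E" "{a, c} \<in> E" by blast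
  have e': "{b, a} \<in> E" "{c, b} \<in> E" "{c, a} \<in> E" using e by (simp_all add: insert_commute)
  have "a \<noteq> b" "b \<noteq> c" "a \<noteq> c" using abc(1,2) by auto
  then have "card t = 3" using abc(3) by simp
  moreover have "{u, v} \<in> E" if "u \<in> t" "v \<in> t" "u \<noteq> v" for u v
    using that e e' unfolding abc(3) by blast
  ultimately show "t \<in> triangles E" unfolding triangles_def by blast
qed

lemma trianglesI:
  fixes a b c :: "'v::linorder"
  shows "a < b \<Longrightarrow> b < c \<Longrightarrow> {a, b} \<in> E \<Longrightarrow> {b, c} \<in> E \<Longrightarrow> {a, c} \<in> E \<Longrightarrow> {a, b, c} \<in> triangles E"
  unfolding triangles_iff by (intro exI conjI) (assumption | rule refl)+

lemma trianglesE:
  fixes E :: "'v::linorder set set"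
  assumes "t \<in> triangles E"
  obtains a b c where "a < b" "b < c" "t = {a, b, c}" "{a, b} \<in> E" "{b, c} \<in> E" "{a, c} \<in> E"
  using assms unfolding triangles_iff by (elim exE conjE) (rule that)

section \<open>Triangulated polygons\<close>

lemma poly_sides_iff:
  assumes "N \<ge> 3" "u < v"
  shows "{u, v} \<in> poly_sides N \<longleftrightarrow>
    0 \<le> u \<and> v < int N \<and> (v = u + 1 \<or> u = 0 \<and> v = int N - 1)"
proof
  assume "{u, v} \<in> poly_sides N"
  then obtain w where w: "{u, v} = {w, (w + 1) mod int N}" "0 \<le> w" "w < int N"
    unfolding poly_sides_def by auto
  have "(w + 1) mod int N = (if w = int N - 1 then 0 else w + 1)" using w by auto
  then show "0 \<le> u \<and> v < int N \<and> (v = u + 1 \<or> u = 0 \<and> v = int N - 1)"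
    using w assms unfolding doubleton_eq_iff by (auto split: if_splits)
next
  assume *: "0 \<le> u \<and> v < int N \<and> (v = u + 1 \<or> u = 0 \<and> v = int N - 1)"
  show "{u, v} \<in> poly_sides N"
  proof (cases "v = u + 1")
    case True
    then have "(u + 1) mod int N = v" using * by auto
    then show ?thesis using * assms unfolding poly_sides_def by fastforce
  next
    case False
    then have uv: "u = 0" "v = int N - 1" using * by auto
    then have "(v + 1) mod int N = u" by auto
    then have "{u, v} = {v, (v + 1) mod int N}" by auto
    moreover have "v \<in> {0..<int N}" using uv assms by auto
    ultimately show ?thesis unfolding poly_sides_def by blast
  qed
qed

lemma poly_sidesE:
  assumes "N \<ge> 3" "e \<in> poly_sides N"
  obtains u v where "e = {u, v}" "u < v"
proof -
  obtain w where w: "e = {w, (w + 1) mod int N}" "0 \<le> w" "w < int N"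
    using assms unfolding poly_sides_def by auto
  have "(w + 1) mod int N = (if w = int N - 1 then 0 else w + 1)" using w by auto
  then have "w \<noteq> (w + 1) mod int N" using assms w by auto
  then show thesis using that w(1) by (metis insert_commute linorder_neqE)
qed

lemma poly_arcs_iff:
  assumes "N \<ge> 3" "u < v"
  shows "{u, v} \<in> poly_arcs N \<longleftrightarrow>
    0 \<le> u \<and> u + 2 \<le> v \<and> v < int N \<and> \<not> (u = 0 \<and> v = int N - 1)"
proof -
  have "(\<exists>a b. {u, v} = {a, b} \<and> a \<in> {0..<int N} \<and> b \<in> {0..<int N} \<and> a \<noteq> b) \<longleftrightarrow> 0 \<le> u \<and> v < int N"
    using assms(2) by (fastforce simp: doubleton_eq_iff)
  then show ?thesis using poly_sides_iff[OF assms] assms(2) unfolding poly_arcs_def by auto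
qed

lemma poly_arcsE:
  assumes "N \<ge> 3" "e \<in> poly_arcs N"
  obtains u v where "e = {u, v}" "0 \<le> u" "u + 2 \<le> v" "v < int N" "\<not> (u = 0 \<and> v = int N - 1)"
proof -
  obtain a b where ab: "e = {a, b}" "a \<noteq> b" using assms(2) unfolding poly_arcs_def by blast
  define u v where "u = min a b" and "v = max a b"
  have uv: "e = {u, v}" "u < v" using ab unfolding u_def v_def by auto
  show thesis using that[of u v] poly_arcs_iff[OF assms(1) uv(2)] assms(2) uv by auto
qed

lemma poly_triangulationI:
  assumes "T \<subseteq> poly_arcs N" "\<And>a b. a \<in> T \<Longrightarrow> b \<in> T \<Longrightarrow> \<not> crosses a b"
    "\<And>c. c \<in> poly_arcs N \<Longrightarrow> (\<And>a. a \<in> T \<Longrightarrow> \<not> crosses a c) \<Longrightarrow> c \<in> T"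
  shows "poly_triangulation N T"
  using assms unfolding poly_triangulation_def is_triangulation_def by blast

section \<open>Triangles on either side of an edge, and flips, in a triangulated polygon\<close>

locale triangulated_polygon =
  fixes N :: nat and T :: "int set set"
  assumes N: "N \<ge> 3" and tri: "poly_triangulation N T"
begin

text \<open>Sides are included so that every triangle, also one at the boundary, has all its three
  edges in the same set.\<close>

definition E :: "int set set" where "E = T \<union> poly_sides N"

lemma T_edge: "e \<in> T \<Longrightarrow> e \<in> E"
  unfolding E_def by simp

lemma T_arcs: "T \<subseteq> poly_arcs N"
  and T_noncrossing: "a \<in> T \<Longrightarrow> b \<in> T \<Longrightarrow> \<not> crosses a b"
  and T_maximal: "c \<in> poly_arcs N \<Longrightarrow> (\<And>a. a \<in> T \<Longrightarrow> \<not> crosses a c) \<Longrightarrow> c \<in> T"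
  using tri crosses_sym unfolding poly_triangulation_def is_triangulation_def by blast+

lemma edge_range: "{u, v} \<in> E \<Longrightarrow> u < v \<Longrightarrow> 0 \<le> u \<and> v < int N"
  using T_arcs poly_arcs_iff[OF N] poly_sides_iff[OF N] unfolding E_def by blast

lemma edgeE:
  assumes "e \<in> E"
  obtains u v where "e = {u, v}" "u < v"
proof (cases "e \<in> T")
  case True
  then obtain u v where "e = {u, v}" "u + 2 \<le> v"
    using T_arcs poly_arcsE[OF N] by (metis subsetD)
  then show thesis using that by auto
next
  case False
  then have "e \<in> poly_sides N" using assms unfolding E_def by simp
  then show thesis using that poly_sidesE[OF N] by blast
qed

lemma side: "0 \<le> u \<Longrightarrow> u + 1 < int N \<Longrightarrow> {u, u + 1} \<in> E"
  using poly_sides_iff[OF N, of u "u + 1"] unfolding E_def by auto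

lemma last_side: "{0, int N - 1} \<in> E"
  using poly_sides_iff[OF N, of 0 "int N - 1"] N unfolding E_def by auto

lemma edge_in_T:
  "{u, v} \<in> E \<Longrightarrow> u + 2 \<le> v \<Longrightarrow> \<not> (u = 0 \<and> v = int N - 1) \<Longrightarrow> {u, v} \<in> T"
  using poly_sides_iff[OF N, of u v] unfolding E_def by auto

text \<open>Interlacing endpoints leave a vertex on both sides of each pair, so neither pair can be
  a side; only arcs of \<open>T\<close> remain.\<close>

lemma edge_noncrossing:
  assumes "{u, v} \<in> E" "{x, y} \<in> E" "u < x" "x < v" "v < y"
  shows False
proof -
  have r: "0 \<le> u" "y < int N" using assms edge_range[of u v] edge_range[of x y] by auto
  have "{u, v} \<in> T" "{x, y} \<in> T"
    using assms r edge_in_T[of u v] edge_in_T[of x y] by auto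
  then show False using T_noncrossing crosses_iff[of u v x y] assms by auto
qed

lemma edge_maximal:
  assumes "0 \<le> u" "u < v" "v < int N"
    and "\<And>x y. {x, y} \<in> T \<Longrightarrow> x < y \<Longrightarrow> \<not> (x < u \<and> u < y \<and> y < v \<or> u < x \<and> x < v \<and> v < y)"
  shows "{u, v} \<in> E"
proof (cases "{u, v} \<in> poly_arcs N")
  case True
  have "\<not> crosses a {u, v}" if "a \<in> T" for a
  proof -
    obtain x y where "a = {x, y}" "x < y" using edgeE T_edge \<open>a \<in> T\<close> by blast
    then show ?thesis using assms(4)[of x y] that crosses_iff[of x y u v] assms(2) by auto
  qed
  then show ?thesis using T_maximal True T_edge by auto
next
  case False
  then show ?thesis using assms(1-3) poly_arcs_iff[OF N] poly_sides_iff[OF N] unfolding E_def by auto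
qed

text \<open>The apex is the largest vertex strictly inside that is joined to \<open>u\<close>. An
  arc crossing \<open>{v, w}\<close> would cross \<open>{u, v}\<close> or \<open>{u, w}\<close>, or
  else start at \<open>u\<close> and contradict the choice of \<open>v\<close>.\<close>

lemma inner_apex:
  assumes uw: "{u, w} \<in> E" "u + 2 \<le> w"
  obtains v where "u < v" "v < w" "{u, v} \<in> E" "{v, w} \<in> E"
proof -
  have r: "0 \<le> u" "w < int N" using edge_range[OF uw(1)] uw(2) by auto
  define S where "S = {v. u < v \<and> v < w \<and> {u, v} \<in> E}"
  have "finite S" by (rule finite_subset[of _ "{u..w}"]) (auto simp: S_def)
  moreover have "u + 1 \<in> S" using side[of u] uw r by (auto simp: S_def)
  ultimately have v: "Max S \<in> S" "\<And>x. x \<in> S \<Longrightarrow> x \<le> Max S"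
    by (auto intro: Max_in Max_ge)
  define v where "v = Max S"
  have v1: "u < v" "v < w" "{u, v} \<in> E" and v2: "\<And>x. u < x \<Longrightarrow> x < w \<Longrightarrow> {u, x} \<in> E \<Longrightarrow> x \<le> v"
    using v unfolding v_def S_def by auto
  have "{v, w} \<in> E"
  proof (rule edge_maximal)
    fix x y assume xy: "{x, y} \<in> T" "x < y"
    then have xyE: "{x, y} \<in> E" using T_edge by blast
    show "\<not> (x < v \<and> v < y \<and> y < w \<or> v < x \<and> x < w \<and> w < y)"
    proof
      assume "x < v \<and> v < y \<and> y < w \<or> v < x \<and> x < w \<and> w < y"
      then show False
      proof
        assume *: "x < v \<and> v < y \<and> y < w"
        then have "\<not> u < x" using edge_noncrossing[of u v x y] v1 xy xyE by auto
        moreover have "\<not> x < u" using edge_noncrossing[of x y u w] v1 xy xyE uw * by auto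
        ultimately have "x = u" by auto
        then show False using v2[of y] xy xyE * v1 by auto
      next
        assume "v < x \<and> x < w \<and> w < y"
        then show False using edge_noncrossing[of u w x y] v1 xy xyE uw by auto
      qed
    qed
  qed (use r v1 in auto)
  then show thesis using that v1 by blast
qed

lemma edge_noncrossing':
  "{u, v} \<in> E \<Longrightarrow> {x, y} \<in> E \<Longrightarrow> \<not> (u < x \<and> x < v \<and> v < y)"
  using edge_noncrossing by blast

text \<open>Take the shortest other edge that encloses \<open>{u, w}\<close> and its inner apex. The
  apex cannot lie strictly between \<open>u\<close> and \<open>w\<close>, and by minimality
  \<open>{u, w}\<close> is then a side of that triangle. Its third vertex may lie before
  \<open>u\<close> or after \<open>w\<close>.\<close>

lemma outer_apex:
  assumes uw: "{u, w} \<in> E" "u < w" "\<not> (u = 0 \<and> w = int N - 1)"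
  obtains y where "y < u \<or> w < y" "{y, u} \<in> E" "{y, w} \<in> E"
proof -
  define K where "K = (\<lambda>(x, y). {x, y} \<in> E \<and> x \<le> u \<and> w \<le> y \<and> (x, y) \<noteq> (u, w))"
  have r: "0 \<le> u" "w < int N" using edge_range[OF uw(1,2)] by auto
  \<comment> \<open>The side \<open>{0, N - 1}\<close> encloses everything, so an enclosing edge
    exists unless \<open>{u, w}\<close> is that side itself.\<close>
  have "K (0, int N - 1)" unfolding K_def using last_side r uw(3) by auto
  then obtain z where z: "K z" "\<And>z'. K z' \<Longrightarrow> nat (snd z - fst z) \<le> nat (snd z' - fst z')"
    using ex_has_least_nat[of K _ "\<lambda>z. nat (snd z - fst z)"] by blast
  obtain x y where xy: "z = (x, y)" by (cases z)
  have K: "{x, y} \<in> E" "x \<le> u" "w \<le> y" "x \<noteq> u \<or> y \<noteq> w" using z(1) unfolding K_def xy by auto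
  have "x + 2 \<le> y" using K uw(2) by auto
  then obtain v where v: "x < v" "v < y" "{x, v} \<in> E" "{v, y} \<in> E"
    using inner_apex[OF K(1)] by blast
  have "w \<le> v \<or> v \<le> u"
  proof (rule ccontr)
    assume "\<not> (w \<le> v \<or> v \<le> u)"
    then have "u < v" "v < w" by auto
    then have "\<not> x < u" using edge_noncrossing[of x v u w] v uw(1) by auto
    moreover have "\<not> w < y" using edge_noncrossing[of u w v y] v uw(1) \<open>u < v\<close> \<open>v < w\<close> by auto
    ultimately show False using K by auto
  qed
  then show thesis
  proof
    assume "w \<le> v"
    have "(x, v) = (u, w)"
    proof (rule ccontr)
      assume "(x, v) \<noteq> (u, w)"
      then have "K (x, v)" using v K \<open>w \<le> v\<close> unfolding K_def by auto
      from z(2)[OF this] show False using v xy by auto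
    qed
    then show thesis using that[of y] K v uw by (auto simp: insert_commute)
  next
    assume "v \<le> u"
    have "(v, y) = (u, w)"
    proof (rule ccontr)
      assume "(v, y) \<noteq> (u, w)"
      then have "K (v, y)" using v K \<open>v \<le> u\<close> unfolding K_def by auto
      from z(2)[OF this] show False using v xy by auto
    qed
    then show thesis using that[of x] K v uw by (auto simp: insert_commute)
  qed
qed

text \<open>The two triangles on \<open>a = {u, v}\<close> have apexes \<open>x\<close> and
  \<open>y\<close>, and \<open>a' = {x, y}\<close> is the other diagonal of the quadrilateral. Its
  four sides are edges: an arc of \<open>T\<close> that crosses \<open>a'\<close> cannot leave
  through them, so it is \<open>a\<close>; a chord that crosses \<open>a\<close> and no other arc
  must end at \<open>x\<close> and \<open>y\<close>.\<close>

lemma flip_quadrilateral: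
  assumes "a \<in> T"
  obtains a' where "a' \<in> poly_arcs N" "crosses a a'"
    "\<And>e. e \<in> T \<Longrightarrow> crosses e a' \<Longrightarrow> e = a"
    "\<And>e. e \<in> poly_arcs N \<Longrightarrow> (\<And>b. b \<in> T - {a} \<Longrightarrow> \<not> crosses b e) \<Longrightarrow> crosses a e \<Longrightarrow> e = a'"
proof -
  obtain u v where uv: "a = {u, v}" "0 \<le> u" "u + 2 \<le> v" "v < int N" "\<not> (u = 0 \<and> v = int N - 1)"
    using poly_arcsE[OF N] T_arcs assms by blast
  have aE: "{u, v} \<in> E" using assms uv T_edge by auto
  obtain x where x: "u < x" "x < v" "{u, x} \<in> E" "{x, v} \<in> E" using inner_apex[OF aE uv(3)] by blast
  have "u < v" using uv by auto
  obtain y where y: "y < u \<or> v < y" "{y, u} \<in> E" "{y, v} \<in> E"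
    using outer_apex[OF aE \<open>u < v\<close> uv(5)] by blast
  have yr: "0 \<le> y" "y < int N" using y edge_range[of y u] edge_range[of u y] edge_range[of v y] uv
    by (auto simp: insert_commute)
  have y2: "{u, y} \<in> E" "{v, y} \<in> E" using y by (auto simp: insert_commute)
  have xy: "{x, y} \<in> poly_arcs N"
    using poly_arcs_iff[OF N, of x y] poly_arcs_iff[OF N, of y x] x y yr uv
    by (auto simp: insert_commute)
  have cr: "crosses a {x, y}"
    using y(1) x crosses_iff[of u v x y] crosses_iff[of u v y x] \<open>u < v\<close> uv(1)
    by (auto simp: insert_commute)
  have only_a: "e = a" if e: "e \<in> T" and "crosses e {x, y}" for e
  proof -
    obtain c d where cd: "e = {c, d}" "c < d" using edgeE T_edge e by blast
    then have cE: "{c, d} \<in> E" using e T_edge by auto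
    \<comment> \<open>Noncrossing with the four sides of the quadrilateral, in both orders; the
      sides at \<open>y\<close> occur in both orientations because the position of \<open>y\<close>
      is still open.\<close>
    note nc = edge_noncrossing'[OF cE x(3)] edge_noncrossing'[OF cE x(4)] edge_noncrossing'[OF x(3) cE]
      edge_noncrossing'[OF x(4) cE] edge_noncrossing'[OF cE y(2)] edge_noncrossing'[OF cE y(3)]
      edge_noncrossing'[OF cE y2(1)] edge_noncrossing'[OF cE y2(2)] edge_noncrossing'[OF y(2) cE]
      edge_noncrossing'[OF y(3) cE] edge_noncrossing'[OF y2(1) cE] edge_noncrossing'[OF y2(2) cE]
    from y(1) have "c = u \<and> d = v"
    proof
      assume "y < u"
      then have "c < y \<and> y < d \<and> d < x \<or> y < c \<and> c < x \<and> x < d"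
        using crosses_iff[OF cd(2), of y x] \<open>crosses e {x, y}\<close> cd x by (auto simp: insert_commute)
      then show ?thesis using nc \<open>y < u\<close> x(1,2) cd(2) by smt
    next
      assume "v < y"
      then have "c < x \<and> x < d \<and> d < y \<or> x < c \<and> c < y \<and> y < d"
        using crosses_iff[OF cd(2), of x y] \<open>crosses e {x, y}\<close> cd x by auto
      then show ?thesis using nc \<open>v < y\<close> x(1,2) cd(2) by smt
    qed
    then show ?thesis using cd uv by auto
  qed
  have only_a': "e = {x, y}" if e: "e \<in> poly_arcs N" and ne: "\<And>b. b \<in> T - {a} \<Longrightarrow> \<not> crosses b e"
    and "crosses a e" for e
  proof -
    obtain c d where cd: "e = {c, d}" "0 \<le> c" "c + 2 \<le> d" "d < int N" using poly_arcsE[OF N e] by blast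
    then have "c < d" by auto
    \<comment> \<open>Extends the hypothesis on \<open>e\<close> from \<open>T - {a}\<close> to all
      edges other than \<open>a\<close>, since sides are never crossed.\<close>
    have free: "\<not> (g < c \<and> c < h \<and> h < d) \<and> \<not> (c < g \<and> g < d \<and> d < h)"
      if "{g, h} \<in> E" "{g, h} \<noteq> a" for g h
    proof (rule ccontr)
      assume "\<not> ?thesis"
      then have *: "g < h" "g < c \<and> c < h \<and> h < d \<or> c < g \<and> g < d \<and> d < h" by auto
      have "{g, h} \<in> T"
        using edge_in_T[OF that(1)] * cd edge_range[OF that(1) *(1)] by auto
      then show False using ne[of "{g, h}"] that * crosses_iff[OF *(1) \<open>c < d\<close>] cd by auto
    qed
    have ne2: "{u, x} \<noteq> a" "{x, v} \<noteq> a" "{y, u} \<noteq> a" "{y, v} \<noteq> a" "{u, y} \<noteq> a" "{v, y} \<noteq> a"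
      using uv x y by (auto simp: doubleton_eq_iff)
    note fr = free[OF x(3) ne2(1)] free[OF x(4) ne2(2)] free[OF y(2) ne2(3)]
      free[OF y(3) ne2(4)] free[OF y2(1) ne2(5)] free[OF y2(2) ne2(6)]
    have "u < c \<and> c < v \<and> v < d \<or> c < u \<and> u < d \<and> d < v"
      using crosses_iff[OF \<open>u < v\<close> \<open>c < d\<close>] \<open>crosses a e\<close> cd uv by auto
    then have "c = x \<and> d = y \<or> c = y \<and> d = x"
    proof
      assume *: "u < c \<and> c < v \<and> v < d"
      then have "c = x" using fr(1,2) x(1,2) y(1) * by smt
      moreover have "d = y" using fr(3-6) x(1,2) y(1) * by smt
      ultimately show ?thesis by auto
    next
      assume *: "c < u \<and> u < d \<and> d < v"
      then have "d = x" using fr(1,2) x(1,2) y(1) * by smt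
      moreover have "c = y" using fr(3-6) x(1,2) y(1) * by smt
      ultimately show ?thesis by auto
    qed
    then show ?thesis using cd by auto
  qed
  show thesis using that[of "{x, y}"] xy cr only_a only_a' by blast
qed

text \<open>Otherwise maximality puts \<open>a'\<close> into \<open>T\<close>, and the exchanged set
  would be a triangulation properly contained in \<open>T\<close>.\<close>

lemma flip_crosses:
  assumes "a \<in> T" "a' \<noteq> a" "poly_triangulation N (T - {a} \<union> {a'})"
  shows "crosses a a'"
proof (rule ccontr)
  assume nc: "\<not> crosses a a'"
  have a': "a' \<in> poly_arcs N" "\<And>b. b \<in> T - {a} \<Longrightarrow> \<not> crosses b a'"
    using assms(3) unfolding poly_triangulation_def is_triangulation_def by blast+
  have "a' \<in> T" using T_maximal[of a'] a' nc by blast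
  then have "T - {a} \<union> {a'} \<subseteq> T" by auto
  then have "T - {a} \<union> {a'} = T"
    using assms(3) tri unfolding poly_triangulation_def by (intro is_triangulation_maximal)
  then show False using assms(1,2) by blast
qed

lemma flip_exists:
  assumes a: "a \<in> T"
  obtains a' where "a' \<noteq> a" "poly_triangulation N (T - {a} \<union> {a'})"
proof -
  obtain a' where a': "a' \<in> poly_arcs N" "crosses a a'"
    "\<And>e. e \<in> T \<Longrightarrow> crosses e a' \<Longrightarrow> e = a"
    "\<And>e. e \<in> poly_arcs N \<Longrightarrow> (\<And>b. b \<in> T - {a} \<Longrightarrow> \<not> crosses b e) \<Longrightarrow> crosses a e \<Longrightarrow> e = a'"
    by (rule flip_quadrilateral[OF a]) blast
  have self: "\<not> crosses e e" if e: "e \<in> poly_arcs N" for e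
  proof -
    obtain u v where uv: "e = {u, v}" "u + 2 \<le> v" using poly_arcsE[OF N e] by blast
    then have "u < v" by auto
    show ?thesis using crosses_iff[OF \<open>u < v\<close> \<open>u < v\<close>] uv by auto
  qed
  have "a' \<noteq> a" using self T_arcs a a'(2) by auto
  moreover have "poly_triangulation N (T - {a} \<union> {a'})"
  proof (rule poly_triangulationI)
    show "T - {a} \<union> {a'} \<subseteq> poly_arcs N" using T_arcs a' by auto
    fix e f assume "e \<in> T - {a} \<union> {a'}" "f \<in> T - {a} \<union> {a'}"
    moreover have "\<not> crosses b a'" "\<not> crosses a' b" if "b \<in> T - {a}" for b
      using a'(3)[of b] that crosses_sym[of b a'] by auto
    ultimately show "\<not> crosses e f" using self[OF a'(1)] T_noncrossing[of e f] by auto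
  next
    fix c assume c: "c \<in> poly_arcs N" "\<And>e. e \<in> T - {a} \<union> {a'} \<Longrightarrow> \<not> crosses e c"
    show "c \<in> T - {a} \<union> {a'}"
    proof (cases "crosses a c")
      case True
      have "c = a'"
      proof (rule a'(4)[OF c(1) _ True])
        show "\<not> crosses b c" if "b \<in> T - {a}" for b by (rule c(2)) (use that in simp)
      qed
      then show ?thesis by simp
    next
      case False
      have "\<not> crosses b c" if "b \<in> T" for b using c(2)[of b] that False by (cases "b = a") simp_all
      then have "c \<in> T" by (rule T_maximal[OF c(1)])
      moreover have "\<not> crosses a' c" by (rule c(2)) simp
      then have "c \<noteq> a" using a'(2) crosses_sym[of a a'] by metis
      ultimately show ?thesis by simp
    qed
  qed
  ultimately show thesis using that by blast
qed

lemma flip_unique: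
  assumes a: "a \<in> T"
    and a': "a' \<noteq> a" "poly_triangulation N (T - {a} \<union> {a'})"
    and a'': "a'' \<noteq> a" "poly_triangulation N (T - {a} \<union> {a''})"
  shows "a' = a''"
proof -
  obtain q where q: "\<And>e. e \<in> poly_arcs N \<Longrightarrow> (\<And>b. b \<in> T - {a} \<Longrightarrow> \<not> crosses b e) \<Longrightarrow> crosses a e \<Longrightarrow> e = q"
    by (rule flip_quadrilateral[OF a]) blast
  have "e = q" if "e \<noteq> a" "poly_triangulation N (T - {a} \<union> {e})" for e
    using q[of e] that flip_crosses[OF a that]
    unfolding poly_triangulation_def is_triangulation_def by blast
  then show ?thesis using a' a'' by metis
qed

text \<open>Evaluates the definite description in \<open>mutate\<close>: it suffices to exhibit some
  exchanged triangulation, without knowing which quadrilateral the flip happens in.\<close>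

lemma mutate_poly:
  assumes "a \<in> T" "a' \<noteq> a" "poly_triangulation N (T - {a} \<union> {a'})"
  shows "mutate (poly_triangulation N) a T = T - {a} \<union> {a'}"
proof -
  have "(THE b. b \<noteq> a \<and> poly_triangulation N (T - {a} \<union> {b})) = a'"
    using assms flip_unique by (intro the_equality) blast+
  then show ?thesis unfolding mutate_def by simp
qed

end

section \<open>Friezes from vectors in the plane\<close>

text \<open>Vectors are pairs of integers; quantified vectors are to stay whole instead of being
  split into coordinates.\<close>

declare split_paired_All [simp del] split_paired_Ex [simp del]

definition wedge :: "int \<times> int \<Rightarrow> int \<times> int \<Rightarrow> int" where
  "wedge p q = fst p * snd q - snd p * fst q"

text \<open>Besides the diamond rule it yields positivity: choosing two of the four vectors as the
  ends of an edge, with determinant 1, writes an unknown determinant as a combination of known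
  ones.\<close>

lemma plucker: "wedge p r * wedge q s = wedge p q * wedge r s + wedge p s * wedge q r"
  unfolding wedge_def by algebra

lemma wedge_self [simp]: "wedge p p = 0"
  unfolding wedge_def by simp

lemma wedge_swap: "wedge q p = - wedge p q"
  unfolding wedge_def by simp

text \<open>This is Farey addition: \<open>v = u + w\<close>. Testing against an arbitrary
  \<open>z\<close> turns vector identities into integer identities, which suffices because the
  determinant is nondegenerate.\<close>

lemma wedge_between:
  assumes "wedge u v = 1" "wedge v w = 1" "wedge u w = 1"
  shows "wedge v z = wedge u z + wedge w z"
  using plucker[of u w v z] assms by simp

text \<open>A diamond determines its bottom entry once its top entry is nonzero. The diamonds
  centred in rows 1 to \<open>R\<close> fix the rows up to \<open>R + 1\<close>, and the divisions
  are only by entries of rows 0 to \<open>R - 1\<close>.\<close>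

lemma diamond_unique:
  fixes F G :: pattern
  assumes "\<And>j. F 0 j = G 0 j" "\<And>j. F 1 j = G 1 j"
    and "\<And>r j. 1 \<le> r \<Longrightarrow> r \<le> R \<Longrightarrow> diamond F r j \<and> diamond G r j"
    and "\<And>r j. 0 \<le> r \<Longrightarrow> r < R \<Longrightarrow> F r j \<noteq> 0"
  shows "int m \<le> R + 1 \<Longrightarrow> F (int m) j = G (int m) j"
proof (induction m arbitrary: j rule: less_induct)
  case (less m)
  show ?case
  proof (cases "m \<le> 1")
    case True
    then have "m = 0 \<or> m = 1" by auto
    then show ?thesis using assms(1,2) by auto
  next
    case False
    define r where "r = int m - 1"
    have r: "1 \<le> r" "r \<le> R" using False less.prems unfolding r_def by auto
    have eq: "F (int i) j = G (int i) j" if "i < m" for i j using less.IH[OF that] less.prems that by auto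
    have rows: "r = int (m - 1)" "r - 1 = int (m - 2)" "r + 1 = int m" using False unfolding r_def by auto
    have "F r j = G r j" "F (r - 1) j = G (r - 1) j" for j
      using eq[of "m - 1"] eq[of "m - 2"] False unfolding rows by auto
    moreover have "F (r - 1) (j + 1) \<noteq> 0" using assms(4) r by auto
    moreover have "diamond F r j" "diamond G r j" using assms(3) r by auto
    ultimately have "F (r + 1) j = G (r + 1) j" unfolding diamond_def by (smt (verit) mult_left_cancel)
    then show ?thesis using rows(3) by metis
  qed
qed

lemma frieze_A_unique:
  assumes F: "is_frieze_A m F" and G: "is_frieze_A m G" and q: "\<And>j. F 1 j = G 1 j"
    and r: "-1 \<le> r" "r \<le> int m + 2"
  shows "F r j = G r j"
proof (cases "r = -1")
  case True
  then show ?thesis using F G unfolding is_frieze_A_def by auto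
next
  case False
  have "F (int (nat r)) j = G (int (nat r)) j"
  proof (rule diamond_unique[where F = F and G = G and R = "int m + 1"])
    show "F r j \<noteq> 0" if "0 \<le> r" "r < int m + 1" for r j
    proof (cases "r = 0")
      case True
      then show ?thesis using F unfolding is_frieze_A_def by auto
    next
      case False
      then have "F r j > 0" using F that unfolding is_frieze_A_def by auto
      then show ?thesis by auto
    qed
  qed (use F G q r False in \<open>auto simp: is_frieze_A_def\<close>)
  then show ?thesis using r False by auto
qed

section \<open>Realising a triangulated polygon by vectors, and its frieze by their
  determinants\<close>

context triangulated_polygon
begin

text \<open>For an edge \<open>{u, w}\<close> these lie in the part of the polygon cut off by it.
  Counting there permits induction over the apex, and \<open>u = 0\<close>, \<open>w = N - 1\<close>
  gives the quiddity entries.\<close>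

definition inner_triangles :: "int \<Rightarrow> int \<Rightarrow> int \<Rightarrow> int set set" where
  "inner_triangles u w x = {t \<in> triangles E. t \<subseteq> {u..w} \<and> x \<in> t}"

lemma finite_inner_triangles: "finite (inner_triangles u w x)"
  by (rule finite_subset[of _ "Pow {u..w}"]) (auto simp: inner_triangles_def)

lemma inner_triangles_short: "w \<le> u + 1 \<Longrightarrow> inner_triangles u w x = {}"
proof -
  assume w: "w \<le> u + 1"
  have False if t: "t \<in> triangles E" "t \<subseteq> {u..w}" for t
  proof -
    obtain a b c where "a < b" "b < c" "t = {a, b, c}" by (rule trianglesE[OF t(1)])
    then show False using w t(2) by auto
  qed
  then show ?thesis unfolding inner_triangles_def by auto
qed

lemma inner_triangles_outside: "x < u \<or> w < x \<Longrightarrow> inner_triangles u w x = {}"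
  unfolding inner_triangles_def by auto

text \<open>If \<open>v\<close> lies strictly between the outer vertices of \<open>t\<close>, its
  longest edge can avoid \<open>{u, v}\<close> and \<open>{v, w}\<close> only by being
  \<open>{u, w}\<close>; the same two edges then force the middle vertex to be
  \<open>v\<close>.\<close>

lemma triangle_below_apex:
  assumes t: "t \<in> triangles E" "t \<subseteq> {u..w}"
    and v: "u < v" "v < w" "{u, v} \<in> E" "{v, w} \<in> E"
  shows "t = {u, v, w} \<or> t \<subseteq> {u..v} \<or> t \<subseteq> {v..w}"
proof -
  obtain a b c where abc: "a < b" "b < c" "t = {a, b, c}" "{a, b} \<in> E" "{b, c} \<in> E" "{a, c} \<in> E"
    by (rule trianglesE[OF t(1)])
  have r: "u \<le> a" "c \<le> w" using abc t by auto
  show ?thesis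
  proof (cases "a < v \<and> v < c")
    case True
    have "\<not> u < a" using edge_noncrossing[OF v(3) abc(6)] True by auto
    then have a: "a = u" using r by simp
    have "\<not> c < w" using edge_noncrossing[OF abc(6) v(4)] True by auto
    then have c: "c = w" using r by simp
    have "b = v"
    proof (rule ccontr)
      assume "b \<noteq> v"
      then consider "b < v" | "v < b" by linarith
      then show False
      proof cases
        case 1
        then show False using edge_noncrossing[OF v(3) abc(5)] abc True a by auto
      next
        case 2
        then show False using edge_noncrossing[OF abc(4) v(4)] abc True c by auto
      qed
    qed
    then show ?thesis using a c abc by auto
  next
    case False
    then show ?thesis using abc r by auto
  qed
qed

lemma card_inner_triangles:
  assumes v: "u < v" "v < w" "{u, v} \<in> E" "{v, w} \<in> E" "{u, w} \<in> E"
  shows "card (inner_triangles u w x) =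
    card (inner_triangles u v x) + card (inner_triangles v w x) + (if x \<in> {u, v, w} then 1 else 0)"
proof -
  let ?t = "{t. t = {u, v, w} \<and> x \<in> t}"
  have t: "{u, v, w} \<in> triangles E" using v by (intro trianglesI)
  have c3: "card s = 3" if "s \<in> triangles E" for s using that unfolding triangles_def by auto
  have "inner_triangles u w x = inner_triangles u v x \<union> inner_triangles v w x \<union> ?t"
  proof (intro equalityI subsetI)
    fix s assume "s \<in> inner_triangles u w x"
    then show "s \<in> inner_triangles u v x \<union> inner_triangles v w x \<union> ?t"
      using triangle_below_apex[OF _ _ v(1-4), of s] unfolding inner_triangles_def by blast
  next
    fix s assume s: "s \<in> inner_triangles u v x \<union> inner_triangles v w x \<union> ?t"
    have "{u..v} \<subseteq> {u..w}" "{v..w} \<subseteq> {u..w}" "{u, v, w} \<subseteq> {u..w}" using v(1,2) by auto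
    then show "s \<in> inner_triangles u w x" using s t unfolding inner_triangles_def by blast
  qed
  moreover have "(inner_triangles u v x \<union> inner_triangles v w x) \<inter> ?t = {}"
  proof -
    have "\<not> {u, v, w} \<subseteq> {u..v}" "\<not> {u, v, w} \<subseteq> {v..w}" using v(1,2) by auto
    then show ?thesis unfolding inner_triangles_def by blast
  qed
  moreover have "inner_triangles u v x \<inter> inner_triangles v w x = {}"
  proof -
    have False if s: "s \<in> triangles E" "s \<subseteq> {u..v}" "s \<subseteq> {v..w}" for s
    proof -
      have "{u..v} \<inter> {v..w} = {v}" using v(1,2) by auto
      then have "s \<subseteq> {v}" using that by blast
      then have "card s \<le> 1" using card_mono[of "{v}" s] by simp
      then show False using c3[OF s(1)] by auto
    qed
    then show ?thesis unfolding inner_triangles_def by blast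
  qed
  moreover have "card ?t = (if x \<in> {u, v, w} then 1 else 0)"
  proof (cases "x \<in> {u, v, w}")
    case True
    then have "?t = {{u, v, w}}" by auto
    then show ?thesis using True by simp
  next
    case False
    then have "?t = {}" by auto
    then show ?thesis using False by (metis card.empty)
  qed
  moreover have "finite ?t" by auto
  ultimately show ?thesis by (simp add: card_Un_disjoint finite_inner_triangles)
qed

text \<open>Induction on the span of the edge. At an inner vertex the two neighbours sum to a
  multiple of its vector; at an end of the edge the missing neighbour is replaced by minus the
  vector at the other end. Passing from \<open>{u, v}\<close> to \<open>{u, w}\<close> replaces
  \<open>p v\<close> by \<open>p u + p w\<close>, which accounts exactly for the new
  triangle.\<close>

lemma triangle_counts:
  assumes unit: "\<And>x y. {x, y} \<in> E \<Longrightarrow> x < y \<Longrightarrow> wedge (p x) (p y) = 1"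
  shows "{u, w} \<in> E \<Longrightarrow> u < w \<Longrightarrow>
    (\<forall>z. wedge (p (u + 1)) z = wedge (p w) z + int (card (inner_triangles u w u)) * wedge (p u) z) \<and>
    (\<forall>z. wedge (p (w - 1)) z = wedge (p u) z + int (card (inner_triangles u w w)) * wedge (p w) z) \<and>
    (\<forall>x z. u < x \<longrightarrow> x < w \<longrightarrow>
      wedge (p (x - 1)) z + wedge (p (x + 1)) z = int (card (inner_triangles u w x)) * wedge (p x) z)"
proof (induction "nat (w - u)" arbitrary: u w rule: less_induct)
  case less
  show ?case
  proof (cases "w = u + 1")
    case True
    then show ?thesis by (simp add: inner_triangles_short)
  next
    case False
    then have "u + 2 \<le> w" using less.prems by auto
    then obtain v where v: "u < v" "v < w" "{u, v} \<in> E" "{v, w} \<in> E"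
      using inner_apex[OF less.prems(1)] by blast
    have apex: "wedge (p v) z = wedge (p u) z + wedge (p w) z" for z
      using wedge_between unit v less.prems by metis
    have "nat (v - u) < nat (w - u)" "nat (w - v) < nat (w - u)" using v by auto
    note uv = less.hyps[OF this(1) v(3) v(1)] and vw = less.hyps[OF this(2) v(4) v(2)]
    note cnt = card_inner_triangles[OF v less.prems(1)]
    have out: "inner_triangles u v x = {}" if "v < x" for x using inner_triangles_outside that by auto
    have out': "inner_triangles v w x = {}" if "x < v" for x using inner_triangles_outside that by auto
    have "wedge (p (u + 1)) z = wedge (p w) z + int (card (inner_triangles u w u)) * wedge (p u) z" for z
      using uv cnt[of u] out'[of u] v apex[of z] by (simp add: algebra_simps)
    moreover have "wedge (p (w - 1)) z = wedge (p u) z + int (card (inner_triangles u w w)) * wedge (p w) z" for z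
      using vw cnt[of w] out[of w] v apex[of z] by (simp add: algebra_simps)
    moreover have "wedge (p (x - 1)) z + wedge (p (x + 1)) z
      = int (card (inner_triangles u w x)) * wedge (p x) z" if "u < x" "x < w" for x z
    proof -
      consider "x < v" | "x = v" | "v < x" by linarith
      then show ?thesis
      proof cases
        case 1
        then show ?thesis using uv cnt[of x] out'[of x] that v by auto
      next
        case 2
        \<comment> \<open>At the apex the end formulas of both halves are added, and
          \<open>p u + p w = p v\<close> contributes the 1 for the triangle
          \<open>{u, v, w}\<close>.\<close>
        have "wedge (p (v - 1)) z = wedge (p u) z + int (card (inner_triangles u v v)) * wedge (p v) z"
          "wedge (p (v + 1)) z = wedge (p w) z + int (card (inner_triangles v w v)) * wedge (p v) z"
          using uv vw by auto
        then show ?thesis using cnt[of v] apex[of z] 2 by (simp add: algebra_simps)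
      next
        case 3
        then show ?thesis using vw cnt[of x] out[of x] that v by auto
      qed
    qed
    ultimately show ?thesis by blast
  qed
qed

text \<open>The apex receives the Farey sum of the end vectors, and both halves are filled in
  recursively, which is why \<open>P\<close> and \<open>Q\<close> must be arbitrary. Only pairs on
  different sides of the apex need an argument: Pluecker with the vectors of \<open>u\<close> and
  \<open>v\<close> gives a sum of a nonnegative and a positive term, and the only edge among such
  pairs is \<open>{u, w}\<close>.\<close>

lemma vectors_below_edge:
  assumes "wedge P Q = 1"
  shows "{u, w} \<in> E \<Longrightarrow> u < w \<Longrightarrow> \<exists>p. p u = P \<and> p w = Q \<and>
    (\<forall>x y. u \<le> x \<longrightarrow> x < y \<longrightarrow> y \<le> w \<longrightarrow>
      wedge (p x) (p y) > 0 \<and> ({x, y} \<in> E \<longrightarrow> wedge (p x) (p y) = 1))"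
  using assms
proof (induction "nat (w - u)" arbitrary: u w P Q rule: less_induct)
  case less
  show ?case
  proof (cases "w = u + 1")
    case True
    then have "x = u \<and> y = w" if "u \<le> x" "x < y" "y \<le> w" for x y using that by auto
    then show ?thesis using less.prems by (intro exI[of _ "\<lambda>x. if x = u then P else Q"]) fastforce
  next
    case False
    then have "u + 2 \<le> w" using less.prems by auto
    then obtain v where v: "u < v" "v < w" "{u, v} \<in> E" "{v, w} \<in> E"
      using inner_apex[OF less.prems(1)] by blast
    define R where "R = (fst P + fst Q, snd P + snd Q)"
    have R: "wedge P R = 1" "wedge R Q = 1"
      using less.prems(3) unfolding R_def wedge_def by (auto simp: algebra_simps)
    have sm: "nat (v - u) < nat (w - u)" "nat (w - v) < nat (w - u)" using v by auto
    obtain p where p: "p u = P" "p v = R" "\<And>x y. u \<le> x \<Longrightarrow> x < y \<Longrightarrow> y \<le> v \<Longrightarrow>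
      wedge (p x) (p y) > 0 \<and> ({x, y} \<in> E \<longrightarrow> wedge (p x) (p y) = 1)"
      using less.hyps[OF sm(1) v(3,1) R(1)] by blast
    obtain q where q: "q v = R" "q w = Q" "\<And>x y. v \<le> x \<Longrightarrow> x < y \<Longrightarrow> y \<le> w \<Longrightarrow>
      wedge (q x) (q y) > 0 \<and> ({x, y} \<in> E \<longrightarrow> wedge (q x) (q y) = 1)"
      using less.hyps[OF sm(2) v(4,2) R(2)] by blast
    \<comment> \<open>Both halves assign \<open>R\<close> to \<open>v\<close>, so the case
      distinction may treat \<open>v\<close> as belonging to either.\<close>
    define s where "s = (\<lambda>x. if x \<le> v then p x else q x)"
    have "wedge (s x) (s y) > 0 \<and> ({x, y} \<in> E \<longrightarrow> wedge (s x) (s y) = 1)"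
      if xy: "u \<le> x" "x < y" "y \<le> w" for x y
    proof -
      consider "y \<le> v" | "v \<le> x" | "x < v" "v < y" by linarith
      then show ?thesis
      proof cases
        case 1
        then show ?thesis using p(3)[of x y] xy unfolding s_def by auto
      next
        case 2
        then have "s x = q x" "s y = q y" using p(2) q(1) xy unfolding s_def by auto
        then show ?thesis using q(3)[of x y] xy 2 by auto
      next
        case 3
        have s: "s x = p x" "s y = q y" using 3 unfolding s_def by auto
        have a: "wedge (p x) R > 0" using p(2) p(3)[of x v] 3 xy by auto
        have b: "wedge P (p x) \<ge> 0" using p(1) p(3)[of u x] 3 xy by (cases "x = u") auto
        have c: "wedge R (q y) > 0" using q(1) q(3)[of v y] 3 xy by auto
        have d: "wedge (q y) Q \<ge> 0" using q(2) q(3)[of y w] 3 xy by (cases "y = w") auto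
        have "wedge P (q y) = wedge R (q y) * 1 + wedge (q y) Q * 1"
          using plucker[of P "q y" R Q] R less.prems(3) by (simp add: algebra_simps)
        then have e: "wedge P (q y) > 0" using c d by auto
        have "wedge P R * wedge (p x) (q y) = wedge P (p x) * wedge R (q y) + wedge P (q y) * wedge (p x) R"
          by (rule plucker)
        then have eq: "wedge (p x) (q y) = wedge P (p x) * wedge R (q y) + wedge P (q y) * wedge (p x) R"
          using R by simp
        then have pos: "wedge (p x) (q y) > 0" using a b c e by (simp add: add_nonneg_pos)
        have "wedge (p x) (q y) = 1" if xyE: "{x, y} \<in> E"
        proof -
          have "\<not> u < x" using edge_noncrossing[OF v(3) xyE] 3 by auto
          moreover have "\<not> y < w" using edge_noncrossing[OF xyE v(4)] 3 by auto
          ultimately have "x = u" "y = w" using xy by auto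
          then show ?thesis using p(1) q(2) less.prems(3) by simp
        qed
        then show ?thesis using s pos by simp
      qed
    qed
    moreover have "s u = P" "s w = Q" using p q v unfolding s_def by auto
    ultimately show ?thesis by blast
  qed
qed

lemma vectors_exist:
  obtains p where "\<And>x y. 0 \<le> x \<Longrightarrow> x < y \<Longrightarrow> y < int N \<Longrightarrow> wedge (p x) (p y) > 0"
    "\<And>x y. {x, y} \<in> E \<Longrightarrow> x < y \<Longrightarrow> wedge (p x) (p y) = 1"
proof -
  have "wedge (1, 0) (0, 1) = 1" unfolding wedge_def by simp
  from vectors_below_edge[OF this last_side] N obtain p where
    p: "\<forall>x y. 0 \<le> x \<longrightarrow> x < y \<longrightarrow> y \<le> int N - 1 \<longrightarrow>
      wedge (p x) (p y) > 0 \<and> ({x, y} \<in> E \<longrightarrow> wedge (p x) (p y) = 1)"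
    by auto
  then show thesis using that[of p] edge_range by fastforce
qed

lemma poly_quiddity_eq: "poly_quiddity N T v = card (inner_triangles 0 (int N - 1) (v mod int N))"
proof -
  have "t \<subseteq> {0..int N - 1}" if t: "t \<in> triangles E" for t
  proof -
    obtain a b c where "a < b" "b < c" "t = {a, b, c}" "{a, b} \<in> E" "{b, c} \<in> E"
      by (rule trianglesE[OF t])
    then show ?thesis using edge_range[of a b] edge_range[of b c] by auto
  qed
  then have "{t \<in> triangles E. x \<in> t} = inner_triangles 0 (int N - 1) x" for x
    unfolding inner_triangles_def by blast
  then show ?thesis unfolding poly_quiddity_def E_def by simp
qed

lemma quiddity_recurrence:
  assumes "\<And>x y. {x, y} \<in> E \<Longrightarrow> x < y \<Longrightarrow> wedge (p x) (p y) = 1" "0 < x" "x < int N - 1"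
  shows "wedge (p (x - 1)) z + wedge (p (x + 1)) z = int (poly_quiddity N T x) * wedge (p x) z"
  using triangle_counts[of p, OF assms(1) last_side] assms(2,3) N
  unfolding poly_quiddity_eq by simp

text \<open>The vectors are extended to all integers with a change of sign after each turn. This
  sign makes the determinant across the seam positive and closes the pattern with rows of ones and
  zeros. The pattern so obtained has the right quiddity sequence, so uniqueness identifies it with
  the chosen \<open>frieze_A\<close>.\<close>

lemma frieze_A_wedge:
  assumes pos: "\<And>x y. 0 \<le> x \<Longrightarrow> x < y \<Longrightarrow> y < int N \<Longrightarrow> wedge (p x) (p y) > 0"
    and unit: "\<And>x y. {x, y} \<in> E \<Longrightarrow> x < y \<Longrightarrow> wedge (p x) (p y) = 1"
    and r: "-1 \<le> r" "0 \<le> j" "j + r + 1 \<le> int N - 1"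
  shows "frieze_A N T r j = wedge (p j) (p (j + r + 1))"
proof -
  \<comment> \<open>Parity of the number of completed turns.\<close>
  define sg :: "int \<Rightarrow> int" where "sg j = (if even (j div int N) then 1 else -1)" for j
  define P where "P j = (sg j * fst (p (j mod int N)), sg j * snd (p (j mod int N)))" for j
  define F where "F r j = wedge (P j) (P (j + r + 1))" for r j
  have wP: "wedge (P i) (P j) = sg i * sg j * wedge (p (i mod int N)) (p (j mod int N))" for i j
    unfolding P_def wedge_def by (simp add: algebra_simps)
  have N0: "int N > 0" using N by auto
  have Pp: "P j = p j" if "0 \<le> j" "j < int N" for j
    using that unfolding P_def sg_def by (simp add: div_pos_pos_trivial)
  have sgN: "sg (j + int N) = - sg j" for j using N0 unfolding sg_def by simp
  have PN: "wedge (P i) (P (j + int N)) = - wedge (P i) (P j)" for i j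
    unfolding wP sgN by simp
  have shift: "wedge (P (i + int N)) (P (j + int N)) = wedge (P i) (P j)" for i j
    unfolding wP sgN by simp
  have shiftd: "wedge (P (i + d * int N)) (P (j + d * int N)) = wedge (P i) (P j)" for i j d
  proof -
    have "sg (i + d * int N) = (if even d then sg i else - sg i)" for i
      using N0 unfolding sg_def by simp
    then show ?thesis unfolding wP by simp
  qed
  \<comment> \<open>A determinant depends only on the residue of the first index and the distance,
    so the checks below may start in the basic polygon.\<close>
  have reduce: "wedge (P i) (P (i + l)) = wedge (P (i mod int N)) (P (i mod int N + l))" for i l
  proof -
    have "i = i mod int N + (i div int N) * int N" by simp
    then show ?thesis using shiftd[of "i mod int N" "i div int N" "i mod int N + l"]
      by (simp add: algebra_simps)
  qed
  have P1: "wedge (P i) (P (i + 1)) = 1" for i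
  proof -
    define m where "m = i mod int N"
    have m: "0 \<le> m" "m < int N" using N0 unfolding m_def by auto
    have "wedge (P m) (P (m + 1)) = 1"
    proof (cases "m = int N - 1")
      case True
      then have "wedge (P m) (P (m + 1)) = - wedge (p (int N - 1)) (p 0)"
        using PN[of m 0] Pp[of 0] Pp[of m] m by simp
      then show ?thesis using unit[OF last_side] wedge_swap[of "p 0" "p (int N - 1)"] N by simp
    next
      case False
      then have "{m, m + 1} \<in> E" using side m by auto
      then show ?thesis using unit[of m "m + 1"] Pp[of m] Pp[of "m + 1"] m False by auto
    qed
    then show ?thesis using reduce[of i 1] unfolding m_def by simp
  qed
  have Ppos: "wedge (P i) (P (i + l)) > 0" if l: "0 < l" "l < int N" for i l
  proof -
    define m where "m = i mod int N"
    have m: "0 \<le> m" "m < int N" using N0 unfolding m_def by auto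
    have "wedge (P m) (P (m + l)) > 0"
    proof (cases "m + l < int N")
      case True
      then show ?thesis using Pp[of m] Pp[of "m + l"] m l pos by auto
    next
      case False
      then have "wedge (P m) (P (m + l)) = - wedge (p m) (p (m + l - int N))"
        using PN[of m "m + l - int N"] Pp[of "m + l - int N"] Pp[of m] m l by simp
      then show ?thesis using pos[of "m + l - int N" m] wedge_swap[of "p m" "p (m + l - int N)"] m l False by simp
    qed
    then show ?thesis using reduce[of i l] unfolding m_def by simp
  qed
  have quid: "F 1 j = int (poly_quiddity N T (j + 1))" for j
  proof -
    define m where "m = (j + 1) mod int N"
    have m: "0 \<le> m" "m < int N" using N0 unfolding m_def by auto
    define c where "c = int (poly_quiddity N T (j + 1))"
    have cm: "c = int (card (inner_triangles 0 (int N - 1) m))"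
      unfolding c_def m_def poly_quiddity_eq by simp
    note tc = triangle_counts[of p, OF unit last_side]
    have "m = j + 1 - ((j + 1) div int N) * int N" unfolding m_def by (simp add: minus_div_mult_eq_mod)
    then have jm: "j = (m - 1) + ((j + 1) div int N) * int N" by simp
    then have "F 1 j = wedge (P (m - 1)) (P (m + 1))"
      using shiftd[of "m - 1" "(j + 1) div int N" "m + 1"] unfolding F_def by (smt (verit))
    moreover have "wedge (P (m - 1)) (P (m + 1)) = c"
    proof -
      \<comment> \<open>At the two ends of the side \<open>{0, N - 1}\<close> one neighbour lies
        beyond the seam and carries a sign, which matches the end formulas of
        \<open>triangle_counts\<close>; all other vertices are inner.\<close>
      consider "m = 0" | "m = int N - 1" | "0 < m" "m < int N - 1" using m by linarith
      then show ?thesis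
      proof cases
        case 1
        have "wedge (P (m - 1)) (P (m + 1)) = - wedge (P (int N - 1)) (P 1)"
          using shift[of "-1" 1] PN[of "int N - 1" 1] 1 by simp
        also have "\<dots> = wedge (p 1) (p (int N - 1))"
          using Pp[of 1] Pp[of "int N - 1"] N wedge_swap[of "p 1" "p (int N - 1)"] by simp
        also have "\<dots> = c * wedge (p 0) (p (int N - 1))"
          using tc N unfolding cm 1 by auto
        finally show ?thesis using unit[OF last_side] N by simp
      next
        case 2
        have "wedge (P (m - 1)) (P (m + 1)) = - wedge (P (int N - 2)) (P 0)"
          using PN[of "int N - 2" 0] 2 by simp
        also have "\<dots> = - wedge (p (int N - 1 - 1)) (p 0)"
          using Pp[of 0] Pp[of "int N - 2"] N by (simp add: algebra_simps)
        also have "\<dots> = - (c * wedge (p (int N - 1)) (p 0))"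
          using tc N unfolding cm 2 by auto
        finally show ?thesis using unit[OF last_side] N wedge_swap[of "p (int N - 1)" "p 0"] by simp
      next
        case 3
        have e: "wedge (p (m - 1)) (p m) = 1" using unit[of "m - 1" m] side[of "m - 1"] 3 by auto
        have "wedge (p (m - 1)) (p (m - 1)) + wedge (p (m + 1)) (p (m - 1)) = c * wedge (p m) (p (m - 1))"
          using quiddity_recurrence[of p m "p (m - 1)"] unit 3 m unfolding cm poly_quiddity_eq by simp
        then have "wedge (p (m - 1)) (p (m + 1)) = c"
          using e wedge_swap[of "p (m - 1)" "p (m + 1)"] wedge_swap[of "p (m - 1)" "p m"] by simp
        then show ?thesis using Pp[of "m - 1"] Pp[of "m + 1"] 3 by simp
      qed
    qed
    ultimately show ?thesis unfolding c_def by simp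
  qed
  have N3: "int (N - 3) = int N - 3" using N by auto
  have "is_frieze_A (N - 3) F"
    unfolding is_frieze_A_def N3
  proof (intro conjI allI ballI)
    fix j
    show "F (-1) j = 0" unfolding F_def by simp
    show "F 0 j = 1" unfolding F_def using P1 by simp
    have "wedge (P j) (P (j - 1 + int N)) = 1"
      using PN[of j "j - 1"] P1[of "j - 1"] wedge_swap[of "P j" "P (j - 1)"] by simp
    then show "F (int N - 3 + 1) j = 1" unfolding F_def by (simp add: algebra_simps)
    have "wedge (P j) (P (j + int N)) = 0" using PN[of j j] by simp
    then show "F (int N - 3 + 2) j = 0" unfolding F_def by (simp add: algebra_simps)
  next
    fix r j assume "r \<in> {1..int N - 3}"
    then show "F r j > 0" using Ppos[of "r + 1" j] unfolding F_def by (simp add: add.assoc)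
  next
    fix r j
    have "wedge (P j) (P (j + r + 1)) * wedge (P (j + 1)) (P (j + r + 1 + 1))
      = wedge (P j) (P (j + 1)) * wedge (P (j + r + 1)) (P (j + r + 1 + 1))
      + wedge (P j) (P (j + r + 1 + 1)) * wedge (P (j + 1)) (P (j + r + 1))"
      by (rule plucker)
    then show "diamond F r j" unfolding diamond_def F_def P1
      by (simp add: algebra_simps)
  qed
  with quid have ex: "is_frieze_A (N - 3) F \<and> (\<forall>j. F 1 j = int (poly_quiddity N T (j + 1)))" by simp
  have fr: "is_frieze_A (N - 3) (frieze_A N T) \<and> (\<forall>j. frieze_A N T 1 j = int (poly_quiddity N T (j + 1)))"
    unfolding frieze_A_def by (rule someI[of _ F]) (rule ex)
  have "frieze_A N T r j = F r j"
    by (rule frieze_A_unique[of "N - 3"]) (use fr ex r N3 in auto)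
  then show ?thesis using Pp[of j] Pp[of "j + r + 1"] r unfolding F_def by auto
qed

end

section \<open>Gluing two triangulated polygons along a side\<close>

text \<open>Relabelling from the first copy to the second: the puncture stays \<open>0\<close>, and
  \<open>1\<close> goes to \<open>n + 1\<close>, so the side \<open>{0, 1}\<close> becomes the
  diameter along which the copies are glued.\<close>

definition shift :: "nat \<Rightarrow> int \<Rightarrow> int" where
  "shift n m = (if m = 0 then 0 else m + int n)"

lemma shift_less: "0 \<le> x \<Longrightarrow> 0 \<le> y \<Longrightarrow> shift n x < shift n y \<longleftrightarrow> x < y"
  unfolding shift_def by auto

lemma crosses_shift:
  assumes "0 \<le> u" "u < v" "0 \<le> x" "x < y"
  shows "crosses {shift n u, shift n v} {shift n x, shift n y} \<longleftrightarrow> crosses {u, v} {x, y}"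
proof -
  have "shift n u < shift n v" "shift n x < shift n y" using assms shift_less by auto
  from crosses_iff[OF this] show ?thesis
    using assms crosses_iff[of u v x y] by (simp add: shift_less)
qed

text \<open>Restricted to arcs because \<open>shift\<close> is injective only on suitable sets: it
  sends \<open>- int n\<close> to \<open>0\<close> as well.\<close>

lemma inj_on_image_shift: "inj_on ((`) (shift n)) (poly_arcs N)"
proof -
  have "inj_on (shift n) {0..}" unfolding shift_def inj_on_def by auto
  moreover have "e \<subseteq> {0..}" if "e \<in> poly_arcs N" for e using that unfolding poly_arcs_def by auto
  ultimately show ?thesis unfolding inj_on_def by (metis inj_on_image_eq_iff inj_on_def)
qed

lemma poly_arc_bound:
  assumes "e \<in> poly_arcs N"
  shows "e \<subseteq> {0..int N - 1}"
  using assms unfolding poly_arcs_def by auto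

text \<open>The larger end of a diagonal is at least 2, so its shift leaves the vertices
  \<open>0\<close> to \<open>n + 1\<close> of the first copy. This keeps the two copies of an arc
  apart.\<close>

lemma shifted_arc_reaches:
  assumes "n \<ge> 2" "e \<in> poly_arcs (n + 2)"
  shows "\<exists>m\<in>shift n ` e. m \<ge> int n + 2"
proof -
  have "n + 2 \<ge> 3" using assms by simp
  then obtain u v where "e = {u, v}" "0 \<le> u" "u + 2 \<le> v"
    by (rule poly_arcsE[OF _ assms(2)])
  then have "shift n v \<in> shift n ` e" "shift n v \<ge> int n + 2" unfolding shift_def by auto
  then show ?thesis by blast
qed

text \<open>Two different halves are allowed because they do differ between the two flips. For
  maximality, a chord that does not cross the diameter lies within one half, where the given
  triangulation decides.\<close>

lemma glue_triangulations:
  assumes n: "n \<ge> 2"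
    and Q: "poly_triangulation (n + 2) Q" and R: "poly_triangulation (n + 2) R"
  shows "poly_triangulation (2 * n + 2) (Q \<union> (`) (shift n) ` R \<union> {{0, int n + 1}})"
    (is "poly_triangulation _ ?T")
proof -
  interpret q: triangulated_polygon "n + 2" Q by unfold_locales (use n Q in auto)
  interpret r: triangulated_polygon "n + 2" R by unfold_locales (use n R in auto)
  define D where "D = (\<lambda>u v. 0 \<le> u \<and> u + 2 \<le> v \<and> v \<le> int n + 1 \<and> \<not> (u = 0 \<and> v = int n + 1))"
  have arc: "{u, v} \<in> poly_arcs (n + 2)" if "D u v" for u v
    using that poly_arcs_iff[of "n + 2" u v] n unfolding D_def by auto
  have elem: "\<exists>u v. D u v \<and> e = {u, v}" if e: "e \<in> poly_arcs (n + 2)" for e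
  proof -
    have "n + 2 \<ge> 3" using n by simp
    then obtain u v where "e = {u, v}" "0 \<le> u" "u + 2 \<le> v" "v < int (n + 2)" "\<not> (u = 0 \<and> v = int (n + 2) - 1)"
      by (rule poly_arcsE[OF _ e])
    then show ?thesis unfolding D_def by (intro exI[of _ u] exI[of _ v]) auto
  qed
  have big: "2 * n + 2 \<ge> 3" using n by simp
  have cases: "(\<exists>u v. D u v \<and> e = {u, v} \<and> {u, v} \<in> Q) \<or>
      (\<exists>u v. D u v \<and> e = {shift n u, shift n v} \<and> {u, v} \<in> R) \<or> e = {0, int n + 1}"
    if "e \<in> ?T" for e
  proof -
    consider "e \<in> Q" | f where "f \<in> R" "e = shift n ` f" | "e = {0, int n + 1}" using \<open>e \<in> ?T\<close> by blast
    then show ?thesis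
    proof cases
      case 1
      then obtain u v where "D u v" "e = {u, v}" using elem[of e] q.T_arcs by blast
      then show ?thesis using 1 by auto
    next
      case 2
      then obtain u v where "D u v" "f = {u, v}" using elem[of f] r.T_arcs by blast
      then show ?thesis using 2 by auto
    qed simp
  qed
  have sD: "shift n u < shift n v \<and> shift n v > int n + 1 \<and> (shift n u = 0 \<or> shift n u \<ge> int n + 1)
    \<and> shift n v \<le> 2 * int n + 1 \<and> shift n u + 2 \<le> shift n v \<and> 0 \<le> shift n u
    \<and> \<not> (shift n u = 0 \<and> shift n v = 2 * int n + 1)" if "D u v" for u v
    using that unfolding D_def shift_def by auto
  have QR: "\<not> crosses {u, v} {shift n x, shift n y}" if "D u v" "D x y" for u v x y
  proof -
    have "u < v" "v \<le> int n + 1" "0 \<le> u" using that unfolding D_def by auto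
    then show ?thesis using crosses_iff[of u v "shift n x" "shift n y"] sD[OF that(2)] by auto
  qed
  have QD: "\<not> crosses {u, v} {0, int n + 1}" if "D u v" for u v
    using that crosses_iff[of u v 0 "int n + 1"] unfolding D_def by auto
  have RD: "\<not> crosses {shift n u, shift n v} {0, int n + 1}" if "D u v" for u v
    using sD[OF that] crosses_iff[of "shift n u" "shift n v" 0 "int n + 1"] by auto
  have DD: "\<not> crosses {0, int n + 1} {0, int n + 1}"
    using crosses_iff[of 0 "int n + 1" 0 "int n + 1"] by auto
  have QQ: "\<not> crosses {u, v} {x, y}" if "{u, v} \<in> Q" "{x, y} \<in> Q" for u v x y
    using q.T_noncrossing that by blast
  have RQ: "\<not> crosses {shift n x, shift n y} {u, v}" if "D u v" "D x y" for u v x y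
    using QR[OF that] crosses_sym by metis
  have DQ: "\<not> crosses {0, int n + 1} {u, v}" if "D u v" for u v
    using QD[OF that] crosses_sym by metis
  have DR: "\<not> crosses {0, int n + 1} {shift n u, shift n v}" if "D u v" for u v
    using RD[OF that] crosses_sym by metis
  have RR: "\<not> crosses {shift n u, shift n v} {shift n x, shift n y}"
    if "D u v" "D x y" "{u, v} \<in> R" "{x, y} \<in> R" for u v x y
    using r.T_noncrossing[OF that(3,4)] that(1,2) crosses_shift[of u v x y] unfolding D_def by auto
  show ?thesis
  proof (rule poly_triangulationI)
    show "?T \<subseteq> poly_arcs (2 * n + 2)"
    proof
      fix e assume "e \<in> ?T"
      from cases[OF this]
      have "\<exists>u v. e = {u, v} \<and> 0 \<le> u \<and> u + 2 \<le> v \<and> v \<le> 2 * int n + 1 \<and> \<not> (u = 0 \<and> v = 2 * int n + 1)"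
        (is ?goal)
      proof (elim disjE exE conjE)
        fix u v assume "D u v" "e = {u, v}"
        then show ?goal using n unfolding D_def by (intro exI[of _ u] exI[of _ v]) auto
      next
        fix u v assume "D u v" "e = {shift n u, shift n v}"
        then show ?goal using sD by (intro exI[of _ "shift n u"] exI[of _ "shift n v"]) auto
      next
        assume "e = {0, int n + 1}"
        then show ?goal using n by (intro exI[of _ 0] exI[of _ "int n + 1"]) auto
      qed
      then obtain u v where "e = {u, v}" "0 \<le> u" "u + 2 \<le> v" "v \<le> 2 * int n + 1" "\<not> (u = 0 \<and> v = 2 * int n + 1)"
        by blast
      then show "e \<in> poly_arcs (2 * n + 2)" using poly_arcs_iff[OF big, of u v] by auto
    qed
  next
    fix a b assume "a \<in> ?T" "b \<in> ?T"
    from cases[OF this(1)] cases[OF this(2)] show "\<not> crosses a b"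
      by (elim disjE exE conjE)
        (simp_all only: QQ QR RQ QD DQ RD DR RR DD simp_thms)
  next
    fix c assume c: "c \<in> poly_arcs (2 * n + 2)" and nc: "\<And>a. a \<in> ?T \<Longrightarrow> \<not> crosses a c"
    obtain a b where ab: "c = {a, b}" "0 \<le> a" "a + 2 \<le> b" "b \<le> 2 * int n + 1" "\<not> (a = 0 \<and> b = 2 * int n + 1)"
    proof -
      obtain u v where "c = {u, v}" "0 \<le> u" "u + 2 \<le> v" "v < int (2 * n + 2)"
        "\<not> (u = 0 \<and> v = int (2 * n + 2) - 1)"
        by (rule poly_arcsE[OF big c])
      then show thesis by (intro that[of u v]) auto
    qed
    have "a < b" using ab by auto
    have "\<not> crosses {0, int n + 1} c" by (rule nc) simp
    \<comment> \<open>A chord from \<open>0\<close> to a vertex beyond \<open>n + 1\<close> is not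
      excluded here; it belongs to the second copy, which shares the vertex
      \<open>0\<close>.\<close>
    then have nd: "\<not> (0 < a \<and> a < int n + 1 \<and> int n + 1 < b)"
      using crosses_iff[of 0 "int n + 1" a b] ab by auto
    show "c \<in> ?T"
    proof (cases "b \<le> int n + 1")
      case True
      show ?thesis
      proof (cases "a = 0 \<and> b = int n + 1")
        case False
        then have "D a b" using True ab unfolding D_def by auto
        then have "c \<in> Q" using q.T_maximal[of c] arc nc ab(1) by simp
        then show ?thesis by simp
      qed (use ab in simp)
    next
      case False
      define a' b' where "a' = (if a = 0 then 0 else a - int n)" and "b' = b - int n"
      have D: "D a' b'" using False ab nd unfolding D_def a'_def b'_def by auto
      have sh: "shift n a' = a" "shift n b' = b" using False ab nd unfolding shift_def a'_def b'_def by auto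
      have "{a', b'} \<in> R"
      proof (rule r.T_maximal)
        show "{a', b'} \<in> poly_arcs (n + 2)" using arc D by simp
        fix f assume "f \<in> R"
        then obtain u v where uv: "D u v" "f = {u, v}" using elem r.T_arcs by blast
        have "shift n ` f \<in> ?T" using \<open>f \<in> R\<close> by blast
        then have "\<not> crosses (shift n ` f) c" by (rule nc)
        then show "\<not> crosses f {a', b'}" using crosses_shift[of u v a' b' n] uv D sh ab(1) unfolding D_def by simp
      qed
      then have "shift n ` {a', b'} \<in> ?T" by blast
      then show ?thesis using sh ab by simp
    qed
  qed
qed

section \<open>Arcs of the cut disk\<close>

lemma int_mod_eq_iff: "(s::int) mod n = c mod n \<longleftrightarrow> (\<exists>d. s = c + d * n)"
  by (metis add.commute diff_add_cancel dvd_def mod_eq_dvd_iff mod_mult_self1 mult.commute)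

locale cut_disk =
  fixes n :: nat and k :: int
  assumes n: "n \<ge> 2" and k: "0 \<le> k" "k < int n"
begin

definition diagonal :: "int \<Rightarrow> int \<Rightarrow> bool" where
  "diagonal u v \<longleftrightarrow> 0 \<le> u \<and> u + 2 \<le> v \<and> v \<le> int n + 1 \<and> \<not> (u = 0 \<and> v = int n + 1)"

text \<open>The vertex \<open>m\<close> of the cut polygon in the \<open>d\<close>-th translate of
  the fundamental domain. Vertex \<open>n + 1\<close> of one translate is vertex \<open>1\<close> of
  the next; the puncture is common to all.\<close>

definition lift_vertex :: "int \<Rightarrow> int \<Rightarrow> int extended" where
  "lift_vertex d m = (if m = 0 then \<infinity> else Fin (k + m - 1 + d * int n))"

text \<open>Inverse of \<open>copy1\<close> in sorted coordinates; see
  \<open>copy1_arc_of\<close>.\<close>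

definition arc_of :: "int \<Rightarrow> int \<Rightarrow> disk_arc" where
  "arc_of u v = (if u = 0 then Radius ((k + v - 1) mod int n)
     else Around ((k + u - 1) mod int n) ((k + v - 1) mod int n))"

definition compatible :: "disk_arc set" where
  "compatible = {a \<in> disk_arcs n. a \<noteq> Radius k \<and> \<not> disk_crosses n a (Radius k)}"

lemma diagonal_iff: "u < v \<Longrightarrow> {u, v} \<in> poly_arcs (n + 2) \<longleftrightarrow> diagonal u v"
  using poly_arcs_iff[of "n + 2" u v] n unfolding diagonal_def by auto

lemma diagonalE:
  assumes "e \<in> poly_arcs (n + 2)"
  obtains u v where "diagonal u v" "e = {u, v}"
proof -
  have "n + 2 \<ge> 3" using n by simp
  then obtain u v where "e = {u, v}" "0 \<le> u" "u + 2 \<le> v" "v < int (n + 2)" "\<not> (u = 0 \<and> v = int (n + 2) - 1)"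
    by (rule poly_arcsE[OF _ assms])
  then show thesis by (intro that[of u v]) (auto simp: diagonal_def)
qed

text \<open>Replaces the nonlinear term \<open>d * int n\<close> by three alternatives that linear
  arithmetic can use, mostly to conclude that two translates coincide.\<close>

lemma multiple_cases:
  fixes d :: int
  obtains "d = 0" | "d * int n \<ge> int n" "d \<ge> 1" | "d * int n \<le> - int n" "d \<le> -1"
proof -
  consider "d = 0" | "d \<ge> 1" | "d \<le> -1" by linarith
  then show thesis
  proof cases
    case 2
    then have "1 * int n \<le> d * int n" by (intro mult_right_mono) auto
    then show thesis using that 2 by simp
  next
    case 3
    then have "d * int n \<le> (-1) * int n" by (intro mult_right_mono) auto
    then show thesis using that 3 by simp
  qed (use that in simp)
qed

text \<open>The residue in \<open>disk_len\<close> is taken of the length minus one, so a full turn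
  \<open>v - u = n\<close> is recovered as \<open>n\<close> and not as 0.\<close>

lemma disk_len_arc:
  assumes "1 \<le> v - u" "v - u \<le> int n"
  shows "disk_len n ((k + u - 1) mod int n) ((k + v - 1) mod int n) = v - u"
proof -
  have "((k + v - 1) mod int n - (k + u - 1) mod int n - 1) mod int n
      = (((k + v - 1) mod int n - (k + u - 1) mod int n) mod int n - 1) mod int n"
    by (rule mod_diff_left_eq[symmetric])
  also have "\<dots> = (((k + v - 1) - (k + u - 1)) mod int n - 1) mod int n"
    by (simp only: mod_diff_eq)
  also have "\<dots> = ((k + v - 1) - (k + u - 1) - 1) mod int n"
    by (rule mod_diff_left_eq)
  also have "(k + v - 1) - (k + u - 1) - 1 = v - u - 1" by simp
  finally have "((k + v - 1) mod int n - (k + u - 1) mod int n - 1) mod int n = (v - u - 1) mod int n" .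
  then show ?thesis using assms unfolding disk_len_def by simp
qed

lemma lifts_arc_of:
  assumes "diagonal u v"
  shows "lifts n (arc_of u v) = range (\<lambda>d. {lift_vertex d u, lift_vertex d v})"
proof (cases "u = 0")
  case True
  have "v \<noteq> 0" using assms unfolding diagonal_def by auto
  then show ?thesis using True unfolding arc_of_def lift_vertex_def
    by (auto simp: int_mod_eq_iff insert_commute)
next
  case False
  then have v: "v \<noteq> 0" "1 \<le> v - u" "v - u \<le> int n" using assms unfolding diagonal_def by auto
  have l: "k + u - 1 + d * int n + (v - u) = k + v - 1 + d * int n" for d by simp
  show ?thesis using False v(1) unfolding arc_of_def lift_vertex_def
    by (auto simp: int_mod_eq_iff disk_len_arc[OF v(2,3)] l)
qed

lemma lifts_cut_radius: "lifts n (Radius k) = range (\<lambda>d. {Fin (k + d * int n), \<infinity>})"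
proof -
  have "s mod int n = k \<longleftrightarrow> (\<exists>d. s = k + d * int n)" for s
    using int_mod_eq_iff[of s "int n" k] k by simp
  then show ?thesis by auto
qed

lemma disk_crosses_sym: "disk_crosses n a b \<longleftrightarrow> disk_crosses n b a"
  unfolding disk_crosses_def using crosses_sym by blast

lemma not_crosses_infinity: "\<not> crosses {Fin s, \<infinity>} {Fin t, \<infinity>}"
  using crosses_iff[of "Fin s" \<infinity> "Fin t" \<infinity>] by simp

lemma crosses_infinity_iff:
  "s < t \<Longrightarrow> crosses {Fin s, Fin t} {Fin r, \<infinity>} \<longleftrightarrow> s < r \<and> r < t"
  using crosses_iff[of "Fin s" "Fin t" "Fin r" \<infinity>] by auto

lemma arc_of_compatible:
  assumes uv: "diagonal u v"
  shows "arc_of u v \<in> compatible"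
proof -
  have d: "0 \<le> u" "u + 2 \<le> v" "v \<le> int n + 1" "\<not> (u = 0 \<and> v = int n + 1)"
    using uv unfolding diagonal_def by auto
  have n0: "int n > 0" using n by simp
  have "arc_of u v \<in> disk_arcs n"
  proof (cases "u = 0")
    case False
    then show ?thesis using d n0 disk_len_arc[of v u] unfolding arc_of_def disk_arcs_def by auto
  qed (use n0 in \<open>auto simp: arc_of_def disk_arcs_def\<close>)
  moreover have "arc_of u v \<noteq> Radius k"
  proof
    assume eq: "arc_of u v = Radius k"
    then have u: "u = 0" and "(k + v - 1) mod int n = k mod int n"
      using k unfolding arc_of_def by (auto split: if_splits)
    then obtain c where "k + v - 1 = k + c * int n" unfolding int_mod_eq_iff by blast
    then show False using d u by (cases rule: multiple_cases[of c]) auto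
  qed
  moreover have "\<not> crosses {lift_vertex c u, lift_vertex c v} {Fin (k + e * int n), \<infinity>}" for c e
  proof (cases "u = 0")
    case True
    then show ?thesis using not_crosses_infinity d unfolding lift_vertex_def by (auto simp: insert_commute)
  next
    case False
    have "\<not> (k + u - 1 + c * int n < k + e * int n \<and> k + e * int n < k + v - 1 + c * int n)"
    proof
      assume *: "k + u - 1 + c * int n < k + e * int n \<and> k + e * int n < k + v - 1 + c * int n"
      have "(e - c) * int n = e * int n - c * int n" by (simp add: left_diff_distrib)
      then show False using * d False by (cases rule: multiple_cases[of "e - c"]) auto
    qed
    then show ?thesis
      using crosses_infinity_iff[of "k + u - 1 + c * int n" "k + v - 1 + c * int n" "k + e * int n"] False d
      unfolding lift_vertex_def by simp
  qed
  then have "\<not> disk_crosses n (arc_of u v) (Radius k)"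
    unfolding disk_crosses_def lifts_arc_of[OF uv] lifts_cut_radius by blast
  ultimately show ?thesis unfolding compatible_def by simp
qed

text \<open>A curve is lifted so that it starts in the fundamental domain; if it ran past
  \<open>k + n\<close>, it would cross the lift of the cut radius there.\<close>

lemma compatibleE:
  assumes "a \<in> compatible"
  obtains u v where "diagonal u v" "a = arc_of u v"
proof -
  have a: "a \<in> disk_arcs n" "a \<noteq> Radius k" "\<not> disk_crosses n a (Radius k)"
    using assms unfolding compatible_def by auto
  have n0: "int n > 0" using n by simp
  have offset: "(k + (1 + (x - k) mod int n) - 1) mod int n = x" if "0 \<le> x" "x < int n" for x
    using that by (simp add: mod_simps)
  show thesis
  proof (cases a)
    case (Radius w)
    then have w: "0 \<le> w" "w < int n" "w \<noteq> k" using a unfolding disk_arcs_def by auto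
    define v where "v = 1 + (w - k) mod int n"
    have "(w - k) mod int n \<noteq> 0"
    proof
      assume "(w - k) mod int n = 0"
      then have "w mod int n = k mod int n" by (simp add: mod_eq_dvd_iff mod_0_imp_dvd)
      then show False using w k by simp
    qed
    moreover have "0 \<le> (w - k) mod int n" "(w - k) mod int n < int n" using n0 by auto
    ultimately have "diagonal 0 v" unfolding diagonal_def v_def by auto
    moreover have "a = arc_of 0 v" using Radius offset[of w] w unfolding arc_of_def v_def by simp
    ultimately show thesis using that by blast
  next
    case (Around x y)
    then have xy: "0 \<le> x" "x < int n" "0 \<le> y" "y < int n" "disk_len n x y \<ge> 2"
      using a unfolding disk_arcs_def by auto
    define u where "u = 1 + (x - k) mod int n"
    define v where "v = u + disk_len n x y"
    have u: "1 \<le> u" "u \<le> int n" using pos_mod_bound[OF n0, of "x - k"] pos_mod_sign[OF n0, of "x - k"] unfolding u_def by linarith+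
    have ux: "(k + u - 1) mod int n = x" using offset[of x] xy unfolding u_def by simp
    have "v \<le> int n + 1"
    proof (rule ccontr)
      assume "\<not> v \<le> int n + 1"
      then have "crosses {Fin (k + u - 1), Fin (k + u - 1 + disk_len n x y)} {Fin (k + 1 * int n), \<infinity>}"
        using crosses_infinity_iff[of "k + u - 1" "k + u - 1 + disk_len n x y" "k + 1 * int n"] u xy unfolding v_def by auto
      moreover have "{Fin (k + u - 1), Fin (k + u - 1 + disk_len n x y)} \<in> lifts n a"
        using ux Around by auto
      moreover have "{Fin (k + 1 * int n), \<infinity>} \<in> lifts n (Radius k)" unfolding lifts_cut_radius by blast
      ultimately show False using a(3) unfolding disk_crosses_def by blast
    qed
    then have "diagonal u v" using u xy unfolding diagonal_def v_def by auto
    moreover have "(k + v - 1) mod int n = y"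
    proof -
      have "(k + v - 1) mod int n = ((k + u - 1) + disk_len n x y) mod int n"
        unfolding v_def by (simp add: algebra_simps)
      also have "\<dots> = (x + disk_len n x y) mod int n" unfolding ux[symmetric] by (simp add: mod_simps)
      also have "\<dots> = ((y - x - 1) mod int n + (x + 1)) mod int n"
        unfolding disk_len_def by (simp add: algebra_simps)
      also have "\<dots> = ((y - x - 1) + (x + 1)) mod int n" by (rule mod_add_left_eq)
      also have "(y - x - 1) + (x + 1) = y" by simp
      finally show ?thesis using xy by simp
    qed
    then have "a = arc_of u v" using Around ux u unfolding arc_of_def by simp
    ultimately show thesis using that by blast
  qed
qed

text \<open>The puncture is the last vertex of the cover but vertex \<open>0\<close> of the polygon;
  this is a rotation of the cyclic order and does not affect interlacing. Different translates are
  separated by a lift of the cut radius.\<close>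

lemma crosses_lift_vertex:
  assumes uv: "diagonal u v" and xy: "diagonal x y"
  shows "crosses {lift_vertex c u, lift_vertex c v} {lift_vertex d x, lift_vertex d y} \<longleftrightarrow>
    c = d \<and> crosses {u, v} {x, y}"
proof -
  have D: "0 \<le> u" "u + 2 \<le> v" "v \<le> int n + 1" "u = 0 \<Longrightarrow> v \<le> int n"
    "0 \<le> x" "x + 2 \<le> y" "y \<le> int n + 1" "x = 0 \<Longrightarrow> y \<le> int n"
    using uv xy unfolding diagonal_def by auto
  \<comment> \<open>Displacement between the two translates: zero, at least \<open>n\<close>, or at
    most \<open>- n\<close>. With this the comparison of endpoints is linear.\<close>
  define g where "g = (d - c) * int n"
  have g: "d * int n = c * int n + g" unfolding g_def by (simp add: left_diff_distrib)
  have "d - c = 0 \<and> g = 0 \<or> d - c \<noteq> 0 \<and> g \<ge> int n \<or> d - c \<noteq> 0 \<and> g \<le> - int n"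
    unfolding g_def by (cases rule: multiple_cases[of "d - c"]) auto
  then have G: "c = d \<and> g = 0 \<or> c \<noteq> d \<and> g \<ge> int n \<or> c \<noteq> d \<and> g \<le> - int n" by auto
  have iff: "crosses {u, v} {x, y} \<longleftrightarrow> u < x \<and> x < v \<and> v < y \<or> x < u \<and> u < y \<and> y < v"
    using crosses_iff[of u v x y] D(2,6) by simp
  have Fins: "{lift_vertex c u, lift_vertex c v} = {Fin (k + u - 1 + c * int n), Fin (k + v - 1 + c * int n)}" if "u \<noteq> 0"
    using that D unfolding lift_vertex_def by auto
  have Finx: "{lift_vertex d x, lift_vertex d y} = {Fin (k + x - 1 + d * int n), Fin (k + y - 1 + d * int n)}" if "x \<noteq> 0"
    using that D unfolding lift_vertex_def by auto
  have inf: "{lift_vertex c u, lift_vertex c v} = {Fin (k + v - 1 + c * int n), \<infinity>}" if "u = 0"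
    using that D unfolding lift_vertex_def by auto
  have infx: "{lift_vertex d x, lift_vertex d y} = {Fin (k + y - 1 + d * int n), \<infinity>}" if "x = 0"
    using that D unfolding lift_vertex_def by auto
  show ?thesis
  proof (cases "u = 0"; cases "x = 0")
    assume "u = 0" "x = 0"
    then show ?thesis using not_crosses_infinity inf infx iff by simp
  next
    assume ux: "u = 0" "x \<noteq> 0"
    have "crosses {lift_vertex c u, lift_vertex c v} {lift_vertex d x, lift_vertex d y} \<longleftrightarrow>
      x + g < v \<and> v < y + g"
      unfolding inf[OF ux(1)] Finx[OF ux(2)] crosses_sym[of _ "{Fin _, Fin _}"] g
      by (subst crosses_infinity_iff) (use D in auto)
    then show ?thesis unfolding iff using G D(1-3,5-7) D(4)[OF ux(1)] ux by auto
  next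
    assume ux: "u \<noteq> 0" "x = 0"
    have "crosses {lift_vertex c u, lift_vertex c v} {lift_vertex d x, lift_vertex d y} \<longleftrightarrow>
      u < y + g \<and> y + g < v"
      unfolding infx[OF ux(2)] Fins[OF ux(1)] g
      by (subst crosses_infinity_iff) (use D in auto)
    then show ?thesis unfolding iff using G D(1-3,5-7) D(8)[OF ux(2)] ux by auto
  next
    assume ux: "u \<noteq> 0" "x \<noteq> 0"
    have "crosses {lift_vertex c u, lift_vertex c v} {lift_vertex d x, lift_vertex d y} \<longleftrightarrow>
      u < x + g \<and> x + g < v \<and> v < y + g \<or> x + g < u \<and> u < y + g \<and> y + g < v"
      (is "_ = ?rhs")
      unfolding Fins[OF ux(1)] Finx[OF ux(2)] g
    proof (subst crosses_iff)
      show "Fin (k + u - 1 + c * int n) < Fin (k + v - 1 + c * int n)"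
        "Fin (k + x - 1 + (c * int n + g)) < Fin (k + y - 1 + (c * int n + g))"
        using D(2,6) by simp_all
      have "(Fin (k + p - 1 + c * int n) < Fin (k + q - 1 + (c * int n + g))) = (p < q + g)"
        "(Fin (k + q - 1 + (c * int n + g)) < Fin (k + p - 1 + c * int n)) = (q + g < p)" for p q
        by auto
      then show "(Fin (k + u - 1 + c * int n) < Fin (k + x - 1 + (c * int n + g)) \<and>
         Fin (k + x - 1 + (c * int n + g)) < Fin (k + v - 1 + c * int n) \<and>
         Fin (k + v - 1 + c * int n) < Fin (k + y - 1 + (c * int n + g)) \<or>
         Fin (k + x - 1 + (c * int n + g)) < Fin (k + u - 1 + c * int n) \<and>
         Fin (k + u - 1 + c * int n) < Fin (k + y - 1 + (c * int n + g)) \<and>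
         Fin (k + y - 1 + (c * int n + g)) < Fin (k + v - 1 + c * int n)) = ?rhs" by (simp only:)
    qed
    moreover have u1: "1 \<le> u" "1 \<le> x" using ux D(1,5) by auto
    moreover have "\<not> (u < x + g \<and> x + g < v \<and> v < y + g \<or> x + g < u \<and> u < y + g \<and> y + g < v)"
      if "c \<noteq> d"
    proof -
      have "g \<ge> int n \<or> g \<le> - int n" using G that by auto
      then show ?thesis using D(1-3,5-7) u1 by (intro notI, elim disjE conjE) linarith+
    qed
    moreover have "g = 0" if "c = d" unfolding g_def using that by simp
    ultimately show ?thesis unfolding iff by (cases "c = d") simp_all
  qed
qed

lemma disk_crosses_arc_of:
  assumes "diagonal u v" "diagonal x y"
  shows "disk_crosses n (arc_of u v) (arc_of x y) \<longleftrightarrow> crosses {u, v} {x, y}"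
  unfolding disk_crosses_def lifts_arc_of[OF assms(1)] lifts_arc_of[OF assms(2)]
  using crosses_lift_vertex[OF assms] by auto

text \<open>Only the translate \<open>d = 0\<close> fits into the window. \<open>Radius k\<close>
  would have two lifts there, one at either end, but \<open>arc_of\<close> never yields it on
  diagonals.\<close>

lemma cut_arc_arc_of:
  assumes uv: "diagonal u v"
  shows "cut_arc n k (arc_of u v) = {lift_vertex 0 u, lift_vertex 0 v}"
  unfolding cut_arc_def
proof (rule the_equality)
  have D: "0 \<le> u" "u + 2 \<le> v" "v \<le> int n + 1" "u = 0 \<Longrightarrow> v \<le> int n"
    using uv unfolding diagonal_def by auto
  show "{lift_vertex 0 u, lift_vertex 0 v} \<in> lifts n (arc_of u v) \<and>
    {lift_vertex 0 u, lift_vertex 0 v} \<subseteq> Fin ` {k..k + int n} \<union> {\<infinity>}"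
    unfolding lifts_arc_of[OF uv] using D by (auto simp: lift_vertex_def)
  fix e assume e: "e \<in> lifts n (arc_of u v) \<and> e \<subseteq> Fin ` {k..k + int n} \<union> {\<infinity>}"
  then obtain d where d: "e = {lift_vertex d u, lift_vertex d v}" unfolding lifts_arc_of[OF uv] by blast
  have "d = 0"
  proof (cases "u = 0")
    case True
    then have "0 \<le> v - 1 + d * int n" "v - 1 + d * int n \<le> int n"
      using e d D unfolding lift_vertex_def by auto
    then show ?thesis using D True by (cases rule: multiple_cases[of d]) auto
  next
    case False
    then have "0 \<le> u - 1 + d * int n" "v - 1 + d * int n \<le> int n"
      using e d D unfolding lift_vertex_def by auto
    then show ?thesis using D False by (cases rule: multiple_cases[of d]) auto
  qed
  then show "e = {lift_vertex 0 u, lift_vertex 0 v}" using d by simp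
qed

lemma copy1_arc_of: "diagonal u v \<Longrightarrow> copy1 n k (arc_of u v) = {u, v}"
  unfolding copy1_def by (simp add: cut_arc_arc_of lift_vertex_def diagonal_def)

lemma copy2_eq_shift:
  assumes "a \<in> compatible"
  shows "copy2 n k a = shift n ` copy1 n k a"
proof -
  obtain u v where "diagonal u v" "a = arc_of u v" using compatibleE[OF assms] .
  then show ?thesis
    unfolding copy1_def copy2_def by (auto simp: cut_arc_arc_of lift_vertex_def diagonal_def shift_def)
qed

lemma copy1_compatible: "a \<in> compatible \<Longrightarrow> copy1 n k a \<in> poly_arcs (n + 2)"
  by (erule compatibleE) (use diagonal_iff in \<open>auto simp: copy1_arc_of diagonal_def\<close>)

lemma inj_on_copy1: "inj_on (copy1 n k) compatible"
proof (rule inj_onI)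
  fix a b assume "a \<in> compatible" "b \<in> compatible" and eq: "copy1 n k a = copy1 n k b"
  then obtain u v x y where uv: "diagonal u v" "a = arc_of u v" and xy: "diagonal x y" "b = arc_of x y"
    by (metis compatibleE)
  then have "{u, v} = {x, y}" using eq copy1_arc_of by simp
  then have "u = x" "v = y" using uv xy unfolding diagonal_def doubleton_eq_iff by auto
  then show "a = b" using uv xy by simp
qed

lemma copy1_surj:
  assumes "e \<in> poly_arcs (n + 2)"
  obtains a where "a \<in> compatible" "copy1 n k a = e"
  using diagonalE[OF assms] arc_of_compatible copy1_arc_of by metis

lemma disk_crosses_copy1:
  assumes "a \<in> compatible" "b \<in> compatible"
  shows "disk_crosses n a b \<longleftrightarrow> crosses (copy1 n k a) (copy1 n k b)"
proof -
  obtain u v where "diagonal u v" "a = arc_of u v" using compatibleE[OF assms(1)] .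
  moreover obtain x y where "diagonal x y" "b = arc_of x y" using compatibleE[OF assms(2)] .
  ultimately show ?thesis using disk_crosses_arc_of copy1_arc_of by simp
qed

definition flat :: "disk_arc set \<Rightarrow> int set set" where
  "flat T = copy1 n k ` (T - {Radius k})"

text \<open>\<open>copy1\<close> is a crossing-preserving bijection from \<open>compatible\<close>
  to the diagonals. An arc that could be added to \<open>T\<close> avoids \<open>Radius k\<close>,
  hence is compatible, so maximality on both sides concerns the same arcs.\<close>

lemma disk_triangulation_iff:
  assumes kT: "Radius k \<in> T"
  shows "disk_triangulation n T \<longleftrightarrow> T - {Radius k} \<subseteq> compatible \<and> poly_triangulation (n + 2) (flat T)"
proof
  assume T: "disk_triangulation n T"
  then have arcs: "T \<subseteq> disk_arcs n" and nc: "\<And>a b. a \<in> T \<Longrightarrow> b \<in> T \<Longrightarrow> \<not> disk_crosses n a b"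
    and mx: "\<And>c. c \<in> disk_arcs n \<Longrightarrow> (\<forall>a\<in>T. \<not> disk_crosses n a c \<and> \<not> disk_crosses n c a) \<Longrightarrow> c \<in> T"
    unfolding disk_triangulation_def is_triangulation_def by blast+
  have comp: "T - {Radius k} \<subseteq> compatible" using arcs nc kT unfolding compatible_def by auto
  moreover have "poly_triangulation (n + 2) (flat T)"
  proof (rule poly_triangulationI)
    show "flat T \<subseteq> poly_arcs (n + 2)" using comp copy1_compatible unfolding flat_def by auto
  next
    fix e f assume "e \<in> flat T" "f \<in> flat T"
    then obtain a b where ab: "a \<in> T" "b \<in> T" "a \<in> compatible" "b \<in> compatible" "e = copy1 n k a" "f = copy1 n k b"
      using comp unfolding flat_def by blast
    show "\<not> crosses e f" using disk_crosses_copy1[OF ab(3,4)] nc[OF ab(1,2)] ab(5,6) by simp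
  next
    fix e assume e: "e \<in> poly_arcs (n + 2)" and en: "\<And>f. f \<in> flat T \<Longrightarrow> \<not> crosses f e"
    obtain c where c: "c \<in> compatible" "copy1 n k c = e" using copy1_surj[OF e] .
    have "\<not> disk_crosses n a c" if a: "a \<in> T" for a
    proof (cases "a = Radius k")
      case True
      then show ?thesis using c(1) disk_crosses_sym[of c a] unfolding compatible_def by auto
    next
      case False
      then have "copy1 n k a \<in> flat T" "a \<in> compatible" using a comp unfolding flat_def by auto
      then show ?thesis using en disk_crosses_copy1[of a c] c by simp
    qed
    then have "c \<in> T" using mx[of c] c(1) disk_crosses_sym[of c] unfolding compatible_def by auto
    then show "e \<in> flat T" using c unfolding flat_def compatible_def by auto
  qed
  ultimately show "T - {Radius k} \<subseteq> compatible \<and> poly_triangulation (n + 2) (flat T)" by simp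
next
  assume *: "T - {Radius k} \<subseteq> compatible \<and> poly_triangulation (n + 2) (flat T)"
  have "n + 2 \<ge> 3" using n by simp
  then interpret q: triangulated_polygon "n + 2" "flat T" using * by unfold_locales simp_all
  have comp: "a \<in> compatible" if "a \<in> T" "a \<noteq> Radius k" for a using that * by auto
  have kk: "\<not> disk_crosses n (Radius k) (Radius k)"
    unfolding disk_crosses_def lifts_cut_radius using not_crosses_infinity by auto
  have ck: "\<not> disk_crosses n a (Radius k)" "\<not> disk_crosses n (Radius k) a" if "a \<in> compatible" for a
    using that disk_crosses_sym[of a] unfolding compatible_def by auto
  have flatI: "copy1 n k a \<in> flat T" if "a \<in> T" "a \<noteq> Radius k" for a
    using that unfolding flat_def by auto
  show "disk_triangulation n T" unfolding disk_triangulation_def is_triangulation_def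
  proof (intro conjI ballI impI)
    have "Radius k \<in> disk_arcs n" using k unfolding disk_arcs_def by simp
    then show "T \<subseteq> disk_arcs n" using comp unfolding compatible_def by auto
  next
    fix a b assume ab: "a \<in> T" "b \<in> T"
    show "\<not> disk_crosses n a b"
    proof (cases "a = Radius k \<or> b = Radius k")
      case True
      then show ?thesis using kk ck comp ab by metis
    next
      case False
      then show ?thesis using disk_crosses_copy1[of a b] comp ab flatI q.T_noncrossing by simp
    qed
  next
    fix c assume c: "c \<in> disk_arcs n" "\<forall>a\<in>T. \<not> disk_crosses n a c \<and> \<not> disk_crosses n c a"
    show "c \<in> T"
    proof (cases "c = Radius k")
      case False
      then have cc: "c \<in> compatible" using c kT unfolding compatible_def by auto
      have "copy1 n k c \<in> flat T"
      proof (rule q.T_maximal)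
        show "copy1 n k c \<in> poly_arcs (n + 2)" using copy1_compatible cc .
        fix f assume "f \<in> flat T"
        then obtain a where a: "a \<in> T" "a \<in> compatible" "f = copy1 n k a" using comp unfolding flat_def by auto
        then show "\<not> crosses f (copy1 n k c)" using disk_crosses_copy1[of a c] cc c by simp
      qed
      then obtain a where a: "a \<in> T" "a \<in> compatible" "copy1 n k a = copy1 n k c" using comp unfolding flat_def by auto
      then have "a = c" using inj_on_copy1 cc unfolding inj_on_def by blast
      then show ?thesis using a by simp
    qed (use kT in simp)
  qed
qed

section \<open>Mutation in the disk compared with mutation in the glued polygon\<close>

lemma tilde_eq:
  assumes "T - {Radius k} \<subseteq> compatible"
  shows "tilde n k T = flat T \<union> (`) (shift n) ` flat T \<union> {{0, int n + 1}}"
proof -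
  have "copy2 n k ` (T - {Radius k}) = (`) (shift n) ` flat T"
    unfolding flat_def image_image using assms copy2_eq_shift by (intro image_cong) auto
  then show ?thesis unfolding tilde_def flat_def by simp
qed

lemma disk_flip:
  assumes T: "disk_triangulation n T" "Radius k \<in> T" "a \<in> T" "a \<noteq> Radius k"
  obtains a' where "a' \<in> compatible" "copy1 n k a' \<noteq> copy1 n k a"
    "mutate (disk_triangulation n) a T = T - {a} \<union> {a'}"
    "disk_triangulation n (T - {a} \<union> {a'})"
    "flat (T - {a} \<union> {a'}) = flat T - {copy1 n k a} \<union> {copy1 n k a'}"
proof -
  have *: "T - {Radius k} \<subseteq> compatible" "poly_triangulation (n + 2) (flat T)"
    using T disk_triangulation_iff by auto
  interpret q: triangulated_polygon "n + 2" "flat T" using * n by unfold_locales auto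
  have ac: "a \<in> compatible" using * T by auto
  have aT: "copy1 n k a \<in> flat T" using T unfolding flat_def by auto
  have flat_flip: "flat (T - {a} \<union> {b}) = flat T - {copy1 n k a} \<union> {copy1 n k b}" if "b \<in> compatible" for b
  proof -
    have "b \<noteq> Radius k" using that unfolding compatible_def by auto
    then have "flat (T - {a} \<union> {b}) = copy1 n k ` ((T - {Radius k}) - {a}) \<union> {copy1 n k b}"
      unfolding flat_def by auto
    also have "copy1 n k ` ((T - {Radius k}) - {a}) = copy1 n k ` (T - {Radius k}) - copy1 n k ` {a}"
      by (rule inj_on_image_set_diff[OF inj_on_copy1]) (use * T in auto)
    finally show ?thesis unfolding flat_def by simp
  qed
  have tri_flip: "disk_triangulation n (T - {a} \<union> {b}) \<longleftrightarrow>
      poly_triangulation (n + 2) (flat T - {copy1 n k a} \<union> {copy1 n k b})" if "b \<in> compatible" for b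
    using disk_triangulation_iff[of "T - {a} \<union> {b}"] T * that flat_flip[OF that] by auto
  obtain e where e: "e \<noteq> copy1 n k a" "poly_triangulation (n + 2) (flat T - {copy1 n k a} \<union> {e})"
    using q.flip_exists[OF aT] .
  then have "e \<in> poly_arcs (n + 2)" unfolding poly_triangulation_def is_triangulation_def by auto
  then obtain a' where a': "a' \<in> compatible" "copy1 n k a' = e" using copy1_surj by blast
  have tri: "disk_triangulation n (T - {a} \<union> {a'})" using tri_flip a' e by simp
  have "(THE b. b \<noteq> a \<and> disk_triangulation n (T - {a} \<union> {b})) = a'"
  proof (rule the_equality)
    show "a' \<noteq> a \<and> disk_triangulation n (T - {a} \<union> {a'})" using tri e a' by auto
  next
    fix b assume b: "b \<noteq> a \<and> disk_triangulation n (T - {a} \<union> {b})"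
    \<comment> \<open>\<open>Radius k\<close> belongs to \<open>T\<close> already, so exchanging
      \<open>a\<close> for it would only remove \<open>a\<close>.\<close>
    have "b \<noteq> Radius k"
    proof
      assume "b = Radius k"
      then have eq: "T - {a} \<union> {b} = T - {a}" using T by auto
      have "T - {a} = T"
        using b T(1) unfolding eq disk_triangulation_def
        by (intro is_triangulation_maximal[where S = "T - {a}"]) auto
      then show False using T(3) by blast
    qed
    then have bc: "b \<in> compatible"
      using b disk_triangulation_iff[of "T - {a} \<union> {b}"] T by auto
    then have "poly_triangulation (n + 2) (flat T - {copy1 n k a} \<union> {copy1 n k b})"
      using tri_flip b by simp
    moreover have "copy1 n k b \<noteq> copy1 n k a"
      using inj_on_eq_iff[OF inj_on_copy1 bc ac] b by simp
    ultimately have "copy1 n k b = e" using q.flip_unique[OF aT _ _ e] by blast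
    then show "b = a'" using inj_on_eq_iff[OF inj_on_copy1 bc a'(1)] a'(2) by simp
  qed
  then have "mutate (disk_triangulation n) a T = T - {a} \<union> {a'}" unfolding mutate_def by simp
  then show thesis using that[of a'] a' e tri flat_flip by simp
qed

text \<open>The inner mutation produces halves \<open>Q\<close> and \<open>Q'\<close>, the outer one
  makes both halves \<open>Q'\<close>. All three stages are triangulations by gluing, so uniqueness
  of the flip identifies each mutation.\<close>

lemma tilde_mutate:
  assumes T: "disk_triangulation n T" "Radius k \<in> T" "a \<in> T" "a \<noteq> Radius k"
  defines "T' \<equiv> mutate (disk_triangulation n) a T"
  shows "disk_triangulation n T'" "Radius k \<in> T'"
    "tilde n k T' = mutate (poly_triangulation (2 * n + 2)) (copy1 n k a)
       (mutate (poly_triangulation (2 * n + 2)) (copy2 n k a) (tilde n k T))"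
proof -
  obtain a' where a': "a' \<in> compatible" "copy1 n k a' \<noteq> copy1 n k a" "T' = T - {a} \<union> {a'}"
    and T': "disk_triangulation n T'" and flat': "flat T' = flat T - {copy1 n k a} \<union> {copy1 n k a'}"
    using disk_flip[OF T] unfolding T'_def by metis
  show "disk_triangulation n T'" by (rule T')
  show k': "Radius k \<in> T'" using T a' by auto
  define e e' Q Q' D where "e = copy1 n k a" and "e' = copy1 n k a'"
    and "Q = flat T" and "Q' = flat T'" and "D = {0, int n + 1}"
  let ?S = "(`) (shift n)"
  have c: "T - {Radius k} \<subseteq> compatible" "poly_triangulation (n + 2) Q"
    using T disk_triangulation_iff unfolding Q_def by auto
  have c': "T' - {Radius k} \<subseteq> compatible" "poly_triangulation (n + 2) Q'"
    using T' k' disk_triangulation_iff unfolding Q'_def by auto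
  have ac: "a \<in> compatible" using c T by auto
  have Q: "Q \<subseteq> poly_arcs (n + 2)" and Q': "Q' \<subseteq> poly_arcs (n + 2)"
    using c(2) c'(2) unfolding poly_triangulation_def is_triangulation_def by auto
  have QQ': "Q' = Q - {e} \<union> {e'}" unfolding Q_def Q'_def e_def e'_def by (rule flat')
  have eQ: "e \<in> Q" using T unfolding Q_def e_def flat_def by auto
  have ne: "e' \<noteq> e" using a' unfolding e_def e'_def by auto
  have e: "e \<in> poly_arcs (n + 2)" "e' \<in> poly_arcs (n + 2)" using eQ Q QQ' Q' by auto
  have bound: "f \<subseteq> {0..int n + 1}" if "f \<in> poly_arcs (n + 2)" for f
    using poly_arc_bound[OF that] by (simp add: add.commute)
  have Dbound: "D \<subseteq> {0..int n + 1}" unfolding D_def by auto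
  have reach: "\<not> ?S f \<subseteq> {0..int n + 1}" if "f \<in> poly_arcs (n + 2)" for f
    using shifted_arc_reaches[OF n that] by fastforce
  have D_arc: "D \<notin> poly_arcs (n + 2)" using diagonal_iff[of 0 "int n + 1"] unfolding D_def diagonal_def by auto
  have inj: "?S f = ?S g \<longleftrightarrow> f = g" if "f \<in> poly_arcs (n + 2)" "g \<in> poly_arcs (n + 2)" for f g
    using inj_on_eq_iff[OF inj_on_image_shift that] .
  \<comment> \<open>Removing one copy of the arc must leave the other half and the diameter
    \<open>D\<close> untouched.\<close>
  have SeQ: "?S e \<notin> Q" "?S e \<noteq> D" using reach[OF e(1)] bound Q Dbound by blast+
  have eSQ: "e \<notin> ?S ` Q'" "e \<noteq> D" using reach Q' bound[OF e(1)] D_arc e(1) by blast+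
  have SQ: "?S ` Q - {?S e} = ?S ` (Q - {e})" using inj e Q by blast
  have t: "tilde n k T = Q \<union> ?S ` Q \<union> {D}" "tilde n k T' = Q' \<union> ?S ` Q' \<union> {D}"
    using tilde_eq c(1) c'(1) unfolding Q_def Q'_def D_def by auto
  have copy2: "copy2 n k a = ?S e" using copy2_eq_shift[OF ac] unfolding e_def .
  have step1: "tilde n k T - {?S e} \<union> {?S e'} = Q \<union> ?S ` Q' \<union> {D}"
    unfolding t QQ' using SeQ SQ by blast
  have step2: "(Q \<union> ?S ` Q' \<union> {D}) - {e} \<union> {e'} = tilde n k T'"
    unfolding t using eSQ QQ' by blast
  have tri: "poly_triangulation (2 * n + 2) (tilde n k T)"
    "poly_triangulation (2 * n + 2) (Q \<union> ?S ` Q' \<union> {D})"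
    "poly_triangulation (2 * n + 2) (tilde n k T')"
    using glue_triangulations[OF n] c(2) c'(2) unfolding t D_def by auto
  interpret p1: triangulated_polygon "2 * n + 2" "tilde n k T" using n tri by unfold_locales auto
  interpret p2: triangulated_polygon "2 * n + 2" "Q \<union> ?S ` Q' \<union> {D}" using n tri by unfold_locales auto
  have "mutate (poly_triangulation (2 * n + 2)) (copy2 n k a) (tilde n k T) = Q \<union> ?S ` Q' \<union> {D}"
    unfolding copy2 step1[symmetric]
  proof (rule p1.mutate_poly)
    show "?S e \<in> tilde n k T" using t eQ by blast
    show "?S e' \<noteq> ?S e" using inj[OF e(2,1)] ne by simp
    show "poly_triangulation (2 * n + 2) (tilde n k T - {?S e} \<union> {?S e'})" unfolding step1 by (rule tri)
  qed
  moreover have "mutate (poly_triangulation (2 * n + 2)) (copy1 n k a) (Q \<union> ?S ` Q' \<union> {D}) = tilde n k T'"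
    unfolding e_def[symmetric] step2[symmetric]
  proof (rule p2.mutate_poly)
    show "e \<in> Q \<union> ?S ` Q' \<union> {D}" using eQ by blast
    show "poly_triangulation (2 * n + 2) ((Q \<union> ?S ` Q' \<union> {D}) - {e} \<union> {e'})" unfolding step2 by (rule tri)
  qed (rule ne)
  ultimately show "tilde n k T' = mutate (poly_triangulation (2 * n + 2)) (copy1 n k a)
       (mutate (poly_triangulation (2 * n + 2)) (copy2 n k a) (tilde n k T))" by simp
qed

end

text \<open>No monotonicity is asked of \<open>f\<close>: it is applied to
  \<open>lift_vertex 0\<close>, which moves the puncture from the first to the last place.\<close>

lemma triangles_image:
  assumes inj: "inj_on f V"
    and E: "\<And>x y. x \<in> V \<Longrightarrow> y \<in> V \<Longrightarrow> x \<noteq> y \<Longrightarrow> {f x, f y} \<in> E' \<longleftrightarrow> {x, y} \<in> E"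
    and t: "t \<subseteq> V"
  shows "f ` t \<in> triangles E' \<longleftrightarrow> t \<in> triangles E"
proof -
  have c: "card (f ` t) = card t" using card_image inj_on_subset[OF inj t] by blast
  have eq: "f x = f y \<longleftrightarrow> x = y" if "x \<in> t" "y \<in> t" for x y
    using inj_on_eq_iff[OF inj] that t by blast
  have "(\<forall>u\<in>f ` t. \<forall>v\<in>f ` t. u \<noteq> v \<longrightarrow> {u, v} \<in> E') \<longleftrightarrow> (\<forall>u\<in>t. \<forall>v\<in>t. u \<noteq> v \<longrightarrow> {u, v} \<in> E)"
    using E t by (simp add: eq) (meson subsetD)
  then show ?thesis unfolding triangles_def using c by simp
qed

lemma triangle_sorted_iff:
  fixes a b c :: "'v::linorder"
  assumes "a < b" "b < c"
  shows "{a, b, c} \<in> triangles E \<longleftrightarrow> {a, b} \<in> E \<and> {b, c} \<in> E \<and> {a, c} \<in> E"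
proof
  assume "{a, b, c} \<in> triangles E"
  moreover have "a \<noteq> b" "b \<noteq> c" "a \<noteq> c" using assms by auto
  ultimately show "{a, b} \<in> E \<and> {b, c} \<in> E \<and> {a, c} \<in> E" unfolding triangles_def by blast
qed (use assms in \<open>auto intro: trianglesI\<close>)

section \<open>The triangulation of the universal cover\<close>

locale cut_triangulation = cut_disk +
  fixes T :: "disk_arc set"
  assumes tri: "disk_triangulation n T" and radius: "Radius k \<in> T"
begin

lemma T_compatible: "T - {Radius k} \<subseteq> compatible"
  using disk_triangulation_iff[OF radius] tri by simp

sublocale q: triangulated_polygon "n + 2" "flat T"
  using disk_triangulation_iff[OF radius] tri n by unfold_locales simp_all

sublocale t: triangulated_polygon "2 * n + 2" "tilde n k T"
proof
  show "3 \<le> 2 * n + 2" using n by simp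
  show "poly_triangulation (2 * n + 2) (tilde n k T)"
    unfolding tilde_eq[OF T_compatible] by (rule glue_triangulations[OF n q.tri q.tri])
qed

definition cover :: "int extended set set" where
  "cover = (\<Union>a\<in>T. lifts n a) \<union> {{Fin s, Fin (s + 1)} | s. True}"

lemma disk_triangles_eq: "disk_triangles n T = triangles cover"
  unfolding disk_triangles_def cover_def ..

lemma q_range: "{u, v} \<in> q.E \<Longrightarrow> u < v \<Longrightarrow> 0 \<le> u \<and> v \<le> int n + 1"
  using q.edge_range[of u v] by auto

lemma q_side: "0 \<le> u \<Longrightarrow> u \<le> int n \<Longrightarrow> {u, u + 1} \<in> q.E"
  using q.side[of u] by auto

lemma q_last_side: "{0, int n + 1} \<in> q.E"
  using q.last_side by (simp add: add.commute)

lemma radius_lift: "{Fin (k + d * int n), \<infinity>} \<in> cover"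
  using radius lifts_cut_radius unfolding cover_def by blast

text \<open>The sides \<open>{0, 1}\<close> and \<open>{0, n + 1}\<close> of the cut polygon are no
  boundary segments of the disk; they lift to the copies of the cut radius at the two ends of the
  translate.\<close>

lemma lift_edge:
  assumes e: "{u, v} \<in> q.E" and uv: "u < v"
  shows "{lift_vertex d u, lift_vertex d v} \<in> cover"
proof (cases "{u, v} \<in> flat T")
  case True
  then obtain a where a: "a \<in> T" "a \<in> compatible" "copy1 n k a = {u, v}"
    using T_compatible unfolding flat_def by auto
  obtain x y where xy: "diagonal x y" "a = arc_of x y" using compatibleE[OF a(2)] .
  then have "{x, y} = {u, v}" using a copy1_arc_of by simp
  then have "x = u" "y = v" using uv xy(1) unfolding diagonal_def doubleton_eq_iff by auto
  then have "{lift_vertex d u, lift_vertex d v} \<in> lifts n a" using xy lifts_arc_of by simp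
  then show ?thesis using a unfolding cover_def by blast
next
  case False
  then have "{u, v} \<in> poly_sides (n + 2)" using e unfolding q.E_def by simp
  then have s: "0 \<le> u \<and> v < int (n + 2) \<and> (v = u + 1 \<or> u = 0 \<and> v = int (n + 2) - 1)"
    using poly_sides_iff[OF q.N uv] by simp
  consider "u = 0" "v = 1" | "u = 0" "v = int n + 1" | "u \<ge> 1" "v = u + 1" using s by fastforce
  then show ?thesis
  proof cases
    case 1
    then show ?thesis using radius_lift[of d] unfolding lift_vertex_def by (simp add: insert_commute)
  next
    case 2
    then show ?thesis using radius_lift[of "d + 1"] unfolding lift_vertex_def
      by (simp add: insert_commute algebra_simps)
  next
    case 3
    have "{Fin (k + u - 1 + d * int n), Fin (k + u - 1 + d * int n + 1)} \<in> cover" unfolding cover_def by blast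
    then show ?thesis using 3 unfolding lift_vertex_def by (simp add: algebra_simps)
  qed
qed

lemma coverE:
  assumes "e \<in> cover"
  obtains d u v where "u < v" "{u, v} \<in> q.E" "e = {lift_vertex d u, lift_vertex d v}"
proof -
  consider a where "a \<in> T" "e \<in> lifts n a" | s where "e = {Fin s, Fin (s + 1)}"
    using assms unfolding cover_def by blast
  then show thesis
  proof cases
    case 1
    show thesis
    proof (cases "a = Radius k")
      case True
      then obtain d where "e = {Fin (k + d * int n), \<infinity>}" using 1 unfolding True lifts_cut_radius by blast
      then have "e = {lift_vertex d 0, lift_vertex d 1}" unfolding lift_vertex_def by auto
      then show thesis using that[of 0 1 d] q_side[of 0] by simp
    next
      case False
      then have ac: "a \<in> compatible" using 1 T_compatible by auto
      obtain x y where xy: "diagonal x y" "a = arc_of x y" using compatibleE[OF ac] .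
      then obtain d where "e = {lift_vertex d x, lift_vertex d y}" using 1 lifts_arc_of by auto
      moreover have "copy1 n k a \<in> flat T" using 1 False unfolding flat_def by simp
      then have "{x, y} \<in> q.E" using q.T_edge copy1_arc_of[OF xy(1)] xy(2) by simp
      moreover have "x < y" using xy unfolding diagonal_def by auto
      ultimately show thesis using that by blast
    qed
  next
    case 2
    define d u where "d = (s - k) div int n" and "u = 1 + (s - k) mod int n"
    have n0: "int n > 0" using n by simp
    have u: "1 \<le> u" "u \<le> int n"
      using pos_mod_bound[OF n0, of "s - k"] pos_mod_sign[OF n0, of "s - k"] unfolding u_def by linarith+
    have s: "s = k + u - 1 + d * int n"
      unfolding d_def u_def using div_mult_mod_eq[of "s - k" "int n"] by linarith
    have "lift_vertex d u = Fin s" "lift_vertex d (u + 1) = Fin (s + 1)"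
      using s u unfolding lift_vertex_def by simp_all
    then have "e = {lift_vertex d u, lift_vertex d (u + 1)}" using 2 by simp
    then show thesis using that[of u "u + 1" d] q_side[of u] u by simp
  qed
qed

lemma cover_finE:
  assumes "{Fin s, Fin t} \<in> cover" "s < t"
  obtains d u v where "1 \<le> u" "u < v" "v \<le> int n + 1" "{u, v} \<in> q.E"
    "s = k + u - 1 + d * int n" "t = k + v - 1 + d * int n"
proof -
  obtain d u v where uv: "u < v" "{u, v} \<in> q.E" "{Fin s, Fin t} = {lift_vertex d u, lift_vertex d v}"
    using coverE[OF assms(1)] .
  have r: "0 \<le> u" "v \<le> int n + 1" using q_range[OF uv(2,1)] by auto
  have "u \<noteq> 0"
  proof
    assume "u = 0"
    then have "\<infinity> \<in> {Fin s, Fin t}" unfolding uv(3) lift_vertex_def by simp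
    then show False by simp
  qed
  then have "{Fin s, Fin t} = {Fin (k + u - 1 + d * int n), Fin (k + v - 1 + d * int n)}"
    using uv(3) r uv(1) unfolding lift_vertex_def by simp
  then have "s = k + u - 1 + d * int n \<and> t = k + v - 1 + d * int n"
    using assms(2) uv(1) unfolding doubleton_eq_iff by auto
  then show thesis using that[of u v d] r uv \<open>u \<noteq> 0\<close> by auto
qed

lemma cover_infinityE:
  assumes "{Fin s, \<infinity>} \<in> cover"
  obtains d v where "1 \<le> v" "v \<le> int n + 1" "{0, v} \<in> q.E" "s = k + v - 1 + d * int n"
proof -
  obtain d u v where uv: "u < v" "{u, v} \<in> q.E" "{Fin s, \<infinity>} = {lift_vertex d u, lift_vertex d v}"
    using coverE[OF assms(1)] .
  have r: "0 \<le> u" "v \<le> int n + 1" using q_range[OF uv(2,1)] by auto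
  have "u = 0"
  proof (rule ccontr)
    assume "u \<noteq> 0"
    moreover have "\<infinity> \<in> {lift_vertex d u, lift_vertex d v}" unfolding uv(3)[symmetric] by simp
    ultimately show False using r uv(1) unfolding lift_vertex_def by (simp split: if_splits)
  qed
  then have "s = k + v - 1 + d * int n"
    using uv(1,3) unfolding lift_vertex_def doubleton_eq_iff by auto
  then show thesis using that[of v d] r uv \<open>u = 0\<close> by auto
qed

lemma cover_translate:
  "{Fin s, Fin t} \<in> cover \<Longrightarrow> s < t \<Longrightarrow> {Fin (s + c * int n), Fin (t + c * int n)} \<in> cover"
  "{Fin s, \<infinity>} \<in> cover \<Longrightarrow> {Fin (s + c * int n), \<infinity>} \<in> cover"
proof -
  assume "{Fin s, Fin t} \<in> cover" "s < t"
  then obtain d u v where uv: "1 \<le> u" "u < v" "{u, v} \<in> q.E"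
    "s = k + u - 1 + d * int n" "t = k + v - 1 + d * int n" using cover_finE by metis
  have "lift_vertex (d + c) u = Fin (s + c * int n)" "lift_vertex (d + c) v = Fin (t + c * int n)"
    using uv unfolding lift_vertex_def by (simp_all add: algebra_simps)
  then show "{Fin (s + c * int n), Fin (t + c * int n)} \<in> cover"
    using lift_edge[OF uv(3,2), of "d + c"] by simp
next
  assume "{Fin s, \<infinity>} \<in> cover"
  then obtain d v where v: "1 \<le> v" "{0, v} \<in> q.E" "s = k + v - 1 + d * int n" using cover_infinityE by metis
  have "lift_vertex (d + c) v = Fin (s + c * int n)" "lift_vertex (d + c) 0 = \<infinity>"
    using v unfolding lift_vertex_def by (simp_all add: algebra_simps)
  then show "{Fin (s + c * int n), \<infinity>} \<in> cover"
    using lift_edge[OF v(2), of "d + c"] v by (simp add: insert_commute)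
qed

definition translate :: "int \<Rightarrow> int extended \<Rightarrow> int extended" where
  "translate c w = (case w of Fin s \<Rightarrow> Fin (s + c * int n) | _ \<Rightarrow> w)"

lemma cover_no_minus_infinity: "-\<infinity> \<notin> e" if e: "e \<in> cover"
proof -
  obtain d u v where "e = {lift_vertex d u, lift_vertex d v}" using coverE[OF e] by metis
  then show ?thesis unfolding lift_vertex_def by simp
qed

lemma cover_translate_iff: "{translate c x, translate c y} \<in> cover \<longleftrightarrow> {x, y} \<in> cover" if "x \<noteq> y"
proof -
  have imp: "{translate c x, translate c y} \<in> cover" if xy: "{x, y} \<in> cover" "x < y" for x y c
  proof -
    have "x \<noteq> -\<infinity>" using cover_no_minus_infinity xy by blast
    then obtain s where s: "x = Fin s" using xy(2) by (cases x) auto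
    show ?thesis
    proof (cases y)
      case (Fin t)
      then show ?thesis using cover_translate(1)[of s t c] xy s unfolding translate_def by simp
    next
      case Pinf
      then show ?thesis using cover_translate(2)[of s c] xy s unfolding translate_def by simp
    next
      case Minf
      then show ?thesis using xy by simp
    qed
  qed
  have imp': "{translate c x, translate c y} \<in> cover" if xy: "{x, y} \<in> cover" "x \<noteq> y" for x y c
    using imp[of x y c] imp[of y x c] xy by (cases "x < y") (auto simp: insert_commute)
  have inv: "translate (-c) (translate c w) = w" for c w
    unfolding translate_def by (cases w) auto
  have "translate c x \<noteq> translate c y" using inv that by metis
  then show ?thesis using imp'[of x y c] imp'[of "translate c x" "translate c y" "-c"] that inv by auto
qed

lemma disk_quiddity_periodic: "disk_quiddity n T (s + c * int n) = disk_quiddity n T s"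
proof -
  have inv: "translate (-c) (translate c w) = w" for c w
    unfolding translate_def by (cases w) auto
  have inj: "inj (translate c)" for c using inv by (metis injI)
  have tr: "translate c ` t \<in> triangles cover \<longleftrightarrow> t \<in> triangles cover" for t c
    by (rule triangles_image[OF inj cover_translate_iff]) auto
  have "{t \<in> triangles cover. Fin (s + c * int n) \<in> t} = (`) (translate c) ` {t \<in> triangles cover. Fin s \<in> t}"
  proof (intro equalityI subsetI)
    fix t assume "t \<in> {t \<in> triangles cover. Fin (s + c * int n) \<in> t}"
    then have t: "t \<in> triangles cover" "Fin (s + c * int n) \<in> t" by auto
    have "translate (-c) (Fin (s + c * int n)) = Fin s" unfolding translate_def by simp
    then have "Fin s \<in> translate (-c) ` t" using t(2) by (metis imageI)
    moreover have "translate (-c) ` t \<in> triangles cover" using t tr by simp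
    moreover have "t = translate c ` (translate (-c) ` t)" using inv[of "-c"] by (simp add: image_image)
    ultimately show "t \<in> (`) (translate c) ` {t \<in> triangles cover. Fin s \<in> t}" by blast
  next
    fix t assume "t \<in> (`) (translate c) ` {t \<in> triangles cover. Fin s \<in> t}"
    then obtain u where u: "t = translate c ` u" "u \<in> triangles cover" "Fin s \<in> u" by blast
    have "translate c (Fin s) = Fin (s + c * int n)" unfolding translate_def by simp
    then have "Fin (s + c * int n) \<in> t" using u by (metis imageI)
    then show "t \<in> {t \<in> triangles cover. Fin (s + c * int n) \<in> t}" using u tr by simp
  qed
  moreover have "inj_on ((`) (translate c)) A" for A
    using inj_image_eq_iff[OF inj] by (auto simp: inj_on_def)
  ultimately show ?thesis unfolding disk_quiddity_def disk_triangles_eq by (simp add: card_image)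
qed

text \<open>With sides included, the diameter needs no separate mention: it is the last side of the
  first copy and the image of \<open>{0, 1}\<close> in the second.\<close>

lemma tilde_edge_iff: "e \<in> t.E \<longleftrightarrow> e \<in> q.E \<or> e \<in> (`) (shift n) ` q.E"
proof
  assume "e \<in> t.E"
  then consider "e \<in> flat T" | "e \<in> (`) (shift n) ` flat T" | "e = {0, int n + 1}" | "e \<in> poly_sides (2 * n + 2)"
    unfolding t.E_def unfolding tilde_eq[OF T_compatible] by blast
  then show "e \<in> q.E \<or> e \<in> (`) (shift n) ` q.E"
  proof cases
    case 4
    then obtain u v where uv: "e = {u, v}" "u < v" using poly_sidesE[OF t.N] by blast
    then have s: "0 \<le> u \<and> v < int (2 * n + 2) \<and> (v = u + 1 \<or> u = 0 \<and> v = int (2 * n + 2) - 1)"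
      using 4 poly_sides_iff[OF t.N uv(2)] by simp
    consider "v = u + 1" "u \<le> int n" | "v = u + 1" "u \<ge> int n + 1" | "u = 0" "v = 2 * int n + 1"
      using s by fastforce
    then show ?thesis
    proof cases
      case 1
      then show ?thesis using q_side[of u] s uv by simp
    next
      case 2
      then have "e = shift n ` {u - int n, u - int n + 1}" using uv unfolding shift_def by auto
      moreover have "{u - int n, u - int n + 1} \<in> q.E" using q_side[of "u - int n"] s 2 by simp
      ultimately show ?thesis by (intro disjI2 image_eqI)
    next
      case 3
      then have "e = shift n ` {0, int n + 1}" using uv unfolding shift_def by auto
      then show ?thesis using q_last_side by (intro disjI2 image_eqI)
    qed
  next
    case 1
    then show ?thesis using q.T_edge by simp
  next
    case 2
    then obtain f where "e = shift n ` f" "f \<in> flat T" by blast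
    then show ?thesis using q.T_edge[of f] by simp
  next
    case 3
    then show ?thesis using q_last_side by simp
  qed
next
  assume "e \<in> q.E \<or> e \<in> (`) (shift n) ` q.E"
  then obtain f where f: "f \<in> q.E" "e = f \<or> e = shift n ` f" by blast
  have diam: "{0, int n + 1} \<in> t.E" unfolding t.E_def unfolding tilde_eq[OF T_compatible] by simp
  show "e \<in> t.E"
  proof (cases "f \<in> flat T")
    case True
    then show ?thesis using f(2) unfolding t.E_def unfolding tilde_eq[OF T_compatible] by blast
  next
    case False
    then have fs: "f \<in> poly_sides (n + 2)" using f unfolding q.E_def by simp
    then obtain u v where uv: "f = {u, v}" "u < v" using poly_sidesE[OF q.N] by blast
    then have s: "0 \<le> u \<and> v < int (n + 2) \<and> (v = u + 1 \<or> u = 0 \<and> v = int (n + 2) - 1)"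
      using fs poly_sides_iff[OF q.N uv(2)] by simp
    have t_side: "{u, u + 1} \<in> t.E" if "0 \<le> u" "u \<le> 2 * int n" for u using t.side[of u] that by auto
    have t_last: "{0, 2 * int n + 1} \<in> t.E" using t.last_side by (simp add: add.commute)
    consider "u = 0" "v = 1" | "u = 0" "v = int n + 1" | "u \<ge> 1" "v = u + 1" using s by fastforce
    then show ?thesis
    proof cases
      case 1
      then have "e = {0, 0 + 1} \<or> e = {0, int n + 1}" using f uv unfolding shift_def by (auto simp: add.commute)
      then show ?thesis using t_side[of 0] diam n by auto
    next
      case 2
      then have "e = {0, int n + 1} \<or> e = {0, 2 * int n + 1}" using f uv unfolding shift_def by auto
      then show ?thesis using t_last diam by auto
    next
      case 3
      then have "e = {u, u + 1} \<or> e = {u + int n, u + int n + 1}" using f uv unfolding shift_def by (auto simp: add.commute)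
      then show ?thesis using t_side[of u] t_side[of "u + int n"] s 3 by auto
    qed
  qed
qed

section \<open>The glued polygon as a window of the universal cover\<close>

lemma lift_vertex_shift: "0 \<le> m \<Longrightarrow> lift_vertex 0 (shift n m) = lift_vertex 1 m"
  unfolding lift_vertex_def shift_def by auto

text \<open>The window consists of the translates 0 and 1, which are the two copies. An edge of
  another translate can meet it only in the puncture and a boundary point at one end, and is then a
  side at \<open>0\<close>.\<close>

lemma cover_window:
  assumes xy: "0 \<le> x" "x < y" "y \<le> 2 * int n + 1"
  shows "{lift_vertex 0 x, lift_vertex 0 y} \<in> cover \<longleftrightarrow> {x, y} \<in> t.E"
proof
  assume "{x, y} \<in> t.E"
  then consider "{x, y} \<in> q.E" | f where "f \<in> q.E" "{x, y} = shift n ` f" unfolding tilde_edge_iff by blast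
  then show "{lift_vertex 0 x, lift_vertex 0 y} \<in> cover"
  proof cases
    case 1
    then show ?thesis using lift_edge xy by blast
  next
    case 2
    then obtain u v where uv: "f = {u, v}" "u < v" using q.edgeE by blast
    have "0 \<le> u" using q_range[of u v] 2 uv by auto
    have "{lift_vertex 0 x, lift_vertex 0 y} = lift_vertex 0 ` {x, y}" by simp
    also have "\<dots> = {lift_vertex 1 u, lift_vertex 1 v}"
      unfolding 2(2) uv(1) using lift_vertex_shift \<open>0 \<le> u\<close> uv(2) by simp
    finally show ?thesis using lift_edge[of u v 1] 2 uv by simp
  qed
next
  assume c: "{lift_vertex 0 x, lift_vertex 0 y} \<in> cover"
  show "{x, y} \<in> t.E"
  proof (cases "x = 0")
    case True
    then have "{Fin (k + y - 1), \<infinity>} \<in> cover" using c xy unfolding lift_vertex_def by (simp add: insert_commute)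
    then obtain d v where v: "1 \<le> v" "v \<le> int n + 1" "{0, v} \<in> q.E" "k + y - 1 = k + v - 1 + d * int n"
      using cover_infinityE by metis
    consider "d = 0" | "d = 1" | "d \<ge> 2" | "d \<le> -1" by linarith
    then show ?thesis
    proof cases
      case 1
      then show ?thesis using v True tilde_edge_iff by simp
    next
      case 2
      then have "{x, y} = shift n ` {0, v}" using v True unfolding shift_def by auto
      then show ?thesis using v tilde_edge_iff by blast
    next
      \<comment> \<open>Beyond the second translate the bounds leave only
        \<open>y = 2 * n + 1\<close>, so the edge is the last side.\<close>
      case 3
      then have "2 * int n \<le> d * int n" by (intro mult_right_mono) auto
      then have "y = 2 * int n + 1" using v xy by linarith
      then show ?thesis using t.last_side True by (simp add: add.commute)
    next
      case 4
      then have "d * int n \<le> (-1) * int n" by (intro mult_right_mono) auto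
      then have "y = 0 + 1" using v xy True by linarith
      then show ?thesis using t.side[of 0] True n by simp
    qed
  next
    case False
    then have "{Fin (k + x - 1), Fin (k + y - 1)} \<in> cover" using c xy unfolding lift_vertex_def by simp
    moreover have "k + x - 1 < k + y - 1" using xy by simp
    ultimately obtain d u v where v: "1 \<le> u" "u < v" "v \<le> int n + 1" "{u, v} \<in> q.E"
      "k + x - 1 = k + u - 1 + d * int n" "k + y - 1 = k + v - 1 + d * int n"
      using cover_finE by metis
    consider "d = 0" | "d = 1" | "d \<ge> 2" | "d \<le> -1" by linarith
    then show ?thesis
    proof cases
      case 1
      then show ?thesis using v tilde_edge_iff by simp
    next
      case 2
      then have "{x, y} = shift n ` {u, v}" using v unfolding shift_def by auto
      then show ?thesis using v tilde_edge_iff by blast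
    next
      case 3
      then have "2 * int n \<le> d * int n" by (intro mult_right_mono) auto
      then show ?thesis using v xy by linarith
    next
      case 4
      then have "d * int n \<le> (-1) * int n" by (intro mult_right_mono) auto
      then show ?thesis using v xy False by linarith
    qed
  qed
qed

lemma cover_window':
  assumes "x \<in> {0..2 * int n + 1}" "y \<in> {0..2 * int n + 1}" "x \<noteq> y"
  shows "{lift_vertex 0 x, lift_vertex 0 y} \<in> cover \<longleftrightarrow> {x, y} \<in> t.E"
  using cover_window[of x y] cover_window[of y x] assms by (cases "x < y") (auto simp: insert_commute)

lemma inj_on_lift_vertex: "inj_on (lift_vertex 0) {0..2 * int n + 1}"
  unfolding inj_on_def lift_vertex_def by auto

text \<open>Every edge stays within one translate, so an edge at a point strictly inside the window
  cannot leave it. At the two extreme boundary points this fails.\<close>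

lemma cover_neighbour:
  assumes e: "{Fin s, w} \<in> cover" "w \<noteq> Fin s" and s: "k < s" "s < k + 2 * int n"
  shows "w \<in> lift_vertex 0 ` {0..2 * int n + 1}"
proof -
  have window: "Fin t \<in> lift_vertex 0 ` {0..2 * int n + 1}" if "k \<le> t" "t \<le> k + 2 * int n" for t
    using that by (intro image_eqI[of _ _ "t - k + 1"]) (auto simp: lift_vertex_def)
  have bound: "k \<le> t \<and> t' \<le> k + 2 * int n" if b: "{Fin t, Fin t'} \<in> cover" "t < t'" "s = t \<or> s = t'" for t t'
  proof -
    obtain d u v where v: "1 \<le> u" "u < v" "v \<le> int n + 1"
      "t = k + u - 1 + d * int n" "t' = k + v - 1 + d * int n"
      using cover_finE[OF b(1,2)] by metis
    have "d \<ge> 0"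
    proof (rule ccontr)
      assume "\<not> d \<ge> 0"
      then have "d * int n \<le> (-1) * int n" by (intro mult_right_mono) auto
      then show False using v b(3) s by linarith
    qed
    moreover have "d \<le> 1"
    proof (rule ccontr)
      assume "\<not> d \<le> 1"
      then have "2 * int n \<le> d * int n" by (intro mult_right_mono) auto
      then show False using v b(3) s by linarith
    qed
    ultimately have "d = 0 \<or> d = 1" by auto
    then show ?thesis using v by auto
  qed
  show ?thesis
  proof (cases w)
    case (Fin t)
    show ?thesis
    proof (cases "s < t")
      case True
      then show ?thesis using bound[of s t] e s Fin window[of t] by simp
    next
      case False
      then have "t < s" using e Fin by auto
      then show ?thesis using bound[of t s] e s Fin window[of t] by (simp add: insert_commute)
    qed
  next
    case Pinf
    then show ?thesis by (intro image_eqI[of _ _ 0]) (auto simp: lift_vertex_def)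
  next
    case Minf
    then show ?thesis using cover_no_minus_infinity[OF e(1)] by simp
  qed
qed

text \<open>For these \<open>m\<close> all triangles upstairs lie in the window; the vertices
  \<open>1\<close> and \<open>2 * n + 1\<close> see only the triangles on one side of a cut
  radius.\<close>

lemma quiddity_window:
  assumes m: "2 \<le> m" "m \<le> 2 * int n"
  shows "disk_quiddity n T (k + m - 1) = poly_quiddity (2 * n + 2) (tilde n k T) m"
proof -
  let ?V = "{0..2 * int n + 1}"
  let ?f = "lift_vertex 0"
  have tr: "?f ` t \<in> triangles cover \<longleftrightarrow> t \<in> triangles t.E" if "t \<subseteq> ?V" for t
    by (rule triangles_image[OF inj_on_lift_vertex cover_window' that])
  have m': "?f m = Fin (k + m - 1)" "m \<in> ?V" using m unfolding lift_vertex_def by auto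
  have sub: "t \<subseteq> ?V" if t: "t \<in> triangles t.E" for t
  proof -
    obtain a b c where "a < b" "b < c" "t = {a, b, c}" "{a, b} \<in> t.E" "{b, c} \<in> t.E"
      by (rule trianglesE[OF t])
    then show ?thesis using t.edge_range[of a b] t.edge_range[of b c] by auto
  qed
  have "{t \<in> triangles cover. Fin (k + m - 1) \<in> t} = (`) ?f ` {t \<in> triangles t.E. m \<in> t}"
  proof (intro equalityI subsetI)
    fix t assume "t \<in> {t \<in> triangles cover. Fin (k + m - 1) \<in> t}"
    then have t: "t \<in> triangles cover" "Fin (k + m - 1) \<in> t" by auto
    have "w \<in> ?f ` ?V" if w: "w \<in> t" for w
    proof (cases "w = Fin (k + m - 1)")
      case True
      then show ?thesis using m' by (metis imageI)
    next
      case False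
      have "\<forall>u\<in>t. \<forall>v\<in>t. u \<noteq> v \<longrightarrow> {u, v} \<in> cover" using t(1) unfolding triangles_def by simp
      then have "{Fin (k + m - 1), w} \<in> cover" using t(2) w False by simp
      then show ?thesis by (rule cover_neighbour[OF _ False]) (use m in auto)
    qed
    then have "t \<subseteq> ?f ` ?V" by blast
    then obtain u where u: "u \<subseteq> ?V" "t = ?f ` u" by (rule subset_imageE)
    have "m \<in> u"
    proof -
      have "?f m \<in> ?f ` u" using t(2) m' u(2) by simp
      then show ?thesis using inj_on_image_mem_iff[OF inj_on_lift_vertex m'(2) u(1)] by simp
    qed
    then show "t \<in> (`) ?f ` {t \<in> triangles t.E. m \<in> t}" using tr[OF u(1)] t(1) u(2) by blast
  next
    fix t assume "t \<in> (`) ?f ` {t \<in> triangles t.E. m \<in> t}"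
    then obtain u where u: "t = ?f ` u" "u \<in> triangles t.E" "m \<in> u" by blast
    then have "Fin (k + m - 1) \<in> t" using m'(1) by (metis imageI)
    then show "t \<in> {t \<in> triangles cover. Fin (k + m - 1) \<in> t}" using u tr[OF sub[OF u(2)]] by simp
  qed
  moreover have "inj_on ((`) ?f) {t \<in> triangles t.E. m \<in> t}"
  proof (rule inj_onI)
    fix x y assume "x \<in> {t \<in> triangles t.E. m \<in> t}" "y \<in> {t \<in> triangles t.E. m \<in> t}" "?f ` x = ?f ` y"
    then show "x = y" using inj_on_image_eq_iff[OF inj_on_lift_vertex sub[of x] sub[of y]] by simp
  qed
  ultimately have "card {t \<in> triangles cover. Fin (k + m - 1) \<in> t} = card {t \<in> triangles t.E. m \<in> t}"
    by (simp add: card_image)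
  moreover have "m mod int (2 * n + 2) = m" using m by simp
  ultimately show ?thesis
    unfolding disk_quiddity_def disk_triangles_eq poly_quiddity_def t.E_def[symmetric] by simp
qed

lemma inner_window: "\<lbrakk>0 \<le> x; x < y; y \<le> int n + 1\<rbrakk> \<Longrightarrow> {x, y} \<in> t.E \<longleftrightarrow> {x, y} \<in> q.E"
proof -
  assume xy: "0 \<le> x" "x < y" "y \<le> int n + 1"
  have "{x, y} \<in> q.E" if "f \<in> q.E" "{x, y} = shift n ` f" for f
  proof -
    obtain u v where uv: "f = {u, v}" "u < v" using q.edgeE \<open>f \<in> q.E\<close> by blast
    then have u0: "0 \<le> u" using q_range[of u v] that by auto
    then have "{x, y} = {shift n u, shift n v}" "shift n u < shift n v"
      using that uv shift_less by auto
    then have "x = shift n u" "y = shift n v" using xy(2) unfolding doubleton_eq_iff by auto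
    then have "x = 0" "y = int n + 1" using xy u0 uv unfolding shift_def by (auto split: if_splits)
    then show ?thesis using q_last_side by simp
  qed
  then show ?thesis unfolding tilde_edge_iff by blast
qed

text \<open>Both numbers count translation orbits of triangles at the puncture, with representatives
  starting in \<open>{0..<n}\<close> and in \<open>{k..<k + n}\<close>; \<open>h\<close> translates
  one kind of representative to the other. As an edge stays in one translate, the far end is at most
  \<open>n + 1\<close> in polygon labels.\<close>

lemma puncture_triangles_eq: "puncture_triangles n T = card (q.inner_triangles 0 (int n + 1) 0)"
proof -
  define A where "A = {(u, v). 1 \<le> u \<and> u < v \<and> v \<le> int n + 1 \<and> {0, u, v} \<in> triangles q.E}"
  define B where "B = {(s, t). s \<in> {0..<int n} \<and> s < t \<and> {Fin s, Fin t, \<infinity>} \<in> disk_triangles n T}"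
  define h where "h = (\<lambda>(u, v). let c = (if k + u - 1 < int n then 0 else int n)
    in (k + u - 1 - c, k + v - 1 - c))"
  have PT: "{Fin s, Fin t, \<infinity>} \<in> disk_triangles n T \<longleftrightarrow>
      {Fin s, Fin t} \<in> cover \<and> {Fin t, \<infinity>} \<in> cover \<and> {Fin s, \<infinity>} \<in> cover" if "s < t" for s t
    unfolding disk_triangles_eq using triangle_sorted_iff[of "Fin s" "Fin t" \<infinity>] that by simp
  have PT_translate: "{Fin (s + c * int n), Fin (t + c * int n), \<infinity>} \<in> disk_triangles n T"
    if "s < t" "{Fin s, Fin t, \<infinity>} \<in> disk_triangles n T" for s t c
    using PT[of s t] PT[of "s + c * int n" "t + c * int n"] cover_translate that by simp
  have PT_window: "{Fin (k + u - 1), Fin (k + v - 1), \<infinity>} \<in> disk_triangles n T \<longleftrightarrow> {0, u, v} \<in> triangles q.E"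
    if "1 \<le> u" "u < v" "v \<le> int n + 1" for u v
  proof -
    have "lift_vertex 0 u = Fin (k + u - 1)" "lift_vertex 0 v = Fin (k + v - 1)" "lift_vertex 0 0 = \<infinity>"
      using that unfolding lift_vertex_def by auto
    then show ?thesis
      using PT[of "k + u - 1" "k + v - 1"] triangle_sorted_iff[of 0 u v q.E] that
        cover_window[of 0 u] cover_window[of 0 v] cover_window[of u v]
        inner_window[of 0 u] inner_window[of 0 v] inner_window[of u v]
      by (auto simp: insert_commute)
  qed
  have "bij_betw h A B"
  proof (rule bij_betw_imageI)
    show "inj_on h A"
    proof (rule inj_onI, clarify)
      fix u v x y assume "(u, v) \<in> A" "(x, y) \<in> A" "h (u, v) = h (x, y)"
      then show "u = x \<and> v = y" using k unfolding A_def h_def by (auto simp: Let_def split: if_splits)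
    qed
    show "h ` A = B"
    proof (intro equalityI subsetI)
      fix z assume "z \<in> h ` A"
      then obtain u v where z: "z = h (u, v)" and uv: "1 \<le> u" "u < v" "v \<le> int n + 1" "{0, u, v} \<in> triangles q.E"
        unfolding A_def by auto
      have *: "{Fin (k + u - 1), Fin (k + v - 1), \<infinity>} \<in> disk_triangles n T" using PT_window uv by simp
      show "z \<in> B"
      proof (cases "k + u - 1 < int n")
        case True
        then show ?thesis using * uv k unfolding z h_def B_def by (auto simp: Let_def)
      next
        case False
        then show ?thesis using PT_translate[OF _ *, of "-1"] uv k unfolding z h_def B_def by (auto simp: Let_def)
      qed
    next
      fix z assume "z \<in> B"
      then obtain s t where z: "z = (s, t)" "0 \<le> s" "s < int n" "s < t" "{Fin s, Fin t, \<infinity>} \<in> disk_triangles n T"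
        unfolding B_def by auto
      define c :: int where "c = (if s < k then 1 else 0)"
      define u v where "u = s + c * int n - k + 1" and "v = t + c * int n - k + 1"
      have u: "1 \<le> u" "u \<le> int n" using z k unfolding u_def c_def by auto
      have uv: "u < v" using z unfolding u_def v_def by auto
      have *: "{Fin (k + u - 1), Fin (k + v - 1), \<infinity>} \<in> disk_triangles n T"
        using PT_translate[OF z(4,5), of c] unfolding u_def v_def by simp
      have "v \<le> int n + 1"
      proof -
        have e: "{Fin (k + u - 1), Fin (k + v - 1)} \<in> cover" "k + u - 1 < k + v - 1"
          using PT[of "k + u - 1" "k + v - 1"] * uv by auto
        obtain d x y where xy: "1 \<le> x" "x < y" "y \<le> int n + 1"
          "k + u - 1 = k + x - 1 + d * int n" "k + v - 1 = k + y - 1 + d * int n"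
          using cover_finE[OF e] by metis
        have "d = 0" using xy u by (cases rule: multiple_cases[of d]) auto
        then show ?thesis using xy by simp
      qed
      then have "(u, v) \<in> A" using u uv * PT_window unfolding A_def by auto
      moreover have "h (u, v) = z" using z k unfolding h_def u_def v_def c_def by (auto simp: Let_def)
      ultimately show "z \<in> h ` A" by (metis imageI)
    qed
  qed
  then have "card A = card B" by (rule bij_betw_same_card)
  moreover have "bij_betw (\<lambda>(u, v). {0, u, v}) A (q.inner_triangles 0 (int n + 1) 0)"
  proof (rule bij_betw_imageI)
    show "inj_on (\<lambda>(u, v). {0, u, v}) A"
    proof (rule inj_onI, clarify)
      fix u v x y assume a: "(u, v) \<in> A" "(x, y) \<in> A" "{0, u, v} = {0, x, y}"
      then have p: "1 \<le> u" "u < v" "1 \<le> x" "x < y" unfolding A_def by auto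
      have "{u, v} = {0, u, v} - {0}" "{x, y} = {0, x, y} - {0}" using p by auto
      then have "{u, v} = {x, y}" using a(3) by simp
      then show "u = x \<and> v = y" using p unfolding doubleton_eq_iff by auto
    qed
    show "(\<lambda>(u, v). {0, u, v}) ` A = q.inner_triangles 0 (int n + 1) 0"
    proof (intro equalityI subsetI)
      fix z assume "z \<in> (\<lambda>(u, v). {0, u, v}) ` A"
      then show "z \<in> q.inner_triangles 0 (int n + 1) 0" unfolding A_def q.inner_triangles_def by auto
    next
      fix z assume "z \<in> q.inner_triangles 0 (int n + 1) 0"
      then have z: "z \<in> triangles q.E" "z \<subseteq> {0..int n + 1}" "0 \<in> z" unfolding q.inner_triangles_def by auto
      obtain a b c where abc: "a < b" "b < c" "z = {a, b, c}" by (rule trianglesE[OF z(1)])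
      then have "a = 0" "c \<le> int n + 1" using z(2,3) by auto
      then have "(b, c) \<in> A" "z = {0, b, c}" using abc z unfolding A_def by auto
      then show "z \<in> (\<lambda>(u, v). {0, u, v}) ` A" by (intro image_eqI[of _ _ "(b, c)"]) auto
    qed
  qed
  then have "card A = card (q.inner_triangles 0 (int n + 1) 0)" by (rule bij_betw_same_card)
  ultimately show ?thesis unfolding puncture_triangles_def B_def[symmetric] by simp
qed

end

section \<open>Friezes of the punctured disk\<close>

lemma wedge_ext: "(\<And>z. wedge p z = wedge q z) \<Longrightarrow> p = q"
  using wedge_def[of p "(0, 1)"] wedge_def[of p "(1, 0)"] wedge_def[of q "(0, 1)"] wedge_def[of q "(1, 0)"]
  by (auto simp: prod_eq_iff)

text \<open>Ungluing solves the two rules for the aligned rows for the left neighbour. Each quotient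
  equals an entry of \<open>F\<close>, so the rational recursion stays integral.\<close>

lemma unglue_last_eq:
  fixes F G :: pattern
  assumes rows: "\<And>j. F (int n - 1) j * F (int n - 1) (j + 1) = 1 + F (int n - 2) (j + 1)"
      "\<And>j. F (int n) j * F (int n) (j + 1) = 1 + F (int n - 2) (j + 1)"
    and pos: "\<And>j. F (int n - 1) j \<noteq> 0" "\<And>j. F (int n) j \<noteq> 0"
    and start: "F (int n) j0 = 1" "G (int n - 1) j0 = F (int n - 1) j0 * F (int n) j0"
    and G: "\<And>j. G (int n - 2) j = F (int n - 2) j"
  shows "unglue_last n G j0 m = (of_int (F (int n - 1) (j0 - int m)), of_int (F (int n) (j0 - int m)))"
proof (induction m)
  case 0
  show ?case using start by simp
next
  case (Suc m)
  define j where "j = j0 - int m - 1"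
  have quotient: "(1 + of_int c) / of_int y = (of_int x :: rat)" if "x * y = 1 + c" "y \<noteq> 0" for x y c
  proof -
    have "of_int x * of_int y = 1 + (of_int c :: rat)" using arg_cong[OF that(1), of of_int] by simp
    then show ?thesis using that(2) by (simp add: field_simps)
  qed
  have j: "j0 - int m = j + 1" "j0 - int (Suc m) = j" unfolding j_def by auto
  have "(1 + of_int (F (int n - 2) (j + 1))) / of_int (F (int n - 1) (j + 1)) = (of_int (F (int n - 1) j) :: rat)"
    by (rule quotient[OF rows(1) pos(1)])
  moreover have "(1 + of_int (F (int n - 2) (j + 1))) / of_int (F (int n) (j + 1)) = (of_int (F (int n) j) :: rat)"
    by (rule quotient[OF rows(2) pos(2)])
  ultimately show ?case using Suc G unfolding unglue_last.simps j by (simp add: Let_def)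
qed

section \<open>Vectors on the universal cover and their determinants\<close>

context cut_triangulation
begin

definition polygon_vectors :: "(int \<Rightarrow> int \<times> int) \<Rightarrow> bool" where
  "polygon_vectors p \<longleftrightarrow>
    (\<forall>x y. 0 \<le> x \<longrightarrow> x < y \<longrightarrow> y \<le> int n + 1 \<longrightarrow> wedge (p x) (p y) > 0) \<and>
    (\<forall>x y. {x, y} \<in> q.E \<longrightarrow> x < y \<longrightarrow> wedge (p x) (p y) = 1)"

definition vectors :: "int \<Rightarrow> int \<times> int" where
  "vectors = (SOME p. polygon_vectors p)"

lemma polygon_vectors: "polygon_vectors vectors"
proof -
  obtain p where "\<And>x y. 0 \<le> x \<Longrightarrow> x < y \<Longrightarrow> y < int (n + 2) \<Longrightarrow> wedge (p x) (p y) > 0"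
    "\<And>x y. {x, y} \<in> q.E \<Longrightarrow> x < y \<Longrightarrow> wedge (p x) (p y) = 1"
    using q.vectors_exist by metis
  then have "polygon_vectors p" unfolding polygon_vectors_def by auto
  then show ?thesis unfolding vectors_def by (rule someI[of polygon_vectors])
qed

lemma vectors_pos: "0 \<le> x \<Longrightarrow> x < y \<Longrightarrow> y \<le> int n + 1 \<Longrightarrow> wedge (vectors x) (vectors y) > 0"
  and vectors_unit: "{x, y} \<in> q.E \<Longrightarrow> x < y \<Longrightarrow> wedge (vectors x) (vectors y) = 1"
  using polygon_vectors unfolding polygon_vectors_def by blast+

definition apex :: "int \<times> int" where
  "apex = vectors 0"

definition twist :: int where
  "twist = int (puncture_triangles n T)"

text \<open>\<open>transvect 1\<close> is the monodromy of the vector-valued frieze around the puncture: it fixes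
  \<open>apex\<close> and carries the vector of \<open>Fin s\<close> to that of \<open>Fin (s + n)\<close>.\<close>

definition transvect :: "int \<Rightarrow> int \<times> int \<Rightarrow> int \<times> int" where
  "transvect d v = (fst v - d * twist * wedge apex v * fst apex, snd v - d * twist * wedge apex v * snd apex)"

lemma wedge_transvect: "wedge (transvect d v) (transvect d w) = wedge v w"
  unfolding transvect_def wedge_def by (simp add: algebra_simps)

lemma wedge_apex_transvect: "wedge apex (transvect d v) = wedge apex v"
  unfolding transvect_def wedge_def by (simp add: algebra_simps)

lemma transvect_add: "transvect c (transvect d v) = transvect (c + d) v"
  unfolding transvect_def[of c "transvect d v"] wedge_apex_transvect
  by (simp add: transvect_def algebra_simps)

lemma wedge_transvect_self: "wedge v (transvect 1 v) = twist * wedge apex v * wedge apex v"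
  unfolding transvect_def wedge_def by (simp add: algebra_simps)

text \<open>Division of \<open>s - k\<close> by \<open>n\<close> gives the number of turns and the
  position in the cut polygon; each turn applies the monodromy once.\<close>

definition vec :: "int \<Rightarrow> int \<times> int" where
  "vec s = transvect ((s - k) div int n) (vectors (1 + (s - k) mod int n))"

text \<open>The value attached to the radius at \<open>s\<close>; it is 1 when this radius lies in
  \<open>T\<close>.\<close>

definition height :: "int \<Rightarrow> int" where
  "height s = wedge apex (vec s)"

definition W :: "int \<Rightarrow> int \<Rightarrow> int" where
  "W s t = wedge (vec s) (vec t)"

lemma n0: "int n > 0"
  using n by simp

text \<open>The end formula of \<open>triangle_counts\<close> at vertex \<open>0\<close> reads
  \<open>vectors 1 = vectors (n + 1) + twist * apex\<close>. As \<open>apex\<close> and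
  \<open>vectors 1\<close> have determinant 1, this is the transvection; hence the constant
  \<open>twist\<close>.\<close>

lemma vectors_seam: "vectors (int n + 1) = transvect 1 (vectors 1)"
proof -
  have "(0::int) < int n + 1" by simp
  note tc = q.triangle_counts[of vectors, OF vectors_unit q_last_side this]
  have u: "wedge apex (vectors 1) = 1" using vectors_unit[OF q_side[of 0]] unfolding apex_def by simp
  have "wedge (vectors 1) z = wedge (vectors (int n + 1)) z + twist * wedge apex z" for z
    using tc unfolding twist_def puncture_triangles_eq apex_def by simp
  moreover have "wedge (transvect 1 (vectors 1)) z = wedge (vectors 1) z - twist * wedge apex z" for z
    unfolding transvect_def u by (simp add: wedge_def algebra_simps)
  ultimately show ?thesis by (intro wedge_ext) simp
qed

text \<open>The label \<open>m = n + 1\<close> is included: it also is label \<open>1\<close> of the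
  next translate, and \<open>vectors_seam\<close> makes the two readings agree.\<close>

lemma vec_eq:
  assumes m: "1 \<le> m" "m \<le> int n + 1"
  shows "vec (k + m - 1 + d * int n) = transvect d (vectors m)"
proof (cases "m = int n + 1")
  case True
  have "k + m - 1 + d * int n - k = (d + 1) * int n" using True by (simp add: algebra_simps)
  then have "vec (k + m - 1 + d * int n) = transvect (d + 1) (vectors 1)" unfolding vec_def using n0 by simp
  then show ?thesis using True vectors_seam transvect_add by simp
next
  case False
  have e: "k + m - 1 + d * int n - k = (m - 1) + d * int n" by simp
  have dm: "((m - 1) + d * int n) div int n = d" "((m - 1) + d * int n) mod int n = m - 1"
    using m False n0 by auto
  show ?thesis unfolding vec_def e dm by simp
qed

lemma positionE:
  obtains d m where "1 \<le> m" "m \<le> int n" "s = k + m - 1 + d * int n"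
proof
  show "1 \<le> 1 + (s - k) mod int n" "1 + (s - k) mod int n \<le> int n"
    using pos_mod_bound[OF n0, of "s - k"] pos_mod_sign[OF n0, of "s - k"] by linarith+
  show "s = k + (1 + (s - k) mod int n) - 1 + ((s - k) div int n) * int n"
    using div_mult_mod_eq[of "s - k" "int n"] by linarith
qed

lemma vec_period: "vec (s + c * int n) = transvect c (vec s)"
proof -
  obtain d m where m: "1 \<le> m" "m \<le> int n" "s = k + m - 1 + d * int n" by (rule positionE)
  have e: "s + c * int n = k + m - 1 + (c + d) * int n" unfolding m(3) by (simp add: algebra_simps)
  have "vec (s + c * int n) = transvect (c + d) (vectors m)"
    unfolding e by (rule vec_eq) (use m in auto)
  moreover have "vec s = transvect d (vectors m)" unfolding m(3) by (rule vec_eq) (use m in auto)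
  ultimately show ?thesis using transvect_add by simp
qed

lemma W_period: "W (s + c * int n) (t + c * int n) = W s t"
  unfolding W_def vec_period wedge_transvect ..

text \<open>This is the product of the radius value \<open>height s\<close> and the loop value
  \<open>twist * height s\<close>, that is, the glued last row.\<close>

lemma W_full_turn: "W s (s + int n) = twist * height s * height s"
  using vec_period[of s 1] unfolding W_def height_def by (simp add: wedge_transvect_self)

lemma height_period: "height (s + c * int n) = height s"
  unfolding height_def vec_period wedge_apex_transvect ..

lemma height_pos: "height s > 0"
proof -
  obtain d m where m: "1 \<le> m" "m \<le> int n" "s = k + m - 1 + d * int n" by (rule positionE)
  then show ?thesis unfolding height_def using vec_eq[of m d] vectors_pos[of 0 m, folded apex_def]
    by (simp add: wedge_apex_transvect)
qed

lemma W_edge: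
  assumes "{Fin s, Fin t} \<in> cover" "s < t"
  shows "W s t = 1"
proof -
  obtain d u v where uv: "1 \<le> u" "u < v" "v \<le> int n + 1" "{u, v} \<in> q.E"
    "s = k + u - 1 + d * int n" "t = k + v - 1 + d * int n" using cover_finE[OF assms] by metis
  then show ?thesis unfolding W_def using vec_eq[of u d] vec_eq[of v d] vectors_unit[of u v]
    by (simp add: wedge_transvect)
qed

lemma height_edge:
  assumes "{Fin s, \<infinity>} \<in> cover"
  shows "height s = 1"
proof -
  obtain d v where v: "1 \<le> v" "v \<le> int n + 1" "{0, v} \<in> q.E" "s = k + v - 1 + d * int n"
    using cover_infinityE[OF assms] by metis
  then show ?thesis unfolding height_def using vec_eq[of v d] vectors_unit[of 0 v, folded apex_def]
    by (simp add: wedge_apex_transvect)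
qed

lemma W_succ: "W s (s + 1) = 1"
proof -
  have "{Fin s, Fin (s + 1)} \<in> cover" unfolding cover_def by blast
  then show ?thesis using W_edge[of s "s + 1"] by simp
qed

lemma W_self: "W s s = 0"
  unfolding W_def by simp

lemma W_pos_within:
  assumes "1 \<le> u" "u < v" "v \<le> int n + 1"
  shows "W (k + u - 1 + d * int n) (k + v - 1 + d * int n) > 0"
  unfolding W_def using vec_eq[of u d] vec_eq[of v d] vectors_pos[of u v] assms
  by (simp add: wedge_transvect)

text \<open>If the pair runs over the seam point \<open>b\<close>, Pluecker with the puncture and
  \<open>b\<close> applies: the radius at \<open>b\<close> has height 1, and the two resulting terms
  lie within single translates.\<close>

lemma W_pos_two_copies:
  assumes s: "k + d * int n \<le> s" "s < k + (d + 1) * int n" and t: "s < t" "t \<le> k + (d + 2) * int n"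
  shows "W s t > 0"
proof (cases "t \<le> k + (d + 1) * int n")
  case True
  then show ?thesis using W_pos_within[of "s - k - d * int n + 1" "t - k - d * int n + 1" d] s t
    by (simp add: algebra_simps)
next
  case False
  define b where "b = k + (d + 1) * int n"
  have b: "s < b" "b < t" using s False unfolding b_def by auto
  have sb: "W s b > 0"
    using W_pos_within[of "s - k - d * int n + 1" "int n + 1" d] s unfolding b_def by (simp add: algebra_simps)
  have bt: "W b t > 0"
    using W_pos_within[of 1 "t - k - (d + 1) * int n + 1" "d + 1"] t b(2) unfolding b_def by (simp add: algebra_simps)
  have hb: "height b = 1" using height_edge[OF radius_lift] unfolding b_def .
  have "wedge apex (vec b) * wedge (vec s) (vec t)
    = wedge apex (vec s) * wedge (vec b) (vec t) + wedge apex (vec t) * wedge (vec s) (vec b)"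
    by (rule plucker)
  then have "W s t = height s * W b t + height t * W s b" using hb unfolding W_def height_def by simp
  then show ?thesis using sb bt height_pos[of s] height_pos[of t] by (simp add: add_pos_pos)
qed

lemma W_pos: "s < t \<Longrightarrow> t \<le> s + int n \<Longrightarrow> W s t > 0"
proof -
  assume st: "s < t" "t \<le> s + int n"
  obtain d m where m: "1 \<le> m" "m \<le> int n" "s = k + m - 1 + d * int n" by (rule positionE)
  then show ?thesis using W_pos_two_copies[of d s t] st by (simp add: algebra_simps)
qed

lemma W_plucker: "W i l * W j m = W i j * W l m + W i m * W j l"
  unfolding W_def by (rule plucker)

lemma W_diamond: "diamond (\<lambda>r j. W j (j + r + 1)) r j"
proof -
  have "W j (j + r + 1) * W (j + 1) (j + r + 1 + 1)
    = W j (j + 1) * W (j + r + 1) (j + r + 1 + 1) + W j (j + r + 1 + 1) * W (j + 1) (j + r + 1)"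
    by (rule W_plucker)
  then show ?thesis unfolding diamond_def W_succ by (simp add: algebra_simps)
qed

text \<open>Realisation of the glued polygon by restricting the vectors of the cover; it makes both
  friezes determinants of the same vectors.\<close>

definition window_vec :: "int \<Rightarrow> int \<times> int" where
  "window_vec m = (if m = 0 then apex else vec (k + m - 1))"

lemma window_vec_pos:
  assumes "0 \<le> x" "x < y" "y < int (2 * n + 2)"
  shows "wedge (window_vec x) (window_vec y) > 0"
proof (cases "x = 0")
  case True
  then show ?thesis using assms height_pos unfolding window_vec_def height_def by simp
next
  case False
  then have "W (k + x - 1) (k + y - 1) > 0"
    using W_pos_two_copies[of 0 "k + x - 1" "k + y - 1"] W_pos_two_copies[of 1 "k + x - 1" "k + y - 1"] assms
    by (cases "x \<le> int n") auto
  then show ?thesis using False assms unfolding window_vec_def W_def by simp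
qed

lemma window_vec_unit:
  assumes xy: "{x, y} \<in> t.E" "x < y"
  shows "wedge (window_vec x) (window_vec y) = 1"
proof -
  have r: "0 \<le> x" "y \<le> 2 * int n + 1" using t.edge_range[OF xy] by auto
  then have c: "{lift_vertex 0 x, lift_vertex 0 y} \<in> cover" using cover_window xy by simp
  show ?thesis
  proof (cases "x = 0")
    case True
    then have "{Fin (k + y - 1), \<infinity>} \<in> cover" using c xy unfolding lift_vertex_def by (simp add: insert_commute)
    then show ?thesis using height_edge True xy unfolding window_vec_def height_def by simp
  next
    case False
    then have "{Fin (k + x - 1), Fin (k + y - 1)} \<in> cover" using c r xy unfolding lift_vertex_def by simp
    then show ?thesis using W_edge[of "k + x - 1" "k + y - 1"] False r xy unfolding window_vec_def W_def by simp
  qed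
qed

lemma frieze_A_eq:
  assumes "-1 \<le> r" "1 \<le> j" "j + r \<le> 2 * int n"
  shows "frieze_A (2 * n + 2) (tilde n k T) r j = W (k + j - 1) (k + j + r)"
proof -
  have "0 \<le> j" "j + r + 1 \<le> int (2 * n + 2) - 1" using assms by auto
  then have "frieze_A (2 * n + 2) (tilde n k T) r j = wedge (window_vec j) (window_vec (j + r + 1))"
    using t.frieze_A_wedge[of window_vec, OF window_vec_pos window_vec_unit assms(1)] by blast
  then show ?thesis using assms unfolding window_vec_def W_def by (simp add: algebra_simps)
qed

section \<open>Quiddity sequence, frieze and glued pattern of the disk\<close>

lemma W_poly_quiddity:
  assumes m: "2 \<le> m" "m \<le> 2 * int n"
  shows "W (k + m - 2) (k + m) = int (poly_quiddity (2 * n + 2) (tilde n k T) m)"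
proof -
  have "wedge (window_vec (m - 1)) (window_vec (m - 1)) + wedge (window_vec (m + 1)) (window_vec (m - 1))
      = int (poly_quiddity (2 * n + 2) (tilde n k T) m) * wedge (window_vec m) (window_vec (m - 1))"
    using m by (intro t.quiddity_recurrence window_vec_unit) auto
  moreover have "window_vec (m - 1) = vec (k + m - 2)" "window_vec m = vec (k + m - 1)"
    "window_vec (m + 1) = vec (k + m)"
    using m unfolding window_vec_def by (simp_all add: algebra_simps)
  moreover have "wedge (vec (k + m - 2)) (vec (k + m - 1)) = 1"
    using W_succ[of "k + m - 2"] unfolding W_def by (simp add: algebra_simps)
  ultimately show ?thesis
    using wedge_swap[of "vec (k + m)" "vec (k + m - 2)"] wedge_swap[of "vec (k + m - 1)" "vec (k + m - 2)"]
    unfolding W_def by simp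
qed

text \<open>After translation the middle vertex has label \<open>m + 1\<close> between 2 and
  \<open>n + 1\<close>, which is interior to the window as \<open>n + 1 <= 2 * n\<close>. The seam
  vertex \<open>n + 1\<close> is thus covered too, which a single copy would not allow.\<close>

lemma W_quiddity: "W j (j + 2) = int (disk_quiddity n T (j + 1))"
proof -
  obtain d m where m: "1 \<le> m" "m \<le> int n" "j = k + m - 1 + d * int n" by (rule positionE)
  have "W j (j + 2) = W (k + m - 1) (k + m + 1)"
    using W_period[of "k + m - 1" d "k + m + 1"] unfolding m(3) by (simp add: algebra_simps)
  also have "\<dots> = int (poly_quiddity (2 * n + 2) (tilde n k T) (m + 1))"
    using W_poly_quiddity[of "m + 1"] m n by (simp add: algebra_simps)
  also have "\<dots> = int (disk_quiddity n T (k + m))"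
    using quiddity_window[of "m + 1"] m n by simp
  also have "disk_quiddity n T (k + m) = disk_quiddity n T (j + 1)"
    using disk_quiddity_periodic[of "k + m" d] unfolding m(3) by (simp add: algebra_simps)
  finally show ?thesis .
qed

lemma twist_pos: "twist > 0"
proof -
  have "twist * height k * height k > 0" using W_pos[of k "k + int n"] W_full_turn[of k] n by simp
  then have "twist * (height k * height k) > 0" by (simp add: mult.assoc)
  then show ?thesis using height_pos[of k] by (simp add: zero_less_mult_iff)
qed

text \<open>Pluecker for the puncture and the points \<open>j\<close>, \<open>j + 1\<close>,
  \<open>j + n\<close>; the full turn contributes a factor \<open>height j\<close>, which cancels by
  positivity.\<close>

lemma height_product: "twist * height j * height (j + 1) = 1 + W (j + 1) (j + int n)"
proof -
  have "wedge apex (vec (j + 1)) * wedge (vec j) (vec (j + int n))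
    = wedge apex (vec j) * wedge (vec (j + 1)) (vec (j + int n)) + wedge apex (vec (j + int n)) * wedge (vec j) (vec (j + 1))"
    by (rule plucker)
  then have "height (j + 1) * W j (j + int n) = height j * W (j + 1) (j + int n) + height (j + int n) * W j (j + 1)"
    unfolding height_def W_def .
  then have "height j * (twist * height j * height (j + 1)) = height j * (1 + W (j + 1) (j + int n))"
    using height_period[of j 1] unfolding W_full_turn W_succ by (simp add: algebra_simps)
  then show ?thesis using height_pos[of j] by simp
qed

text \<open>The condition under the choice operator in \<open>frieze_D\<close>; the uniqueness
  argument applies to every pattern satisfying it.\<close>

definition is_disk_frieze :: "pattern \<Rightarrow> bool" where
  "is_disk_frieze F \<longleftrightarrow> is_frieze_D n F \<and>
     (\<forall>j. glue n F 1 j = int (disk_quiddity n T (j + 1))) \<and>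
     (\<forall>j. Radius (j mod int n) \<in> T \<longrightarrow>
        {F (int n - 1) j, F (int n) j} = {1, int (puncture_triangles n T)})"

text \<open>The loop at \<open>j\<close> has \<open>twist\<close> times the value of the radius at \<open>j\<close>; the two alternate
  between the last two rows.\<close>

lemma disk_frieze_exists: "is_disk_frieze (frieze_D n T)"
proof -
  \<comment> \<open>Alternating by parity puts exactly one factor \<open>twist\<close> into each
    product of neighbours, as \<open>height_product\<close> requires. For odd \<open>n\<close> a
    full turn interchanges the two rows, which the unordered condition at radii permits.\<close>
  define F :: pattern where "F r j =
    (if r = int n - 1 then (if even j then height j else twist * height j)
     else if r = int n then (if even j then twist * height j else height j)
     else W j (j + r + 1))" for r j
  have low: "F r j = W j (j + r + 1)" if "r \<le> int n - 2" for r j using that unfolding F_def by simp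
  have prod: "F (int n - 1) j * F (int n) j = W j (j + int n)" for j
    unfolding F_def W_full_turn by simp
  have gl: "glue n F r j = W j (j + r + 1)" if "r \<le> int n - 1" for r j
    using that prod[of j] low[of r j] unfolding glue_def by (cases "r = int n - 1") auto
  have "is_frieze_D n F" unfolding is_frieze_D_def
  proof (intro conjI allI ballI)
    fix j
    show "F (-1) j = 0" using low[of "-1" j] n W_self by simp
    show "F 0 j = 1" using low[of 0 j] n W_succ by simp
  next
    fix r j assume r: "r \<in> {1..int n}"
    show "F r j > 0"
    proof (cases "r \<le> int n - 2")
      case True
      then show ?thesis using low W_pos[of j "j + r + 1"] r by simp
    next
      case False
      then show ?thesis using r height_pos[of j] twist_pos unfolding F_def by auto
    qed
  next
    fix r j assume r: "r \<in> {0..int n - 3}"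
    then show "diamond F r j" using W_diamond[of r j] low unfolding diamond_def by simp
  next
    fix j
    have hp: "twist * height j * height (j + 1) - F (int n - 2) (j + 1) = 1"
      using height_product[of j] low[of "int n - 2" "j + 1"] by (simp add: algebra_simps)
    show "F (int n - 1) j * F (int n - 1) (j + 1) - F (int n - 2) (j + 1) = 1"
      using hp unfolding F_def by (cases "even j") (simp_all add: algebra_simps)
    show "F (int n) j * F (int n) (j + 1) - F (int n - 2) (j + 1) = 1"
      using hp unfolding F_def by (cases "even j") (simp_all add: algebra_simps)
    show "F (int n - 2) j * F (int n - 2) (j + 1) - F (int n - 3) (j + 1) * F (int n - 1) j * F (int n) j = 1"
      using W_diamond[of "int n - 2" j] low[of "int n - 2"] low[of "int n - 3"] prod[of j]
      unfolding diamond_def by (simp add: algebra_simps)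
  qed
  moreover have "glue n F 1 j = int (disk_quiddity n T (j + 1))" for j
    using gl[of 1 j] W_quiddity[of j] n by (simp add: algebra_simps)
  moreover have "{F (int n - 1) j, F (int n) j} = {1, int (puncture_triangles n T)}" if r: "Radius (j mod int n) \<in> T" for j
  proof -
    have "{Fin j, \<infinity>} \<in> lifts n (Radius (j mod int n))" by auto
    then have "{Fin j, \<infinity>} \<in> cover" using r unfolding cover_def by blast
    then have "height j = 1" by (rule height_edge)
    then show ?thesis unfolding F_def twist_def by auto
  qed
  ultimately have "is_disk_frieze F" unfolding is_disk_frieze_def by simp
  then show ?thesis unfolding frieze_D_def is_disk_frieze_def by (rule someI[where x = F])
qed

text \<open>The third rule for the last rows is the ordinary diamond rule for their product, so the
  glued pattern satisfies diamonds through row \<open>n - 2\<close> and is determined by its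
  quiddity row. Interchanging the last two rows leaves it unchanged.\<close>

lemma glue_disk_frieze:
  assumes F: "is_disk_frieze F" and r: "-1 \<le> r" "r \<le> int n - 1"
  shows "glue n F r j = W j (j + r + 1)"
proof (cases "r = -1")
  case True
  then show ?thesis using F n W_self unfolding is_disk_frieze_def is_frieze_D_def glue_def by simp
next
  case False
  have D: "is_frieze_D n F" using F unfolding is_disk_frieze_def by simp
  have low: "glue n F r j = F r j" if "r \<le> int n - 2" for r j using that unfolding glue_def by simp
  have top: "glue n F (int n - 1) j = F (int n - 1) j * F (int n) j" for j unfolding glue_def by simp
  have diam: "diamond (glue n F) r j" if r: "1 \<le> r" "r \<le> int n - 2" for r j
  proof (cases "r = int n - 2")
    case True
    have "F (int n - 2) j * F (int n - 2) (j + 1) - F (int n - 3) (j + 1) * F (int n - 1) j * F (int n) j = 1"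
      using D unfolding is_frieze_D_def by blast
    then have "diamond (glue n F) (int n - 2) j"
      using low[of "int n - 2"] low[of "int n - 3"] top[of j] unfolding diamond_def by (simp add: algebra_simps)
    then show ?thesis using True by simp
  next
    case False
    then have "diamond F r j" using D r unfolding is_frieze_D_def by auto
    then show ?thesis using low False r unfolding diamond_def by simp
  qed
  have "W j (j + int (nat r) + 1) = glue n F (int (nat r)) j"
  proof (rule diamond_unique[where F = "\<lambda>r j. W j (j + r + 1)" and G = "glue n F" and R = "int n - 2"])
    show "W j (j + 0 + 1) = glue n F 0 j" for j
      using low[of 0 j] D n W_succ unfolding is_frieze_D_def by simp
    show "W j (j + 1 + 1) = glue n F 1 j" for j
      using F W_quiddity[of j] unfolding is_disk_frieze_def by (simp add: add.assoc)
    show "diamond (\<lambda>r j. W j (j + r + 1)) r j \<and> diamond (glue n F) r j" if "1 \<le> r" "r \<le> int n - 2" for r j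
      using W_diamond diam that by blast
    show "W j (j + r + 1) \<noteq> 0" if "0 \<le> r" "r < int n - 2" for r j
      using W_pos[of j "j + r + 1"] that by simp
    show "int (nat r) \<le> int n - 2 + 1" using r False by simp
  qed
  then show ?thesis using r False by simp
qed

lemma frieze_A_glue:
  assumes "(r, j) \<in> glued_region n"
  shows "frieze_A (2 * n + 2) (tilde n k T) r j = glue n (frieze_D n T) r (k + j - 1)"
  using frieze_A_eq[of r j] glue_disk_frieze[OF disk_frieze_exists, of r "k + j - 1"] assms
  unfolding glued_region_def by (simp add: algebra_simps)

lemma region_pattern_eq:
  assumes r: "-1 \<le> r" "r \<le> int n - 1"
  shows "region_pattern n k (frieze_A (2 * n + 2) (tilde n k T)) r j = W j (j + r + 1)"
proof -
  obtain d m where m: "1 \<le> m" "m \<le> int n" "j = k + m - 1 + d * int n" by (rule positionE)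
  have e: "j - k = (m - 1) + d * int n" using m by simp
  have "(j - k) mod int n = m - 1" unfolding e using m(1,2) by auto
  then have "region_pattern n k (frieze_A (2 * n + 2) (tilde n k T)) r j
    = frieze_A (2 * n + 2) (tilde n k T) r m"
    unfolding region_pattern_def by simp
  also have "\<dots> = W (k + m - 1) (k + m + r)" using frieze_A_eq[of r m] r m by simp
  also have "\<dots> = W j (j + r + 1)"
    using W_period[of "k + m - 1" d "k + m + r"] unfolding m(3) by (simp add: algebra_simps)
  finally show ?thesis .
qed

lemma unglue_region:
  assumes j0: "j0 mod int n = k mod int n"
  shows "\<exists>F \<in> {frieze_D n T, swap_last n (frieze_D n T)}.
    \<forall>r j. -1 \<le> r \<and> r \<le> int n \<and> j \<le> j0 \<longrightarrow>
      unglue n (region_pattern n k (frieze_A (2 * n + 2) (tilde n k T))) j0 r j = of_int (F r j)"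
proof -
  define G where "G = region_pattern n k (frieze_A (2 * n + 2) (tilde n k T))"
  define H where "H = frieze_D n T"
  have H: "is_disk_frieze H" unfolding H_def by (rule disk_frieze_exists)
  then have D: "is_frieze_D n H" unfolding is_disk_frieze_def by simp
  have gl: "G r j = glue n H r j" if "-1 \<le> r" "r \<le> int n - 1" for r j
    using glue_disk_frieze[OF H that] region_pattern_eq[OF that] unfolding G_def by simp
  have "j0 mod int n = k" using j0 k by simp
  then have one: "{H (int n - 1) j0, H (int n) j0} = {1, int (puncture_triangles n T)}"
    using H radius unfolding is_disk_frieze_def by simp
  \<comment> \<open>The radius at \<open>j0\<close> lies in the triangulation, so one of the aligned
    entries is 1; \<open>F\<close> is the representative with this 1 in row \<open>n\<close>, where
    \<open>unglue\<close> places it.\<close>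
  define F where "F = (if H (int n) j0 = 1 then H else swap_last n H)"
  have F1: "F (int n) j0 = 1" using one unfolding F_def swap_last_def doubleton_eq_iff by auto
  have Flow: "F r j = H r j" if "r \<le> int n - 2" for r j using that unfolding F_def swap_last_def by simp
  have Fprod: "F (int n - 1) j * F (int n) j = H (int n - 1) j * H (int n) j" for j
    unfolding F_def swap_last_def by simp
  have Drows: "H (int n - 1) j * H (int n - 1) (j + 1) = 1 + H (int n - 2) (j + 1)"
    "H (int n) j * H (int n) (j + 1) = 1 + H (int n - 2) (j + 1)" for j
  proof -
    have "H (int n - 1) j * H (int n - 1) (j + 1) - H (int n - 2) (j + 1) = 1"
      "H (int n) j * H (int n) (j + 1) - H (int n - 2) (j + 1) = 1"
      using D unfolding is_frieze_D_def by blast+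
    then show "H (int n - 1) j * H (int n - 1) (j + 1) = 1 + H (int n - 2) (j + 1)"
      "H (int n) j * H (int n) (j + 1) = 1 + H (int n - 2) (j + 1)" by linarith+
  qed
  have Dpos: "H (int n - 1) j \<noteq> 0" "H (int n) j \<noteq> 0" for j
  proof -
    have "H (int n - 1) j > 0" "H (int n) j > 0" using D n unfolding is_frieze_D_def by auto
    then show "H (int n - 1) j \<noteq> 0" "H (int n) j \<noteq> 0" by auto
  qed
  have last: "unglue_last n G j0 m = (of_int (F (int n - 1) (j0 - int m)), of_int (F (int n) (j0 - int m)))" for m
  proof (rule unglue_last_eq)
    show "F (int n - 1) j * F (int n - 1) (j + 1) = 1 + F (int n - 2) (j + 1)" for j
      using Drows[of j] Flow[of "int n - 2"] unfolding F_def swap_last_def by simp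
    show "F (int n) j * F (int n) (j + 1) = 1 + F (int n - 2) (j + 1)" for j
      using Drows[of j] Flow[of "int n - 2"] unfolding F_def swap_last_def by simp
    show "F (int n - 1) j \<noteq> 0" "F (int n) j \<noteq> 0" for j
      using Dpos[of j] unfolding F_def swap_last_def by simp_all
    show "G (int n - 1) j0 = F (int n - 1) j0 * F (int n) j0"
      using gl[of "int n - 1" j0] Fprod[of j0] unfolding glue_def by simp
    show "G (int n - 2) j = F (int n - 2) j" for j
      using gl[of "int n - 2" j] Flow[of "int n - 2" j] n unfolding glue_def by simp
  qed (rule F1)
  have "unglue n G j0 r j = of_int (F r j)" if "-1 \<le> r" "r \<le> int n" "j \<le> j0" for r j
  proof (cases "r \<le> int n - 2")
    case True
    then show ?thesis using gl[of r j] Flow[of r j] that unfolding unglue_def glue_def by simp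
  next
    case False
    \<comment> \<open>The truncation by \<open>nat\<close> is harmless because \<open>j\<close> is
      at most \<open>j0\<close>.\<close>
    have "j0 - int (nat (j0 - j)) = j" using that by simp
    moreover have "r = int n - 1 \<or> r = int n" using that False by auto
    ultimately show ?thesis using last[of "nat (j0 - j)"] unfolding unglue_def by auto
  qed
  moreover have "F \<in> {frieze_D n T, swap_last n (frieze_D n T)}" unfolding F_def H_def by simp
  ultimately show ?thesis unfolding G_def by blast
qed

end

theorem theorem3p9:
  fixes n :: nat and k :: int and T :: "disk_arc set" and a :: disk_arc
  assumes "n \<ge> 1"
    and "disk_triangulation n T"
    and "Radius k \<in> T"
    and "a \<in> T" and "a \<noteq> Radius k" and "\<not> self_folded_radius T a"
  shows "let N = 2 * n + 2;
             T' = mutate (disk_triangulation n) a T;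
             M = mutate (poly_triangulation N) (copy1 n k a)
                   (mutate (poly_triangulation N) (copy2 n k a) (tilde n k T))
         in tilde n k T' = M \<and>
            (\<forall>(r, j) \<in> glued_region n.
               frieze_A N M r j = glue n (frieze_D n T') r (k + j - 1)) \<and>
            (\<forall>j0. j0 mod int n = k mod int n \<longrightarrow>
               (\<exists>F \<in> {frieze_D n T', swap_last n (frieze_D n T')}.
                  \<forall>r j. -1 \<le> r \<and> r \<le> int n \<and> j \<le> j0 \<longrightarrow>
                    unglue n (region_pattern n k (frieze_A N M)) j0 r j = of_int (F r j)))"
proof -
  have arcs: "T \<subseteq> disk_arcs n"
    using assms(2) unfolding disk_triangulation_def is_triangulation_def by simp
  then have k: "0 \<le> k" "k < int n" using assms(3) unfolding disk_arcs_def by auto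
  \<comment> \<open>With one boundary point every curve around the boundary has length 1 and is no
    arc, so \<open>Radius 0\<close> is the only arc and \<open>a\<close> could not exist.\<close>
  have "n \<noteq> 1"
  proof
    assume "n = 1"
    then have "a = Radius 0" "k = 0" using arcs assms(4) k unfolding disk_arcs_def disk_len_def by auto
    then show False using assms(5) by simp
  qed
  then interpret cut_disk n k using assms(1) k by unfold_locales auto
  define T' where "T' = mutate (disk_triangulation n) a T"
  note mut = tilde_mutate[OF assms(2-5), folded T'_def]
  interpret m: cut_triangulation n k T' using mut by unfold_locales auto
  \<comment> \<open>By part (a) the twice mutated triangulation is \<open>tilde n k T'\<close>, so
    the remaining claims concern the single triangulation \<open>T'\<close>.\<close>
  show ?thesis
    unfolding Let_def T'_def[symmetric] mut(3)[symmetric]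
    using m.frieze_A_glue m.unglue_region by blast
qed

end
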